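(* Let $y_0\in L^2(D)$ be deterministic, and for $s\in(0,L)$ let $y=y(s):\Omega\times[0,T]\to L^2(D)$ be the $L^2(D)$-valued stochastic process solving the state equation $dy(t)+\mathcal{L}^sy(t)\,dt=dW(t)$ in $D\times[0,T]$, $y(\cdot,0)=y_0$. Then the following holds for almost every fixed realisation $\omega\in\Omega$. (i) (Necessary condition) If $\bar s=\bar s(\omega)$ is an optimal parameter for (IP) and $y(\bar s)$ is the associated unique solution of the state equation, then $$\int_0^T\int_D\big(y(\bar s)-y_{D_T}\big)\,\partial_sy(\bar s)\,dx\,dt+\Phi'(\bar s)=0.$$ (ii) (Sufficient condition) If $\bar s=\bar s(\omega)\in(0,L)$ satisfies the equation in (i) and if in addition $$\int_0^T\int_D\Big[\big(\partial_sy(\bar s)\big)^2+\big(y(\bar s)-y_{D_T}\big)\,\partial^2_{ss}y(\bar s)\Big]\,dx\,dt+\Phi''(\bar s)>0,$$ then $\bar s$ is optimal for (IP).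
   Context: $D\subset\mathbb{R}$ is a bounded open domain, $T>0$, $D_T=D\times(0,T)$, and $\langle\cdot,\cdot\rangle$ is the scalar product of $L^2(D)$. $\mathcal{L}:D(\mathcal{L})\subset L^2(D)\to L^2(D)$ is a densely defined, linear, self-adjoint, positive operator with compact inverse; $\{e_j\}_{j\in\mathbb{N}}$ is an orthonormal basis of $L^2(D)$ of eigenfunctions, $\mathcal{L}e_j=\lambda_je_j$, with $\alpha<\lambda_1\le\lambda_2\le\dots$, $\lambda_j\to+\infty$, for some $\alpha>0$; $\mathcal{L}^sv=\sum_j\lambda_j^s\langle v,e_j\rangle e_j$ for $s>0$. $(\Omega,\mathcal{F},\mathbb{P})$ is a probability space with a normal filtration $\mathcal{F}_t$, and $W$ is an adapted $L^2(D)$-valued $Q$-Wiener process, with $Q$ linear, bounded, self-adjoint, positive semidefinite, $Qe_j=\mu_je_j$ and $\sum_j\mu_j<+\infty$; $W(x,t)=\sum_j\sqrt{\mu_j}\,e_j(x)B_j(t)$ with $\{B_j\}$ i.i.d. standard real Brownian motions. The solution of the state equation is the process $$y(s)(x,t)=\sum_{j=1}^{+\infty}y_j(t,s)e_j(x),\qquad y_j(t,s)=\langle y_0,e_j\rangle e^{-\lambda_j^st}+\sqrt{\mu_j}\int_0^te^{-\lambda_j^s(t-\tau)}\,dB_j(\tau),$$ and $\partial_sy(s)=\sum_j\partial_sy_j(\cdot,s)e_j$, $\partial^2_{ss}y(s)=\sum_j\partial_{ss}y_j(\cdot,s)e_j$ are its derivatives in the parameter $s$, which are elements of $L^2(\Omega,L^2(D\times[0,T]))$.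 $y_{D_T}\in L^2(D_T)$ is a given target function. The penalty function $\Phi\in C^2(0,L)$, $L\in(0,+\infty]$, is non-negative with $\lim_{s\to0^+}\Phi(s)=+\infty=\lim_{s\to L^-}\Phi(s)$. The identification problem (IP), for fixed $\omega\in\Omega$, is to minimize over $s\in(0,L)$ the cost $$\mathcal{J}(y(s),s,\omega)=\frac12\int_0^T\int_D|y(s)(x,t,\omega)-y_{D_T}(x,t)|^2\,dx\,dt+\Phi(s),$$ where $y(s)$ is the solution of the state equation; a minimizer $\bar s=\bar s(\omega)$ is called optimal for (IP).
   Formalization: "Optimal" is taken to mean local minimizer of the cost over (0,L) in both parts; with global minimizers (ii) fails, e.g. for y_0=0, Q=0 and a penalty Φ with two nondegenerate wells of different depth. *)

theory Defs
  imports "HOL-Probability.Probability"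
begin

section \<open>Square-integrable functions\<close>

text \<open>An element of \<open>L\<^sup>2(M)\<close> is represented by a measurable square-integrable function;
  the classes are recovered by reading equalities almost everywhere.\<close>

definition L2 :: "'a measure \<Rightarrow> ('a \<Rightarrow> real) set" where
  "L2 M = {f. f \<in> borel_measurable M \<and> integrable M (\<lambda>x. (f x)\<^sup>2)}"

definition L2_inner :: "'a measure \<Rightarrow> ('a \<Rightarrow> real) \<Rightarrow> ('a \<Rightarrow> real) \<Rightarrow> real" where
  "L2_inner M f g = (LINT x|M. f x * g x)"

definition L2_norm :: "'a measure \<Rightarrow> ('a \<Rightarrow> real) \<Rightarrow> real" where
  "L2_norm M f = sqrt (L2_inner M f f)"

definition L2_eq :: "'a measure \<Rightarrow> ('a \<Rightarrow> real) \<Rightarrow> ('a \<Rightarrow> real) \<Rightarrow> bool" where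
  "L2_eq M f g \<longleftrightarrow> (AE x in M. f x = g x)"

text \<open>The norm is only meaningful on \<open>L2 M\<close> (the integral of a non-integrable function is
  \<open>0\<close>), hence the explicit membership conditions below.\<close>

definition L2_tendsto :: "'a measure \<Rightarrow> (nat \<Rightarrow> 'a \<Rightarrow> real) \<Rightarrow> ('a \<Rightarrow> real) \<Rightarrow> bool" where
  "L2_tendsto M f g \<longleftrightarrow> (\<forall>n. f n \<in> L2 M) \<and> g \<in> L2 M \<and>
     (\<lambda>n. L2_norm M (\<lambda>x. f n x - g x)) \<longlonglongrightarrow> 0"

definition L2_sums :: "'a measure \<Rightarrow> (nat \<Rightarrow> 'a \<Rightarrow> real) \<Rightarrow> ('a \<Rightarrow> real) \<Rightarrow> bool" where
  "L2_sums M f g \<longleftrightarrow> L2_tendsto M (\<lambda>n x. \<Sum>j<n. f j x) g"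

text \<open>The sum of an \<open>L\<^sup>2\<close>-convergent series, unique up to equality almost everywhere.\<close>

definition L2_suminf :: "'a measure \<Rightarrow> (nat \<Rightarrow> 'a \<Rightarrow> real) \<Rightarrow> 'a \<Rightarrow> real" where
  "L2_suminf M f = (SOME g. L2_sums M f g)"

definition orthonormal_basis :: "'a measure \<Rightarrow> (nat \<Rightarrow> 'a \<Rightarrow> real) \<Rightarrow> bool" where
  "orthonormal_basis M e \<longleftrightarrow>
     (\<forall>j. e j \<in> L2 M) \<and>
     (\<forall>i j. L2_inner M (e i) (e j) = (if i = j then 1 else 0)) \<and>
     (\<forall>f\<in>L2 M. L2_sums M (\<lambda>j x. L2_inner M f (e j) * e j x) f)"


section \<open>Linear operators on \<open>L\<^sup>2\<close>\<close>

text \<open>An operator is a domain \<open>S\<close> together with a map \<open>A\<close> on representatives, both compatible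
  with equality almost everywhere.\<close>

definition linear_operator ::
    "'a measure \<Rightarrow> ('a \<Rightarrow> real) set \<Rightarrow> (('a \<Rightarrow> real) \<Rightarrow> 'a \<Rightarrow> real) \<Rightarrow> bool" where
  "linear_operator M S A \<longleftrightarrow>
     S \<subseteq> L2 M \<and> A ` S \<subseteq> L2 M \<and>
     (\<forall>f\<in>S. \<forall>g\<in>L2 M. L2_eq M f g \<longrightarrow> g \<in> S \<and> L2_eq M (A f) (A g)) \<and>
     (\<forall>f\<in>S. \<forall>g\<in>S. \<forall>a b. (\<lambda>x. a * f x + b * g x) \<in> S \<and>
        L2_eq M (A (\<lambda>x. a * f x + b * g x)) (\<lambda>x. a * A f x + b * A g x))"

definition L2_dense :: "'a measure \<Rightarrow> ('a \<Rightarrow> real) set \<Rightarrow> bool" where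
  "L2_dense M S \<longleftrightarrow> (\<forall>f\<in>L2 M. \<forall>\<epsilon>>0. \<exists>g\<in>S. L2_norm M (\<lambda>x. f x - g x) < \<epsilon>)"

text \<open>The left-hand side says that \<open>(g, h)\<close> lies in the graph of the adjoint of \<open>A\<close>.\<close>

definition self_adjoint ::
    "'a measure \<Rightarrow> ('a \<Rightarrow> real) set \<Rightarrow> (('a \<Rightarrow> real) \<Rightarrow> 'a \<Rightarrow> real) \<Rightarrow> bool" where
  "self_adjoint M S A \<longleftrightarrow>
     (\<forall>g\<in>L2 M. \<forall>h\<in>L2 M.
        (\<forall>f\<in>S. L2_inner M (A f) g = L2_inner M f h) \<longleftrightarrow> (g \<in> S \<and> L2_eq M (A g) h))"

definition positive_operator ::
    "'a measure \<Rightarrow> ('a \<Rightarrow> real) set \<Rightarrow> (('a \<Rightarrow> real) \<Rightarrow> 'a \<Rightarrow> real) \<Rightarrow> bool" where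
  "positive_operator M S A \<longleftrightarrow>
     (\<forall>f\<in>S. \<not> L2_eq M f (\<lambda>_. 0) \<longrightarrow> L2_inner M (A f) f > 0)"

definition positive_semidefinite ::
    "'a measure \<Rightarrow> ('a \<Rightarrow> real) set \<Rightarrow> (('a \<Rightarrow> real) \<Rightarrow> 'a \<Rightarrow> real) \<Rightarrow> bool" where
  "positive_semidefinite M S A \<longleftrightarrow> (\<forall>f\<in>S. L2_inner M (A f) f \<ge> 0)"

definition bounded_operator ::
    "'a measure \<Rightarrow> ('a \<Rightarrow> real) set \<Rightarrow> (('a \<Rightarrow> real) \<Rightarrow> 'a \<Rightarrow> real) \<Rightarrow> bool" where
  "bounded_operator M S A \<longleftrightarrow> (\<exists>C. \<forall>f\<in>S. L2_norm M (A f) \<le> C * L2_norm M f)"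

text \<open>\<open>A\<close> is a bijection of \<open>S\<close> onto \<open>L\<^sup>2\<close>, and its inverse maps every bounded sequence
  \<open>A u\<^sub>n\<close> to a sequence \<open>u\<^sub>n\<close> with a convergent subsequence.\<close>

definition has_compact_inverse ::
    "'a measure \<Rightarrow> ('a \<Rightarrow> real) set \<Rightarrow> (('a \<Rightarrow> real) \<Rightarrow> 'a \<Rightarrow> real) \<Rightarrow> bool" where
  "has_compact_inverse M S A \<longleftrightarrow>
     (\<forall>f\<in>S. L2_eq M (A f) (\<lambda>_. 0) \<longrightarrow> L2_eq M f (\<lambda>_. 0)) \<and>
     (\<forall>g\<in>L2 M. \<exists>f\<in>S. L2_eq M (A f) g) \<and>
     (\<forall>u C. (\<forall>n. u n \<in> S \<and> L2_norm M (A (u n)) \<le> C) \<longrightarrow>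
        (\<exists>r :: nat \<Rightarrow> nat. \<exists>g. strict_mono r \<and> L2_tendsto M (u \<circ> r) g))"


section \<open>Brownian motion, Wiener processes and the stochastic integral\<close>

definition normal_filtration :: "'w measure \<Rightarrow> (real \<Rightarrow> 'w measure) \<Rightarrow> bool" where
  "normal_filtration M F \<longleftrightarrow>
     (\<forall>t\<ge>0. subalgebra M (F t)) \<and>
     (\<forall>s t. 0 \<le> s \<and> s \<le> t \<longrightarrow> sets (F s) \<subseteq> sets (F t)) \<and>
     (\<forall>t\<ge>0. sets (F t) = (\<Inter>u\<in>{t<..}. sets (F u))) \<and>
     null_sets M \<subseteq> sets (F 0)"

text \<open>\<open>X\<close> has law \<open>N(0, v)\<close>, the Dirac mass at \<open>0\<close> if \<open>v = 0\<close>.\<close>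

definition centered_gaussian :: "'w measure \<Rightarrow> ('w \<Rightarrow> real) \<Rightarrow> real \<Rightarrow> bool" where
  "centered_gaussian M X v \<longleftrightarrow> X \<in> borel_measurable M \<and> v \<ge> 0 \<and>
     (if v = 0 then AE \<omega> in M. X \<omega> = 0
      else distributed M lborel X (normal_density 0 (sqrt v)))"

definition brownian_motion :: "'w measure \<Rightarrow> (real \<Rightarrow> 'w \<Rightarrow> real) \<Rightarrow> bool" where
  "brownian_motion M B \<longleftrightarrow>
     (\<forall>t\<ge>0. B t \<in> borel_measurable M) \<and>
     (AE \<omega> in M. B 0 \<omega> = 0) \<and>
     (AE \<omega> in M. continuous_on {0..} (\<lambda>t. B t \<omega>)) \<and>
     (\<forall>s t. 0 \<le> s \<and> s < t \<longrightarrow> centered_gaussian M (\<lambda>\<omega>. B t \<omega> - B s \<omega>) (t - s)) \<and>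
     (\<forall>n. \<forall>p :: nat \<Rightarrow> real. 0 \<le> p 0 \<and> mono_on {..n} p \<longrightarrow>
        prob_space.indep_vars M (\<lambda>_. borel) (\<lambda>i \<omega>. B (p (Suc i)) \<omega> - B (p i) \<omega>) {..<n})"

text \<open>The processes are independent as random elements of the path space.\<close>

definition independent_brownian_motions ::
    "'w measure \<Rightarrow> (nat \<Rightarrow> real \<Rightarrow> 'w \<Rightarrow> real) \<Rightarrow> bool" where
  "independent_brownian_motions M B \<longleftrightarrow>
     (\<forall>j. brownian_motion M (B j)) \<and>
     prob_space.indep_vars M (\<lambda>_. \<Pi>\<^sub>M t\<in>{0..}. borel) (\<lambda>j \<omega>. \<lambda>t\<in>{0..}. B j t \<omega>) UNIV"

text \<open>\<open>W t \<omega>\<close> is an element of the Hilbert space \<open>L\<^sup>2(N)\<close>, whose Borel \<open>\<sigma>\<close>-algebra is generated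
  by the functionals \<open>\<langle>\<cdot>, h\<rangle>\<close>.\<close>

definition Q_wiener_process ::
    "'w measure \<Rightarrow> (real \<Rightarrow> 'w measure) \<Rightarrow> 'a measure \<Rightarrow> (('a \<Rightarrow> real) \<Rightarrow> 'a \<Rightarrow> real) \<Rightarrow>
     (real \<Rightarrow> 'w \<Rightarrow> 'a \<Rightarrow> real) \<Rightarrow> bool" where
  "Q_wiener_process M F N Q W \<longleftrightarrow>
     (\<forall>t\<ge>0. \<forall>\<omega>\<in>space M. W t \<omega> \<in> L2 N) \<and>
     (\<forall>t\<ge>0. \<forall>h\<in>L2 N. (\<lambda>\<omega>. L2_inner N (W t \<omega>) h) \<in> borel_measurable (F t)) \<and>
     (AE \<omega> in M. L2_eq N (W 0 \<omega>) (\<lambda>_. 0)) \<and>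
     (AE \<omega> in M. \<forall>t\<ge>0.
        ((\<lambda>r. L2_norm N (\<lambda>x. W r \<omega> x - W t \<omega> x)) \<longlongrightarrow> 0) (at t within {0..})) \<and>
     (\<forall>s t. 0 \<le> s \<and> s < t \<longrightarrow>
        (\<forall>h\<in>L2 N. centered_gaussian M (\<lambda>\<omega>. L2_inner N (\<lambda>x. W t \<omega> x - W s \<omega> x) h)
           ((t - s) * L2_inner N (Q h) h)) \<and>
        prob_space.indep_set M (sets (F s))
          (sigma_sets (space M)
             {(\<lambda>\<omega>. L2_inner N (\<lambda>x. W t \<omega> x - W s \<omega> x) h) -` A \<inter> space M |h A.
                h \<in> L2 N \<and> A \<in> sets borel}))"

text \<open>The step function with value \<open>c i\<close> on \<open>(p i, p (i + 1)]\<close>, and its integral against \<open>B\<close>.\<close>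

definition step_function :: "nat \<Rightarrow> (nat \<Rightarrow> real) \<Rightarrow> (nat \<Rightarrow> real) \<Rightarrow> real \<Rightarrow> real" where
  "step_function n p c \<tau> = (\<Sum>i<n. c i * indicator {p i<..p (Suc i)} \<tau>)"

definition step_integral ::
    "nat \<Rightarrow> (nat \<Rightarrow> real) \<Rightarrow> (nat \<Rightarrow> real) \<Rightarrow> (real \<Rightarrow> 'w \<Rightarrow> real) \<Rightarrow> 'w \<Rightarrow> real" where
  "step_integral n p c B \<omega> = (\<Sum>i<n. c i * (B (p (Suc i)) \<omega> - B (p i) \<omega>))"

text \<open>\<open>X\<close> is a version of the Ito integral over \<open>[0, t]\<close> of the deterministic integrand
  \<open>f \<in> L\<^sup>2(0, t)\<close>. By the Ito isometry \<open>X\<close> is unique up to almost sure equality.\<close>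

definition has_ito_integral ::
    "'w measure \<Rightarrow> (real \<Rightarrow> 'w \<Rightarrow> real) \<Rightarrow> (real \<Rightarrow> real) \<Rightarrow> ('w \<Rightarrow> real) \<Rightarrow> real \<Rightarrow> bool" where
  "has_ito_integral M B f X t \<longleftrightarrow>
     (\<exists>n p c.
        (\<forall>k::nat. p k 0 = 0 \<and> p k (n k) = t \<and> mono_on {..n k} (p k)) \<and>
        L2_tendsto (restrict_space lborel {0..t}) (\<lambda>k. step_function (n k) (p k) (c k)) f \<and>
        L2_tendsto M (\<lambda>k. step_integral (n k) (p k) (c k) B) X)"


section \<open>The state equation\<close>

definition C2_on :: "real set \<Rightarrow> (real \<Rightarrow> real) \<Rightarrow> bool" where
  "C2_on I f \<longleftrightarrow>
     (\<forall>s\<in>I. f field_differentiable (at s)) \<and>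
     (\<forall>s\<in>I. deriv f field_differentiable (at s)) \<and>
     continuous_on I (deriv (deriv f))"

text \<open>The interval \<open>(0, L)\<close>, where \<open>L = \<infinity>\<close> is allowed.\<close>

definition params :: "ereal \<Rightarrow> real set" where
  "params L = {s. 0 < s \<and> ereal s < L}"

text \<open>\<open>z t s\<close> is a version of the coefficient
    \<open>a e\<^bsup>-l\<^sup>s t\<^esup> + \<surd>m \<integral>\<^sub>0\<^sup>t e\<^bsup>-l\<^sup>s (t - \<tau>)\<^esup> dB(\<tau>)\<close>,
  that is, of the solution of \<open>dz + l\<^sup>s z dt = \<surd>m dB\<close>, \<open>z(0) = a\<close>. For each \<open>(t, s)\<close> the stochastic
  integral is determined only up to a null set; statements about fixed realisations in which
  \<open>s\<close> varies need a version that is regular in \<open>s\<close> and jointly measurable in \<open>(\<omega>, t)\<close>. One such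
  version is obtained by writing the integral, through integration by parts, as
    \<open>B(t) - l\<^sup>s \<integral>\<^sub>0\<^sup>t e\<^bsup>-l\<^sup>s (t - \<tau>)\<^esup> B(\<tau>) d\<tau>\<close>.\<close>

definition state_coefficient ::
    "'w measure \<Rightarrow> real \<Rightarrow> ereal \<Rightarrow> real \<Rightarrow> real \<Rightarrow> real \<Rightarrow> (real \<Rightarrow> 'w \<Rightarrow> real) \<Rightarrow>
     (real \<Rightarrow> real \<Rightarrow> 'w \<Rightarrow> real) \<Rightarrow> bool" where
  "state_coefficient M T L a l m B z \<longleftrightarrow>
     (\<forall>s\<in>params L. \<forall>t\<in>{0..T}. \<exists>X.
        has_ito_integral M B (\<lambda>\<tau>. exp (- (l powr s) * (t - \<tau>))) X t \<and>
        (AE \<omega> in M. z t s \<omega> = a * exp (- (l powr s) * t) + sqrt m * X \<omega>)) \<and>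
     (\<forall>s\<in>params L. (\<lambda>(\<omega>, t). z t s \<omega>) \<in> borel_measurable (M \<Otimes>\<^sub>M restrict_space borel {0..T})) \<and>
     (AE \<omega> in M. \<forall>t\<in>{0..T}. C2_on (params L) (\<lambda>s. z t s \<omega>))"

definition space_measure :: "real set \<Rightarrow> real measure" where
  "space_measure D = restrict_space lborel D"

definition cylinder_measure :: "real set \<Rightarrow> real \<Rightarrow> (real \<times> real) measure" where
  "cylinder_measure D T = restrict_space lborel D \<Otimes>\<^sub>M restrict_space lborel {0<..<T}"

text \<open>For a realisation \<open>\<omega>\<close>, the solution \<open>y(s) = \<Sum>\<^sub>j y\<^sub>j(\<cdot>, s) e\<^sub>j\<close> of the state equation as an
  element of \<open>L\<^sup>2(D\<^sub>T)\<close>, and its first and second derivatives in the parameter \<open>s\<close>.\<close>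

definition state ::
    "real set \<Rightarrow> real \<Rightarrow> (nat \<Rightarrow> real \<Rightarrow> real) \<Rightarrow> (nat \<Rightarrow> real \<Rightarrow> real \<Rightarrow> 'w \<Rightarrow> real) \<Rightarrow>
     real \<Rightarrow> 'w \<Rightarrow> real \<times> real \<Rightarrow> real" where
  "state D T e z s \<omega> =
     L2_suminf (cylinder_measure D T) (\<lambda>j (x, t). z j t s \<omega> * e j x)"

definition state_ds ::
    "real set \<Rightarrow> real \<Rightarrow> (nat \<Rightarrow> real \<Rightarrow> real) \<Rightarrow> (nat \<Rightarrow> real \<Rightarrow> real \<Rightarrow> 'w \<Rightarrow> real) \<Rightarrow>
     real \<Rightarrow> 'w \<Rightarrow> real \<times> real \<Rightarrow> real" where
  "state_ds D T e z s \<omega> =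
     L2_suminf (cylinder_measure D T) (\<lambda>j (x, t). deriv (\<lambda>r. z j t r \<omega>) s * e j x)"

definition state_dss ::
    "real set \<Rightarrow> real \<Rightarrow> (nat \<Rightarrow> real \<Rightarrow> real) \<Rightarrow> (nat \<Rightarrow> real \<Rightarrow> real \<Rightarrow> 'w \<Rightarrow> real) \<Rightarrow>
     real \<Rightarrow> 'w \<Rightarrow> real \<times> real \<Rightarrow> real" where
  "state_dss D T e z s \<omega> =
     L2_suminf (cylinder_measure D T) (\<lambda>j (x, t). deriv (deriv (\<lambda>r. z j t r \<omega>)) s * e j x)"


section \<open>The identification problem\<close>

definition penalty :: "ereal \<Rightarrow> (real \<Rightarrow> real) \<Rightarrow> bool" where
  "penalty L \<Phi> \<longleftrightarrow>
     C2_on (params L) \<Phi> \<and>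
     (\<forall>s\<in>params L. \<Phi> s \<ge> 0) \<and>
     filterlim \<Phi> at_top (at_right 0) \<and>
     filterlim \<Phi> at_top (filtercomap ereal (at_left L))"

definition cost ::
    "real set \<Rightarrow> real \<Rightarrow> (real \<times> real \<Rightarrow> real) \<Rightarrow> (real \<Rightarrow> real) \<Rightarrow>
     (real \<times> real \<Rightarrow> real) \<Rightarrow> real \<Rightarrow> real" where
  "cost D T y\<^sub>D \<Phi> y s =
     1 / 2 * (LINT t:{0<..<T}|lborel. LINT x:D|lborel. \<bar>y (x, t) - y\<^sub>D (x, t)\<bar>\<^sup>2) + \<Phi> s"

text \<open>Minimizers are understood locally. First and second order conditions at a single
  parameter cannot detect global minimality: for \<open>y\<^sub>0 = 0\<close> and \<open>Q = 0\<close> the cost is \<open>\<Phi>\<close> plus a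
  constant, and \<open>\<Phi>\<close> may have two wells of different depth. For a necessary condition the
  local notion is the more general one, by the lemma that follows.\<close>

definition optimal :: "ereal \<Rightarrow> (real \<Rightarrow> real) \<Rightarrow> real \<Rightarrow> bool" where
  "optimal L J s \<longleftrightarrow> s \<in> params L \<and>
     (\<exists>\<delta>>0. \<forall>r\<in>params L. \<bar>r - s\<bar> < \<delta> \<longrightarrow> J s \<le> J r)"

lemma global_minimizer_imp_optimal:
  assumes "s \<in> params L" and "\<And>r. r \<in> params L \<Longrightarrow> J s \<le> J r"
  shows "optimal L J s"
  using assms unfolding optimal_def by (auto intro: exI[of _ 1])

end

theory Submission
  imports Defs "HOL-Computational_Algebra.Polynomial"
begin

text \<open>
  Put \<open>\<kappa> = \<lambda>\<^sub>j\<^sup>s\<close>. For almost every realisation each coefficient is, for almost every \<open>t\<close> and all \<open>s\<close>,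
    \<open>y\<^sub>j(t, s) = e\<^bsup>-\<kappa>t\<^esup> (a\<^sub>j + \<surd>\<mu>\<^sub>j B\<^sub>j(t)) + \<surd>\<mu>\<^sub>j \<integral>\<^sub>0\<^sup>t \<kappa> e\<^bsup>-\<kappa>u\<^esup> (B\<^sub>j(t) - B\<^sub>j(t - u)) du\<close>:
  equality holds almost surely for fixed \<open>(t, s)\<close>, Fubini and countability give it for rational \<open>s\<close>, and
  continuity in \<open>s\<close> gives the rest. Every derivative in \<open>s\<close> costs a factor \<open>ln \<lambda>\<^sub>j\<close>, which
  \<open>\<Sum>\<^sub>j \<mu>\<^sub>j < \<infinity>\<close> cannot absorb if \<open>B\<^sub>j\<close> is only estimated by its supremum. But \<open>x\<^bsup>n\<^esup> e\<^bsup>-x\<^esup>\<close> is bounded by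
  \<open>C x\<^bsup>-5/4\<^esup>\<close> for all \<open>n \<ge> 0\<close>, so that all derivatives of the kernel are at most \<open>C \<bar>ln \<lambda>\<^sub>j\<bar>\<^bsup>k\<^esup> \<kappa>\<^bsup>-1/4\<^esup> u\<^bsup>-5/4\<^esup>\<close>,
  where \<open>\<bar>ln \<lambda>\<^sub>j\<bar>\<^bsup>k\<^esup> \<kappa>\<^bsup>-1/4\<^esup>\<close> is bounded locally uniformly in \<open>s\<close>, and by Cauchy--Schwarz
    \<open>(\<integral> u\<^bsup>-5/4\<^esup> \<bar>B\<^sub>j(t) - B\<^sub>j(t - u)\<bar> du)\<^sup>2 \<le> C \<integral> u\<^bsup>-7/4\<^esup> \<bar>B\<^sub>j(t) - B\<^sub>j(t - u)\<bar>\<^sup>2 du\<close>,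
  whose expectation is finite. Hence almost surely the derivatives of \<open>y\<^sub>j\<close> up to order three are dominated,
  locally uniformly in \<open>s\<close>, by functions \<open>H\<^sub>j(t)\<close> with \<open>\<Sum>\<^sub>j \<parallel>H\<^sub>j\<parallel>\<^sup>2 < \<infinity>\<close>. By Parseval \<open>s \<mapsto> y(s)\<close> is then
  twice differentiable in \<open>L\<^sup>2(D\<^sub>T)\<close>, so the cost is twice differentiable, and both claims reduce
  to calculus in one variable.
\<close>

section \<open>Square-integrable functions\<close>

lemma L2_measurable: "f \<in> L2 M \<Longrightarrow> f \<in> borel_measurable M"
  by (simp add: L2_def)

lemma L2_integrable_mult:
  assumes "f \<in> L2 M" "g \<in> L2 M"
  shows "integrable M (\<lambda>x. f x * g x)"
proof (rule Bochner_Integration.integrable_bound)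
  show "integrable M (\<lambda>x. (f x)\<^sup>2 + (g x)\<^sup>2)"
    using assms by (simp add: L2_def)
  show "(\<lambda>x. f x * g x) \<in> borel_measurable M"
    using assms by (auto simp: L2_def)
  have "\<bar>a * b\<bar> \<le> a\<^sup>2 + b\<^sup>2" for a b :: real
  proof -
    have "2 * (\<bar>a\<bar> * \<bar>b\<bar>) \<le> a\<^sup>2 + b\<^sup>2"
      using sum_squares_bound[of "\<bar>a\<bar>" "\<bar>b\<bar>"] by simp
    moreover have "0 \<le> \<bar>a\<bar> * \<bar>b\<bar>" by simp
    ultimately show ?thesis unfolding abs_mult by linarith
  qed
  then show "AE x in M. norm (f x * g x) \<le> norm ((f x)\<^sup>2 + (g x)\<^sup>2)"
    by (auto simp: abs_mult)
qed

lemma L2_add: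
  assumes "f \<in> L2 M" "g \<in> L2 M"
  shows "(\<lambda>x. f x + g x) \<in> L2 M"
proof -
  have "integrable M (\<lambda>x. (f x)\<^sup>2 + (g x)\<^sup>2 + 2 * (f x * g x))"
    using assms L2_integrable_mult[OF assms] by (simp add: L2_def)
  moreover have "(\<lambda>x. (f x)\<^sup>2 + (g x)\<^sup>2 + 2 * (f x * g x)) = (\<lambda>x. (f x + g x)\<^sup>2)"
    by (auto simp: power2_eq_square algebra_simps)
  ultimately show ?thesis
    using assms by (auto simp: L2_def)
qed

lemma L2_scale: "f \<in> L2 M \<Longrightarrow> (\<lambda>x. c * f x) \<in> L2 M"
  by (auto simp: L2_def power_mult_distrib)

lemma L2_diff:
  assumes "f \<in> L2 M" "g \<in> L2 M"
  shows "(\<lambda>x. f x - g x) \<in> L2 M"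
  using L2_add[OF assms(1) L2_scale[OF assms(2), of "-1"]] by simp

lemma L2_sum: "(\<And>i. i \<in> I \<Longrightarrow> f i \<in> L2 M) \<Longrightarrow> (\<lambda>x. \<Sum>i\<in>I. f i x) \<in> L2 M"
proof (induction I rule: infinite_finite_induct)
  case (insert i I)
  then show ?case by (simp add: L2_add)
qed (simp_all add: L2_def)

lemma L2_bounded:
  assumes "f \<in> borel_measurable M" "g \<in> L2 M" "AE x in M. \<bar>f x\<bar> \<le> \<bar>g x\<bar>"
  shows "f \<in> L2 M"
proof -
  have "integrable M (\<lambda>x. (f x)\<^sup>2)"
  proof (rule Bochner_Integration.integrable_bound)
    show "integrable M (\<lambda>x. (g x)\<^sup>2)" using assms by (simp add: L2_def)
    show "AE x in M. norm ((f x)\<^sup>2) \<le> norm ((g x)\<^sup>2)"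
      using assms(3) by eventually_elim (simp add: abs_le_square_iff)
  qed (use assms in simp)
  then show ?thesis using assms by (simp add: L2_def)
qed

section \<open>Inner product, norm and the Cauchy--Schwarz inequality\<close>

lemma L2_inner_commute: "L2_inner M f g = L2_inner M g f"
  by (simp add: L2_inner_def mult.commute)

lemma L2_inner_self: "L2_inner M f f = (LINT x|M. (f x)\<^sup>2)"
  by (simp add: L2_inner_def power2_eq_square)

lemma L2_inner_self_nonneg: "0 \<le> L2_inner M f f"
  by (simp add: L2_inner_self)

lemma L2_norm_nonneg: "0 \<le> L2_norm M f"
  by (simp add: L2_norm_def L2_inner_self_nonneg)

lemma L2_norm_power2: "(L2_norm M f)\<^sup>2 = L2_inner M f f"
  by (simp add: L2_norm_def L2_inner_self_nonneg)

lemma L2_inner_add_left: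
  "\<lbrakk>f \<in> L2 M; g \<in> L2 M; h \<in> L2 M\<rbrakk> \<Longrightarrow> L2_inner M (\<lambda>x. f x + g x) h = L2_inner M f h + L2_inner M g h"
  by (simp add: L2_inner_def distrib_right L2_integrable_mult)

lemma L2_inner_diff_left:
  "\<lbrakk>f \<in> L2 M; g \<in> L2 M; h \<in> L2 M\<rbrakk> \<Longrightarrow> L2_inner M (\<lambda>x. f x - g x) h = L2_inner M f h - L2_inner M g h"
  by (simp add: L2_inner_def left_diff_distrib L2_integrable_mult)

lemma L2_inner_scale_left: "L2_inner M (\<lambda>x. c * f x) h = c * L2_inner M f h"
  by (simp add: L2_inner_def mult.assoc)

lemma L2_inner_add_right:
  "\<lbrakk>f \<in> L2 M; g \<in> L2 M; h \<in> L2 M\<rbrakk> \<Longrightarrow> L2_inner M h (\<lambda>x. f x + g x) = L2_inner M h f + L2_inner M h g"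
  by (simp add: L2_inner_commute[of M h] L2_inner_add_left)

lemma L2_inner_diff_right:
  "\<lbrakk>f \<in> L2 M; g \<in> L2 M; h \<in> L2 M\<rbrakk> \<Longrightarrow> L2_inner M h (\<lambda>x. f x - g x) = L2_inner M h f - L2_inner M h g"
  by (simp add: L2_inner_commute[of M h] L2_inner_diff_left)

lemma L2_inner_scale_right: "L2_inner M h (\<lambda>x. c * f x) = c * L2_inner M h f"
  by (simp add: L2_inner_commute[of M h] L2_inner_scale_left)

lemma L2_inner_sum_left:
  "\<lbrakk>\<And>i. i \<in> I \<Longrightarrow> f i \<in> L2 M; h \<in> L2 M\<rbrakk> \<Longrightarrow> L2_inner M (\<lambda>x. \<Sum>i\<in>I. f i x) h = (\<Sum>i\<in>I. L2_inner M (f i) h)"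
  by (simp add: L2_inner_def sum_distrib_right L2_integrable_mult)

lemma L2_inner_sum_right:
  "\<lbrakk>\<And>i. i \<in> I \<Longrightarrow> f i \<in> L2 M; h \<in> L2 M\<rbrakk> \<Longrightarrow> L2_inner M h (\<lambda>x. \<Sum>i\<in>I. f i x) = (\<Sum>i\<in>I. L2_inner M h (f i))"
  by (simp add: L2_inner_commute[of M h] L2_inner_sum_left)

lemma L2_norm_scale: "L2_norm M (\<lambda>x. c * f x) = \<bar>c\<bar> * L2_norm M f"
  by (simp add: L2_norm_def L2_inner_scale_left L2_inner_scale_right real_sqrt_mult flip: mult.assoc)

lemma L2_norm_diff_commute: "L2_norm M (\<lambda>x. f x - g x) = L2_norm M (\<lambda>x. g x - f x)"
  by (simp add: L2_norm_def L2_inner_self power2_commute)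

text \<open>The squared norm of \<open>f - r * g\<close> is a nonnegative quadratic polynomial in
  \<open>r\<close>; its value at the minimum \<open>r = p / b\<close> gives the inequality.\<close>

lemma L2_inner_Cauchy_Schwarz:
  assumes "f \<in> L2 M" "g \<in> L2 M"
  shows "(L2_inner M f g)\<^sup>2 \<le> L2_inner M f f * L2_inner M g g"
proof -
  define a b p where "a = L2_inner M f f" and "b = L2_inner M g g" and "p = L2_inner M f g"
  have *: "0 \<le> a - 2 * r * p + r\<^sup>2 * b" for r
  proof -
    have "0 \<le> L2_inner M (\<lambda>x. f x - r * g x) (\<lambda>x. f x - r * g x)"
      by (rule L2_inner_self_nonneg)
    also have "\<dots> = a - 2 * r * p + r\<^sup>2 * b"
      using assms L2_scale[OF assms(2), of r] L2_diff[OF assms(1) L2_scale[OF assms(2), of r]]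
      by (simp add: L2_inner_diff_left L2_inner_diff_right L2_inner_scale_left L2_inner_scale_right
          L2_inner_commute[of M g f] a_def b_def p_def power2_eq_square algebra_simps)
    finally show ?thesis .
  qed
  have ab: "0 \<le> a" "0 \<le> b" by (simp_all add: a_def b_def L2_inner_self_nonneg)
  have "p\<^sup>2 \<le> a * b"
  proof (cases "b = 0")
    case True
    have "p = 0"
    proof (rule ccontr)
      assume "p \<noteq> 0"
      \<comment> \<open>With \<open>b = 0\<close> the quadratic is affine in \<open>r\<close>, and
        at \<open>r = (a + 1) / p\<close> it equals \<open>- a - 2\<close>, which is
        negative.\<close>
      then show False using *[of "(a + 1) / p"] ab(1) True by simp
    qed
    then show ?thesis using True by simp
  next
    case False
    then have "b > 0" using ab by simp
    then show ?thesis using *[of "p / b"] by (simp add: field_simps power2_eq_square)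
  qed
  then show ?thesis by (simp add: a_def b_def p_def)
qed

lemma L2_inner_abs_le:
  assumes "f \<in> L2 M" "g \<in> L2 M"
  shows "\<bar>L2_inner M f g\<bar> \<le> L2_norm M f * L2_norm M g"
proof -
  have "sqrt ((L2_inner M f g)\<^sup>2) \<le> sqrt (L2_inner M f f * L2_inner M g g)"
    using L2_inner_Cauchy_Schwarz[OF assms] by (rule real_sqrt_le_mono)
  then show ?thesis by (simp add: L2_norm_def real_sqrt_mult)
qed

lemma L2_norm_triangle:
  assumes "f \<in> L2 M" "g \<in> L2 M"
  shows "L2_norm M (\<lambda>x. f x + g x) \<le> L2_norm M f + L2_norm M g"
proof (rule power2_le_imp_le)
  have "(L2_norm M (\<lambda>x. f x + g x))\<^sup>2 = L2_inner M f f + L2_inner M g g + 2 * L2_inner M f g"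
    using assms L2_add[OF assms]
    by (simp add: L2_norm_power2 L2_inner_add_left L2_inner_add_right L2_inner_commute[of M g f])
  also have "\<dots> \<le> (L2_norm M f + L2_norm M g)\<^sup>2"
    using L2_inner_abs_le[OF assms] by (simp add: power2_sum L2_norm_power2)
  finally show "(L2_norm M (\<lambda>x. f x + g x))\<^sup>2 \<le> (L2_norm M f + L2_norm M g)\<^sup>2" .
qed (simp add: L2_norm_nonneg)

section \<open>Convergence in the mean of sequences and series\<close>

lemma L2_tendsto_inner:
  assumes f: "L2_tendsto M f g" and h: "h \<in> L2 M"
  shows "(\<lambda>n. L2_inner M (f n) h) \<longlonglongrightarrow> L2_inner M g h"
proof -
  have mem: "f n \<in> L2 M" "g \<in> L2 M" for n using f by (auto simp: L2_tendsto_def)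
  have "(\<lambda>n. L2_norm M (\<lambda>x. f n x - g x) * L2_norm M h) \<longlonglongrightarrow> 0 * L2_norm M h"
    using f by (intro tendsto_mult_right) (simp add: L2_tendsto_def)
  then have lim: "(\<lambda>n. L2_norm M (\<lambda>x. f n x - g x) * L2_norm M h) \<longlonglongrightarrow> 0" by simp
  have "(\<lambda>n. L2_inner M (f n) h - L2_inner M g h) \<longlonglongrightarrow> 0"
  proof (rule tendsto_rabs_zero_cancel, rule tendsto_sandwich[OF _ _ tendsto_const lim])
    show "\<forall>\<^sub>F n in sequentially. \<bar>L2_inner M (f n) h - L2_inner M g h\<bar> \<le> L2_norm M (\<lambda>x. f n x - g x) * L2_norm M h"
    proof (intro always_eventually allI)
      fix n
      show "\<bar>L2_inner M (f n) h - L2_inner M g h\<bar> \<le> L2_norm M (\<lambda>x. f n x - g x) * L2_norm M h"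
        using L2_inner_abs_le[OF L2_diff[OF mem(1)[of n] mem(2)] h] L2_inner_diff_left[OF mem(1)[of n] mem(2) h]
        by simp
    qed
  qed simp
  then show ?thesis by (simp add: LIM_zero_iff)
qed

lemma L2_tendsto_norm:
  assumes "L2_tendsto M f g"
  shows "(\<lambda>n. L2_norm M (f n)) \<longlonglongrightarrow> L2_norm M g"
proof -
  have mem: "f n \<in> L2 M" "g \<in> L2 M" for n using assms by (auto simp: L2_tendsto_def)
  have "(\<lambda>n. L2_norm M (f n) - L2_norm M g) \<longlonglongrightarrow> 0"
  proof (rule tendsto_rabs_zero_cancel, rule tendsto_sandwich[OF _ _ tendsto_const])
    show "\<forall>\<^sub>F n in sequentially. \<bar>L2_norm M (f n) - L2_norm M g\<bar> \<le> L2_norm M (\<lambda>x. f n x - g x)"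
    proof (intro always_eventually allI)
      fix n
      show "\<bar>L2_norm M (f n) - L2_norm M g\<bar> \<le> L2_norm M (\<lambda>x. f n x - g x)"
        using L2_norm_triangle[OF L2_diff[OF mem(1)[of n] mem(2)] mem(2)]
          L2_norm_triangle[OF L2_diff[OF mem(2) mem(1)[of n]] mem(1)[of n]]
          L2_norm_diff_commute[of M "f n" g] by simp
    qed
  qed (use assms in \<open>simp_all add: L2_tendsto_def\<close>)
  then show ?thesis by (simp add: LIM_zero_iff)
qed

lemma L2_tendsto_add:
  assumes "L2_tendsto M f f'" "L2_tendsto M g g'"
  shows "L2_tendsto M (\<lambda>n x. f n x + g n x) (\<lambda>x. f' x + g' x)"
proof -
  have mem: "f n \<in> L2 M" "f' \<in> L2 M" "g n \<in> L2 M" "g' \<in> L2 M" for n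
    using assms by (auto simp: L2_tendsto_def)
  have lim: "(\<lambda>n. L2_norm M (\<lambda>x. f n x - f' x) + L2_norm M (\<lambda>x. g n x - g' x)) \<longlonglongrightarrow> 0"
    using tendsto_add[of "\<lambda>n. L2_norm M (\<lambda>x. f n x - f' x)" 0 _ "\<lambda>n. L2_norm M (\<lambda>x. g n x - g' x)" 0] assms
    by (simp add: L2_tendsto_def)
  have "(\<lambda>n. L2_norm M (\<lambda>x. f n x + g n x - (f' x + g' x))) \<longlonglongrightarrow> 0"
  proof (rule tendsto_sandwich[OF _ _ tendsto_const lim])
    show "\<forall>\<^sub>F n in sequentially. L2_norm M (\<lambda>x. f n x + g n x - (f' x + g' x))
        \<le> L2_norm M (\<lambda>x. f n x - f' x) + L2_norm M (\<lambda>x. g n x - g' x)"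
    proof (intro always_eventually allI)
      fix n
      show "L2_norm M (\<lambda>x. f n x + g n x - (f' x + g' x))
        \<le> L2_norm M (\<lambda>x. f n x - f' x) + L2_norm M (\<lambda>x. g n x - g' x)"
        using L2_norm_triangle[OF L2_diff[OF mem(1)[of n] mem(2)] L2_diff[OF mem(3)[of n] mem(4)]]
        by (simp add: algebra_simps)
    qed
  qed (simp add: L2_norm_nonneg)
  then show ?thesis using mem by (simp add: L2_tendsto_def L2_add)
qed

lemma L2_tendsto_scale:
  assumes "L2_tendsto M f g"
  shows "L2_tendsto M (\<lambda>n x. c * f n x) (\<lambda>x. c * g x)"
proof -
  have "(\<lambda>n. \<bar>c\<bar> * L2_norm M (\<lambda>x. f n x - g x)) \<longlonglongrightarrow> \<bar>c\<bar> * 0"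
    using assms by (intro tendsto_mult_left) (simp add: L2_tendsto_def)
  then show ?thesis using assms
    by (simp add: L2_tendsto_def L2_scale L2_norm_scale flip: right_diff_distrib)
qed

lemma L2_sums_add:
  assumes "L2_sums M f f'" "L2_sums M g g'"
  shows "L2_sums M (\<lambda>j x. f j x + g j x) (\<lambda>x. f' x + g' x)"
  using L2_tendsto_add[OF assms[unfolded L2_sums_def]] by (simp add: L2_sums_def sum.distrib)

lemma L2_sums_scale:
  assumes "L2_sums M f g"
  shows "L2_sums M (\<lambda>j x. c * f j x) (\<lambda>x. c * g x)"
  using L2_tendsto_scale[OF assms[unfolded L2_sums_def], of c] by (simp add: L2_sums_def sum_distrib_left)

lemma L2_sums_diff:
  assumes "L2_sums M f f'" "L2_sums M g g'"
  shows "L2_sums M (\<lambda>j x. f j x - g j x) (\<lambda>x. f' x - g' x)"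
  using L2_sums_add[OF assms(1) L2_sums_scale[OF assms(2), of "-1"]] by simp

section \<open>Finite measures and completeness\<close>

lemma (in finite_measure) L2_integrable:
  assumes "f \<in> L2 M"
  shows "integrable M f"
proof -
  have "(\<lambda>_. 1) \<in> L2 M" by (simp add: L2_def)
  from L2_integrable_mult[OF assms this] show ?thesis by simp
qed

text \<open>Cauchy--Schwarz against the constant function 1. It turns Cauchy sequences in mean
  square into Cauchy sequences in mean, from which an almost everywhere convergent subsequence is
  extracted.\<close>

lemma (in finite_measure) L1_le_L2_norm:
  assumes "f \<in> L2 M"
  shows "(LINT x|M. \<bar>f x\<bar>) \<le> L2_norm M f * sqrt (measure M (space M))"
proof -
  have "(\<lambda>x. \<bar>f x\<bar>) \<in> L2 M" "(\<lambda>_. 1) \<in> L2 M" using assms by (auto simp: L2_def)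
  from L2_inner_abs_le[OF this] show ?thesis
    by (simp add: L2_norm_def L2_inner_def)
qed

text \<open>Riesz--Fischer: a subsequence converges almost everywhere, and Fatou's lemma turns this
  into convergence in the mean.\<close>

lemma (in finite_measure) L2_complete:
  fixes f :: "nat \<Rightarrow> 'a \<Rightarrow> real"
  assumes f: "\<And>n. f n \<in> L2 M"
    and C: "\<And>\<epsilon>. \<epsilon> > 0 \<Longrightarrow> \<exists>N. \<forall>m\<ge>N. \<forall>n\<ge>N. L2_norm M (\<lambda>x. f m x - f n x) < \<epsilon>"
  shows "\<exists>g. L2_tendsto M f g"
proof -
  have [measurable]: "f n \<in> borel_measurable M" for n using f by (simp add: L2_def)
  have L1: "\<exists>N. \<forall>i\<ge>N. \<forall>j\<ge>N. LINT x|M. norm (f i x - f j x) < \<epsilon>" if "\<epsilon> > 0" for \<epsilon>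
  proof -
    \<comment> \<open>The summand 1 keeps the divisor positive when the whole space has measure
      0.\<close>
    define c where "c = sqrt (measure M (space M)) + 1"
    have "c > 0" by (simp add: c_def add_nonneg_pos)
    from C[of "\<epsilon> / c"] \<open>c > 0\<close> that obtain N where
      N: "\<And>m n. m \<ge> N \<Longrightarrow> n \<ge> N \<Longrightarrow> L2_norm M (\<lambda>x. f m x - f n x) < \<epsilon> / c" by auto
    show ?thesis
    proof (intro exI[of _ N] allI impI)
      fix i j assume "i \<ge> N" "j \<ge> N"
      have "(LINT x|M. norm (f i x - f j x)) \<le> L2_norm M (\<lambda>x. f i x - f j x) * sqrt (measure M (space M))"
        using L1_le_L2_norm[OF L2_diff[OF f[of i] f[of j]]] by simp
      also have "\<dots> \<le> L2_norm M (\<lambda>x. f i x - f j x) * c"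
        by (intro mult_left_mono) (auto simp: c_def L2_norm_nonneg)
      also have "\<dots> < \<epsilon>" using N[OF \<open>i \<ge> N\<close> \<open>j \<ge> N\<close>] \<open>c > 0\<close> by (simp add: field_simps)
      finally show "(LINT x|M. norm (f i x - f j x)) < \<epsilon>" .
    qed
  qed
  from cauchy_L1_AE_cauchy_subseq[of M f, OF L2_integrable[OF f] L1]
  obtain r where r: "strict_mono r" "AE x in M. Cauchy (\<lambda>i. f (r i) x)" by blast
  define g where "g x = lim (\<lambda>i. f (r i) x)" for x
  have [measurable]: "g \<in> borel_measurable M" unfolding g_def by measurable
  have conv: "AE x in M. (\<lambda>i. f (r i) x) \<longlonglongrightarrow> g x"
    using r(2) by eventually_elim (simp add: g_def Cauchy_convergent_iff convergent_LIMSEQ_iff)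
  \<comment> \<open>Fatou's lemma is applied along the subsequence with \<open>n\<close> fixed, so
    the Cauchy bound on \<open>f n - f (r i)\<close> passes to \<open>f n - g\<close> for the entire
    sequence. The bound is stated in extended reals because square-integrability of
    \<open>f n - g\<close> is one of its consequences.\<close>
  have *: "\<exists>N. \<forall>n\<ge>N. (\<integral>\<^sup>+x. ennreal ((f n x - g x)\<^sup>2) \<partial>M) \<le> ennreal (\<epsilon>\<^sup>2)" if "\<epsilon> > 0" for \<epsilon>
  proof -
    from C[OF that] obtain N where
      N: "\<And>m n. m \<ge> N \<Longrightarrow> n \<ge> N \<Longrightarrow> L2_norm M (\<lambda>x. f m x - f n x) < \<epsilon>" by auto
    show ?thesis
    proof (intro exI[of _ N] allI impI)
      fix n assume n: "n \<ge> N"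
      have "(\<integral>\<^sup>+x. ennreal ((f n x - g x)\<^sup>2) \<partial>M) = (\<integral>\<^sup>+x. liminf (\<lambda>i. ennreal ((f n x - f (r i) x)\<^sup>2)) \<partial>M)"
      proof (rule nn_integral_cong_AE, use conv in eventually_elim)
        fix x assume "(\<lambda>i. f (r i) x) \<longlonglongrightarrow> g x"
        then have "(\<lambda>i. ennreal ((f n x - f (r i) x)\<^sup>2)) \<longlonglongrightarrow> ennreal ((f n x - g x)\<^sup>2)"
          by (intro tendsto_ennrealI tendsto_intros)
        then show "ennreal ((f n x - g x)\<^sup>2) = liminf (\<lambda>i. ennreal ((f n x - f (r i) x)\<^sup>2))"
          by (intro lim_imp_Liminf[symmetric]) simp_all
      qed
      also have "\<dots> \<le> liminf (\<lambda>i. \<integral>\<^sup>+x. ennreal ((f n x - f (r i) x)\<^sup>2) \<partial>M)"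
        by (rule nn_integral_liminf) simp
      also have "\<dots> \<le> limsup (\<lambda>i. \<integral>\<^sup>+x. ennreal ((f n x - f (r i) x)\<^sup>2) \<partial>M)"
        by (rule Liminf_le_Limsup) simp
      also have "\<dots> \<le> ennreal (\<epsilon>\<^sup>2)"
      proof (rule Limsup_bounded, rule eventually_sequentiallyI[of N])
        fix i assume "i \<ge> N"
        then have "r i \<ge> N" using seq_suble[OF r(1), of i] by simp
        have "(\<integral>\<^sup>+x. ennreal ((f n x - f (r i) x)\<^sup>2) \<partial>M) = ennreal ((L2_norm M (\<lambda>x. f n x - f (r i) x))\<^sup>2)"
          unfolding L2_norm_power2 L2_inner_self
          using L2_diff[OF f[of n] f[of "r i"]] by (intro nn_integral_eq_integral) (auto simp: L2_def)
        also have "\<dots> \<le> ennreal (\<epsilon>\<^sup>2)"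
          using N[OF n \<open>r i \<ge> N\<close>] by (intro ennreal_leI power_mono) (auto simp: L2_norm_nonneg)
        finally show "(\<integral>\<^sup>+x. ennreal ((f n x - f (r i) x)\<^sup>2) \<partial>M) \<le> ennreal (\<epsilon>\<^sup>2)" .
      qed
      finally show "(\<integral>\<^sup>+x. ennreal ((f n x - g x)\<^sup>2) \<partial>M) \<le> ennreal (\<epsilon>\<^sup>2)" .
    qed
  qed
  have mem: "(\<lambda>x. f n x - g x) \<in> L2 M" if "(\<integral>\<^sup>+x. ennreal ((f n x - g x)\<^sup>2) \<partial>M) \<le> ennreal (\<epsilon>\<^sup>2)" for n \<epsilon>
    unfolding L2_def using that
    by (auto intro!: integrableI_bounded intro: le_less_trans[OF _ ennreal_less_top])
  have g: "g \<in> L2 M"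
  proof -
    obtain N where "(\<integral>\<^sup>+x. ennreal ((f N x - g x)\<^sup>2) \<partial>M) \<le> ennreal (1\<^sup>2)" using *[of 1] by auto
    from L2_diff[OF f[of N] mem[OF this]] show ?thesis by simp
  qed
  have "(\<lambda>n. L2_norm M (\<lambda>x. f n x - g x)) \<longlonglongrightarrow> 0"
  proof (rule LIMSEQ_I)
    fix \<epsilon> :: real assume \<epsilon>: "0 < \<epsilon>"
    then obtain N where N: "\<And>n. n \<ge> N \<Longrightarrow> (\<integral>\<^sup>+x. ennreal ((f n x - g x)\<^sup>2) \<partial>M) \<le> ennreal ((\<epsilon>/2)\<^sup>2)"
      using *[of "\<epsilon>/2"] by auto
    have le: "L2_norm M (\<lambda>x. f n x - g x) \<le> \<epsilon>/2" if "n \<ge> N" for n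
    proof (rule power2_le_imp_le)
      have "ennreal ((L2_norm M (\<lambda>x. f n x - g x))\<^sup>2) = (\<integral>\<^sup>+x. ennreal ((f n x - g x)\<^sup>2) \<partial>M)"
        unfolding L2_norm_power2 L2_inner_self
        using mem[OF N[OF that]] by (intro nn_integral_eq_integral[symmetric]) (auto simp: L2_def)
      then show "(L2_norm M (\<lambda>x. f n x - g x))\<^sup>2 \<le> (\<epsilon>/2)\<^sup>2"
        using N[OF that] by (metis ennreal_le_iff zero_le_power2)
    qed (use \<epsilon> in simp)
    have "norm (L2_norm M (\<lambda>x. f n x - g x) - 0) < \<epsilon>" if "n \<ge> N" for n
      using le[OF that] \<epsilon> L2_norm_nonneg[of M "\<lambda>x. f n x - g x"] by simp
    then show "\<exists>N. \<forall>n\<ge>N. norm (L2_norm M (\<lambda>x. f n x - g x) - 0) < \<epsilon>"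
      by blast
  qed
  then show ?thesis using f g by (auto simp: L2_tendsto_def)
qed

section \<open>Calculus in \<open>L\<^sup>2\<close> and orthonormal expansions\<close>

lemma has_real_derivative_quadratic_remainder:
  fixes \<phi> :: "real \<Rightarrow> real"
  assumes "\<forall>\<^sub>F r in nhds s. \<bar>\<phi> r - \<phi> s - (r - s) * d\<bar> \<le> K * (r - s)\<^sup>2"
  shows "(\<phi> has_real_derivative d) (at s)"
proof -
  have ev: "\<forall>\<^sub>F r in at s. norm ((\<phi> r - \<phi> s) / (r - s) - d) \<le> K * \<bar>r - s\<bar>"
    using assms unfolding eventually_at_filter
  proof eventually_elim
    case (elim r)
    show ?case
    proof (intro impI)
      assume "r \<noteq> s"
      then have "\<bar>(\<phi> r - \<phi> s) / (r - s) - d\<bar> = \<bar>\<phi> r - \<phi> s - (r - s) * d\<bar> / \<bar>r - s\<bar>"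
        by (simp add: field_simps flip: abs_divide)
      also have "\<dots> \<le> K * (r - s)\<^sup>2 / \<bar>r - s\<bar>"
        using elim by (intro divide_right_mono) auto
      also have "\<dots> = K * \<bar>r - s\<bar>"
        using \<open>r \<noteq> s\<close> by (simp add: field_simps power2_eq_square flip: abs_mult)
      finally show "norm ((\<phi> r - \<phi> s) / (r - s) - d) \<le> K * \<bar>r - s\<bar>" by simp
    qed
  qed
  have "((\<lambda>r. K * \<bar>r - s\<bar>) \<longlongrightarrow> K * \<bar>s - s\<bar>) (at s)"
    by (intro tendsto_intros)
  then have "((\<lambda>r. K * \<bar>r - s\<bar>) \<longlongrightarrow> 0) (at s)" by simp
  then have "((\<lambda>r. (\<phi> r - \<phi> s) / (r - s) - d) \<longlongrightarrow> 0) (at s)"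
    by (rule Lim_null_comparison[OF ev])
  then show ?thesis
    by (simp add: has_field_derivative_iff LIM_zero_iff)
qed

text \<open>A quadratic remainder is more than differentiability, but it is what bounds on one further
  derivative of the coefficients provide.\<close>

definition L2_taylor :: "'a measure \<Rightarrow> (real \<Rightarrow> 'a \<Rightarrow> real) \<Rightarrow> ('a \<Rightarrow> real) \<Rightarrow> real \<Rightarrow> bool" where
  "L2_taylor M F F' s \<longleftrightarrow> F' \<in> L2 M \<and>
     (\<exists>C\<ge>0. \<forall>\<^sub>F r in nhds s. F r \<in> L2 M \<and> L2_norm M (\<lambda>x. F r x - F s x - (r - s) * F' x) \<le> C * (r - s)\<^sup>2)"

lemma L2_taylor_diff_const:
  assumes "L2_taylor M F F' s" "g \<in> L2 M"
  shows "L2_taylor M (\<lambda>r x. F r x - g x) F' s"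
  using assms unfolding L2_taylor_def
  by (auto intro!: L2_diff elim!: eventually_mono)

text \<open>The product rule: each curve is written as its first-order part plus a remainder, and
  every term of the expanded inner product beyond first order carries a factor
  \<open>(r - s)\<^sup>2\<close>.\<close>

lemma L2_taylor_inner:
  assumes F: "L2_taylor M F F' s" and G: "L2_taylor M G G' s"
  shows "((\<lambda>r. L2_inner M (F r) (G r)) has_real_derivative
           (L2_inner M F' (G s) + L2_inner M (F s) G')) (at s)"
proof -
  from F obtain C where F': "F' \<in> L2 M" and C: "C \<ge> 0" and
    evF: "\<forall>\<^sub>F r in nhds s. F r \<in> L2 M \<and> L2_norm M (\<lambda>x. F r x - F s x - (r - s) * F' x) \<le> C * (r - s)\<^sup>2"
    unfolding L2_taylor_def by blast
  from G obtain C' where G': "G' \<in> L2 M" and C': "C' \<ge> 0" and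
    evG: "\<forall>\<^sub>F r in nhds s. G r \<in> L2 M \<and> L2_norm M (\<lambda>x. G r x - G s x - (r - s) * G' x) \<le> C' * (r - s)\<^sup>2"
    unfolding L2_taylor_def by blast
  \<comment> \<open>A neighbourhood filter contains its centre, so the eventual membership holds at
    \<open>r = s\<close> itself.\<close>
  have Fs: "F s \<in> L2 M" and Gs: "G s \<in> L2 M"
    using eventually_nhds_x_imp_x[OF evF] eventually_nhds_x_imp_x[OF evG] by auto
  let ?n = "L2_norm M"
  define K where "K = ?n (F s) * C' + C * ?n (G s) + ?n F' * ?n G' + ?n F' * C' + C * ?n G' + C * C'"
  \<comment> \<open>Within distance 1 the terms of third and fourth order in \<open>r - s\<close>
    are bounded by second-order ones, so the single constant \<open>K\<close> covers them
    all.\<close>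
  have ev1: "\<forall>\<^sub>F r in nhds s. \<bar>r - s\<bar> \<le> 1"
    unfolding eventually_nhds_metric by (intro exI[of _ 1]) (auto simp: dist_real_def)
  have "\<forall>\<^sub>F r in nhds s. \<bar>L2_inner M (F r) (G r) - L2_inner M (F s) (G s)
      - (r - s) * (L2_inner M F' (G s) + L2_inner M (F s) G')\<bar> \<le> K * (r - s)\<^sup>2"
    using evF evG ev1
  proof eventually_elim
    case (elim r)
    define h where "h = r - s"
    define RF where "RF x = F r x - F s x - h * F' x" for x
    define RG where "RG x = G r x - G s x - h * G' x" for x
    have RF: "RF \<in> L2 M" and RG: "RG \<in> L2 M"
      unfolding RF_def RG_def using elim F' G' Fs Gs by (auto intro!: L2_diff L2_scale)
    have nRF: "?n RF \<le> C * h\<^sup>2" and nRG: "?n RG \<le> C' * h\<^sup>2"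
      using elim by (simp_all add: RF_def[abs_def] RG_def[abs_def] h_def)
    have h1: "\<bar>h\<bar> \<le> 1" using elim by (simp add: h_def)
    have Fr: "F r = (\<lambda>x. F s x + (h * F' x + RF x))" and Gr: "G r = (\<lambda>x. G s x + (h * G' x + RG x))"
      by (auto simp: RF_def RG_def)
    have expand: "L2_inner M (F r) (G r) - L2_inner M (F s) (G s) - h * (L2_inner M F' (G s) + L2_inner M (F s) G')
       = L2_inner M (F s) RG + L2_inner M RF (G s) + h\<^sup>2 * L2_inner M F' G'
         + h * L2_inner M F' RG + h * L2_inner M RF G' + L2_inner M RF RG"
      unfolding Fr Gr using Fs Gs F' G' RF RG
      by (simp add: L2_inner_add_left L2_inner_add_right L2_add L2_scale L2_inner_scale_left
          L2_inner_scale_right power2_eq_square algebra_simps)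
    have "\<bar>L2_inner M (F r) (G r) - L2_inner M (F s) (G s) - h * (L2_inner M F' (G s) + L2_inner M (F s) G')\<bar>
       \<le> \<bar>L2_inner M (F s) RG\<bar> + \<bar>L2_inner M RF (G s)\<bar> + \<bar>h\<^sup>2 * L2_inner M F' G'\<bar>
         + \<bar>h * L2_inner M F' RG\<bar> + \<bar>h * L2_inner M RF G'\<bar> + \<bar>L2_inner M RF RG\<bar>"
      unfolding expand by (rule order_trans[OF abs_triangle_ineq] add_right_mono order_refl)+
    also have "\<dots> \<le> ?n (F s) * (C' * h\<^sup>2) + (C * h\<^sup>2) * ?n (G s) + h\<^sup>2 * (?n F' * ?n G')
         + ?n F' * (C' * h\<^sup>2) + (C * h\<^sup>2) * ?n G' + (C * h\<^sup>2) * C'"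
    proof (intro add_mono)
      show "\<bar>L2_inner M (F s) RG\<bar> \<le> ?n (F s) * (C' * h\<^sup>2)"
        using L2_inner_abs_le[OF Fs RG] mult_left_mono[OF nRG L2_norm_nonneg[of M "F s"]] by linarith
      show "\<bar>L2_inner M RF (G s)\<bar> \<le> (C * h\<^sup>2) * ?n (G s)"
        using L2_inner_abs_le[OF RF Gs] mult_right_mono[OF nRF L2_norm_nonneg[of M "G s"]] by linarith
      show "\<bar>h\<^sup>2 * L2_inner M F' G'\<bar> \<le> h\<^sup>2 * (?n F' * ?n G')"
        using L2_inner_abs_le[OF F' G'] by (simp add: abs_mult mult_left_mono)
      have small: "\<bar>h * a\<bar> \<le> b" if "\<bar>a\<bar> \<le> b" for a b
        using mult_right_mono[OF h1, of "\<bar>a\<bar>"] that by (simp add: abs_mult)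
      show "\<bar>h * L2_inner M F' RG\<bar> \<le> ?n F' * (C' * h\<^sup>2)"
        using L2_inner_abs_le[OF F' RG] mult_left_mono[OF nRG L2_norm_nonneg[of M "F'"]]
        by (intro small) linarith
      show "\<bar>h * L2_inner M RF G'\<bar> \<le> (C * h\<^sup>2) * ?n G'"
        using L2_inner_abs_le[OF RF G'] mult_right_mono[OF nRF L2_norm_nonneg[of M "G'"]]
        by (intro small) linarith
      have "h\<^sup>2 \<le> 1" using h1 by (simp add: abs_square_le_1)
      then have "C' * h\<^sup>2 \<le> C' * 1" using C' by (intro mult_left_mono)
      then have "?n RG \<le> C'" using nRG by simp
      then have "?n RF * ?n RG \<le> (C * h\<^sup>2) * C'"
        using nRF C C' by (intro mult_mono) (auto simp: L2_norm_nonneg)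
      then show "\<bar>L2_inner M RF RG\<bar> \<le> (C * h\<^sup>2) * C'"
        using L2_inner_abs_le[OF RF RG] by linarith
    qed
    also have "\<dots> = K * h\<^sup>2" by (simp add: K_def algebra_simps)
    finally show ?case by (simp add: h_def)
  qed
  then show ?thesis by (rule has_real_derivative_quadratic_remainder)
qed

section \<open>Orthonormal series whose coefficients depend on time\<close>

lemma summable_orthonormal_coefficients:
  assumes e: "\<And>j. e j \<in> L2 N" "\<And>i j. L2_inner N (e i) (e j) = (if i = j then 1 else 0)"
    and f: "f \<in> L2 N"
  shows "summable (\<lambda>j. (L2_inner N f (e j))\<^sup>2)"
proof (rule summableI_nonneg_bounded[of _ "L2_inner N f f"])
  fix n
  define c where "c j = L2_inner N f (e j)" for j
  define g where "g x = (\<Sum>j<n. c j * e j x)" for x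
  have ce: "(\<lambda>x. c j * e j x) \<in> L2 N" for j by (intro L2_scale e)
  have g: "g \<in> L2 N" unfolding g_def by (intro L2_sum ce)
  have fg: "L2_inner N f g = (\<Sum>j<n. (c j)\<^sup>2)"
    unfolding g_def using ce f
    by (simp add: L2_inner_sum_right L2_inner_scale_right c_def power2_eq_square)
  have gg: "L2_inner N g g = (\<Sum>j<n. (c j)\<^sup>2)"
  proof -
    have "L2_inner N g (\<lambda>x. c j * e j x) = (c j)\<^sup>2" if "j < n" for j
    proof -
      have "L2_inner N g (\<lambda>x. c j * e j x) = c j * (\<Sum>i<n. c i * (if i = j then 1 else 0))"
        unfolding g_def L2_inner_scale_right using ce e
        by (simp add: L2_inner_sum_left L2_inner_scale_left)
      also have "(\<Sum>i<n. c i * (if i = j then 1 else 0)) = (\<Sum>i<n. if i = j then c i else 0)"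
        by (intro sum.cong) auto
      also have "\<dots> = c j" using that by (simp add: sum.delta)
      finally show ?thesis by (simp add: power2_eq_square)
    qed
    then show ?thesis
      using L2_inner_sum_right[where f="\<lambda>j x. c j * e j x" and I="{..<n}" and M=N and h=g] ce g
      by (simp add: g_def[abs_def])
  qed
  \<comment> \<open>Bessel's inequality: the squared distance from \<open>f\<close> to its partial
    expansion \<open>g\<close> is nonnegative, and by \<open>fg\<close> and \<open>gg\<close> it
    equals \<open>L2_inner N f f\<close> minus the sum of the squared coefficients.\<close>
  have "0 \<le> L2_inner N (\<lambda>x. f x - g x) (\<lambda>x. f x - g x)" by (rule L2_inner_self_nonneg)
  also have "\<dots> = L2_inner N f f - (\<Sum>j<n. (c j)\<^sup>2)"
    using f g L2_diff[OF f g]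
    by (simp add: L2_inner_diff_left L2_inner_diff_right L2_inner_commute[of N g f] fg gg)
  finally show "(\<Sum>j<n. (L2_inner N f (e j))\<^sup>2) \<le> L2_inner N f f"
    by (simp add: c_def)
qed simp

text \<open>\<open>N\<close> carries the space variable and \<open>K\<close> the time variable.
  Products \<open>u j t * e j x\<close> with different \<open>j\<close> are orthogonal whatever the
  functions \<open>u j\<close> are, so norms of such series reduce to sums over scalar functions of
  time.\<close>

locale orthonormal_tensor =
  N: finite_measure N + K: finite_measure K
  for N :: "'a measure" and K :: "'b measure" +
  fixes e :: "nat \<Rightarrow> 'a \<Rightarrow> real"
  assumes e: "\<And>j. e j \<in> L2 N" "\<And>i j. L2_inner N (e i) (e j) = (if i = j then 1 else 0)"
begin

sublocale P: pair_sigma_finite N K ..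

sublocale NK: finite_measure "N \<Otimes>\<^sub>M K"
  by (rule finite_measure_pair_measure) unfold_locales

lemma integrable_tensor:
  assumes "integrable K u" "integrable N v"
  shows "integrable (N \<Otimes>\<^sub>M K) (\<lambda>(x, t). u t * (v x :: real))"
proof -
  have [measurable]: "u \<in> borel_measurable K" "v \<in> borel_measurable N"
    using assms by auto
  show ?thesis
  proof (rule P.Fubini_integrable)
    have "integrable N (\<lambda>x. (LINT t|K. \<bar>u t\<bar>) * \<bar>v x\<bar>)"
      using assms by simp
    then show "integrable N (\<lambda>x. LINT t|K. norm (case (x, t) of (x, t) \<Rightarrow> u t * v x))"
      by (simp add: abs_mult)
    show "AE x in N. integrable K (\<lambda>t. case (x, t) of (x, t) \<Rightarrow> u t * v x)"
      using assms by simp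
  qed measurable
qed

lemma tensor_L2:
  assumes "u \<in> L2 K" "v \<in> L2 N"
  shows "(\<lambda>(x, t). u t * v x) \<in> L2 (N \<Otimes>\<^sub>M K)"
proof -
  have [measurable]: "u \<in> borel_measurable K" "v \<in> borel_measurable N"
    using assms by (auto simp: L2_def)
  have "integrable (N \<Otimes>\<^sub>M K) (\<lambda>(x, t). (u t)\<^sup>2 * (v x)\<^sup>2)"
    using assms by (intro integrable_tensor) (auto simp: L2_def)
  moreover have "(\<lambda>z. (case z of (x, t) \<Rightarrow> u t * v x)\<^sup>2) = (\<lambda>(x, t). (u t)\<^sup>2 * (v x)\<^sup>2)"
    by (auto simp: power_mult_distrib)
  ultimately show ?thesis by (simp add: L2_def)
qed

lemma tensor_inner:
  assumes "u \<in> L2 K" "v \<in> L2 N" "u' \<in> L2 K" "v' \<in> L2 N"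
  shows "L2_inner (N \<Otimes>\<^sub>M K) (\<lambda>(x, t). u t * v x) (\<lambda>(x, t). u' t * v' x) = L2_inner K u u' * L2_inner N v v'"
proof -
  have eq: "(\<lambda>z. (case z of (x, t) \<Rightarrow> u t * v x) * (case z of (x, t) \<Rightarrow> u' t * v' x)) =
      (\<lambda>(x, t). (u t * u' t) * (v x * v' x))"
    by (auto simp: algebra_simps)
  have "integrable (N \<Otimes>\<^sub>M K) (\<lambda>(x, t). (u t * u' t) * (v x * v' x))"
    by (intro integrable_tensor L2_integrable_mult assms)
  from P.integral_fst'[OF this]
  have "L2_inner (N \<Otimes>\<^sub>M K) (\<lambda>(x, t). u t * v x) (\<lambda>(x, t). u' t * v' x)
      = (LINT x|N. (LINT t|K. u t * u' t) * (v x * v' x))"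
    unfolding L2_inner_def eq by simp
  then show ?thesis by (simp add: L2_inner_def)
qed

text \<open>Pythagoras: orthogonality of the \<open>e j\<close> removes all mixed terms.\<close>

lemma tensor_sum_inner_self:
  assumes u: "\<And>j. u j \<in> L2 K" and I: "finite I"
  shows "L2_inner (N \<Otimes>\<^sub>M K) (\<lambda>z. \<Sum>j\<in>I. case z of (x, t) \<Rightarrow> u j t * e j x)
    (\<lambda>z. \<Sum>j\<in>I. case z of (x, t) \<Rightarrow> u j t * e j x) = (\<Sum>j\<in>I. L2_inner K (u j) (u j))"
proof -
  let ?f = "\<lambda>j z. case z of (x, t) \<Rightarrow> u j t * e j x"
  have f: "?f j \<in> L2 (N \<Otimes>\<^sub>M K)" for j by (intro tensor_L2 u e)
  have "L2_inner (N \<Otimes>\<^sub>M K) (\<lambda>z. \<Sum>j\<in>I. ?f j z) (\<lambda>z. \<Sum>j\<in>I. ?f j z)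
      = (\<Sum>i\<in>I. \<Sum>j\<in>I. L2_inner (N \<Otimes>\<^sub>M K) (?f i) (?f j))"
    by (subst L2_inner_sum_left[OF f L2_sum[OF f]]) (simp add: L2_inner_sum_right[OF f f])
  also have "\<dots> = (\<Sum>i\<in>I. \<Sum>j\<in>I. if i = j then L2_inner K (u i) (u i) else 0)"
    by (intro sum.cong refl) (simp add: tensor_inner[OF u e(1) u e(1)] e(2))
  also have "\<dots> = (\<Sum>j\<in>I. L2_inner K (u j) (u j))" using I by simp
  finally show ?thesis .
qed

text \<open>The squared norm of a block of the series is the same block of a convergent numerical
  series, so the partial sums are Cauchy and completeness applies.\<close>

lemma tensor_sums_exists:
  assumes u: "\<And>j. u j \<in> L2 K" and summ: "summable (\<lambda>j. L2_inner K (u j) (u j))"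
  shows "\<exists>g. L2_sums (N \<Otimes>\<^sub>M K) (\<lambda>j (x, t). u j t * e j x) g"
  unfolding L2_sums_def
proof (rule NK.L2_complete)
  let ?f = "\<lambda>j z. case z of (x, t) \<Rightarrow> u j t * e j x"
  show L2: "(\<lambda>z. \<Sum>j<n. ?f j z) \<in> L2 (N \<Otimes>\<^sub>M K)" for n
    by (intro L2_sum tensor_L2 u e)
  have sq: "(L2_norm (N \<Otimes>\<^sub>M K) (\<lambda>z. (\<Sum>j<m. ?f j z) - (\<Sum>j<n. ?f j z)))\<^sup>2 = (\<Sum>j=n..<m. L2_inner K (u j) (u j))"
    if "n \<le> m" for m n
  proof -
    have "(\<lambda>z. (\<Sum>j<m. ?f j z) - (\<Sum>j<n. ?f j z)) = (\<lambda>z. \<Sum>j=n..<m. ?f j z)"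
      using sum_diff_nat_ivl[of 0 n m] that by (auto simp: atLeast0LessThan)
    then show ?thesis by (simp only: L2_norm_power2 tensor_sum_inner_self[OF u finite_atLeastLessThan])
  qed
  fix \<epsilon> :: real assume \<epsilon>: "\<epsilon> > 0"
  then have "0 < \<epsilon>\<^sup>2" by simp
  then obtain n0 where n0: "\<And>m n. m \<ge> n0 \<Longrightarrow> norm (\<Sum>j=m..<n. L2_inner K (u j) (u j)) < \<epsilon>\<^sup>2"
    using summ unfolding summable_Cauchy by blast
  have main: "L2_norm (N \<Otimes>\<^sub>M K) (\<lambda>z. (\<Sum>j<m. ?f j z) - (\<Sum>j<n. ?f j z)) < \<epsilon>" if "n \<le> m" "n0 \<le> n" for m n
  proof (rule power2_less_imp_less)
    show "(L2_norm (N \<Otimes>\<^sub>M K) (\<lambda>z. (\<Sum>j<m. ?f j z) - (\<Sum>j<n. ?f j z)))\<^sup>2 < \<epsilon>\<^sup>2"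
      using n0[OF that(2), of m] by (simp only: sq[OF that(1)]) (simp add: sum_nonneg L2_inner_self_nonneg)
  qed (use \<epsilon> in simp)
  show "\<exists>n0. \<forall>m\<ge>n0. \<forall>n\<ge>n0. L2_norm (N \<Otimes>\<^sub>M K) (\<lambda>z. (\<Sum>j<m. ?f j z) - (\<Sum>j<n. ?f j z)) < \<epsilon>"
  proof (intro exI[of _ n0] allI impI)
    fix m n assume "n0 \<le> m" "n0 \<le> n"
    then show "L2_norm (N \<Otimes>\<^sub>M K) (\<lambda>z. (\<Sum>j<m. ?f j z) - (\<Sum>j<n. ?f j z)) < \<epsilon>"
      using main[of n m] main[of m n]
        L2_norm_diff_commute[of "N \<Otimes>\<^sub>M K" "\<lambda>z. \<Sum>j<m. ?f j z" "\<lambda>z. \<Sum>j<n. ?f j z"]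
      by (cases "n \<le> m") auto
  qed
qed

text \<open>Parseval as an inequality: a majorant of the coefficients bounds every partial sum, and
  the norm passes to the limit. For Taylor remainders, \<open>c\<close> carries the factor
  \<open>(r - s)\<^sup>2\<close>.\<close>

lemma tensor_sums_norm_le:
  assumes sums: "L2_sums (N \<Otimes>\<^sub>M K) (\<lambda>j (x, t). u j t * e j x) g"
    and u: "\<And>j. u j \<in> L2 K"
    and H: "\<And>j. H j \<in> L2 K" "summable (\<lambda>j. L2_inner K (H j) (H j))"
    and le: "\<And>j. AE t in K. \<bar>u j t\<bar> \<le> c * \<bar>H j t\<bar>" and c: "c \<ge> 0"
  shows "L2_norm (N \<Otimes>\<^sub>M K) g \<le> c * sqrt (\<Sum>j. L2_inner K (H j) (H j))"
proof (rule LIMSEQ_le_const2[OF L2_tendsto_norm[OF sums[unfolded L2_sums_def]]], intro exI allI impI)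
  fix n :: nat
  have uH: "L2_inner K (u j) (u j) \<le> c\<^sup>2 * L2_inner K (H j) (H j)" for j
  proof -
    have "L2_inner K (u j) (u j) \<le> (LINT t|K. c\<^sup>2 * (H j t)\<^sup>2)"
      unfolding L2_inner_self
    proof (rule integral_mono_AE)
      show "AE t in K. (u j t)\<^sup>2 \<le> c\<^sup>2 * (H j t)\<^sup>2"
        using le[of j]
      proof eventually_elim
        case (elim t)
        then have "\<bar>u j t\<bar>\<^sup>2 \<le> (c * \<bar>H j t\<bar>)\<^sup>2" by (intro power_mono) auto
        then show ?case by (simp add: power_mult_distrib)
      qed
    qed (use u[of j] H(1)[of j] in \<open>auto simp: L2_def\<close>)
    then show ?thesis by (simp add: L2_inner_self)
  qed
  show "L2_norm (N \<Otimes>\<^sub>M K) (\<lambda>z. \<Sum>j<n. case z of (x, t) \<Rightarrow> u j t * e j x)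
      \<le> c * sqrt (\<Sum>j. L2_inner K (H j) (H j))"
  proof (rule power2_le_imp_le)
    have "(L2_norm (N \<Otimes>\<^sub>M K) (\<lambda>z. \<Sum>j<n. case z of (x, t) \<Rightarrow> u j t * e j x))\<^sup>2 = (\<Sum>j<n. L2_inner K (u j) (u j))"
      unfolding L2_norm_power2 by (rule tensor_sum_inner_self[OF u]) simp
    also have "\<dots> \<le> (\<Sum>j<n. c\<^sup>2 * L2_inner K (H j) (H j))" by (intro sum_mono uH)
    also have "\<dots> \<le> c\<^sup>2 * (\<Sum>j. L2_inner K (H j) (H j))"
      unfolding sum_distrib_left[symmetric]
      using H(2) by (intro mult_left_mono sum_le_suminf) (auto simp: L2_inner_self_nonneg)
    also have "\<dots> = (c * sqrt (\<Sum>j. L2_inner K (H j) (H j)))\<^sup>2"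
      using H(2) by (simp add: power_mult_distrib suminf_nonneg L2_inner_self_nonneg)
    finally show "(L2_norm (N \<Otimes>\<^sub>M K) (\<lambda>z. \<Sum>j<n. case z of (x, t) \<Rightarrow> u j t * e j x))\<^sup>2
        \<le> (c * sqrt (\<Sum>j. L2_inner K (H j) (H j)))\<^sup>2" .
  qed (use c H(2) in \<open>simp add: suminf_nonneg L2_inner_self_nonneg\<close>)
qed

end

section \<open>Optimality conditions for a twice differentiable state\<close>

text \<open>The Taylor remainder of the sum is the orthogonal series of the coefficient remainders,
  so their domination by the square-summable family \<open>H j\<close> yields a quadratic bound in
  norm.\<close>

lemma (in orthonormal_tensor) tensor_sum_taylor:
  assumes u: "\<forall>\<^sub>F r in nhds s. (\<forall>j. (\<lambda>t. u j t r) \<in> L2 K) \<and> L2_sums (N \<Otimes>\<^sub>M K) (\<lambda>j (x, t). u j t r * e j x) (Y r)"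
    and u': "\<And>j. u' j \<in> L2 K" "L2_sums (N \<Otimes>\<^sub>M K) (\<lambda>j (x, t). u' j t * e j x) Y'"
    and H: "\<And>j. H j \<in> L2 K" "summable (\<lambda>j. L2_inner K (H j) (H j))" and C: "C \<ge> 0"
    and le: "\<forall>\<^sub>F r in nhds s. \<forall>j. AE t in K. \<bar>u j t r - u j t s - (r - s) * u' j t\<bar> \<le> C * (r - s)\<^sup>2 * \<bar>H j t\<bar>"
  shows "L2_taylor (N \<Otimes>\<^sub>M K) Y Y' s"
  unfolding L2_taylor_def
proof (intro conjI exI[of _ "C * sqrt (\<Sum>j. L2_inner K (H j) (H j))"])
  show "Y' \<in> L2 (N \<Otimes>\<^sub>M K)" using u'(2) by (simp add: L2_sums_def L2_tendsto_def)
  show "0 \<le> C * sqrt (\<Sum>j. L2_inner K (H j) (H j))"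
    using C H(2) by (simp add: suminf_nonneg L2_inner_self_nonneg)
  have us: "\<And>j. (\<lambda>t. u j t s) \<in> L2 K" "L2_sums (N \<Otimes>\<^sub>M K) (\<lambda>j (x, t). u j t s * e j x) (Y s)"
    using eventually_nhds_x_imp_x[OF u] by auto
  show "\<forall>\<^sub>F r in nhds s. Y r \<in> L2 (N \<Otimes>\<^sub>M K) \<and>
      L2_norm (N \<Otimes>\<^sub>M K) (\<lambda>x. Y r x - Y s x - (r - s) * Y' x)
        \<le> C * sqrt (\<Sum>j. L2_inner K (H j) (H j)) * (r - s)\<^sup>2"
    using u le
  proof eventually_elim
    case (elim r)
    then have ur: "\<And>j. (\<lambda>t. u j t r) \<in> L2 K" "L2_sums (N \<Otimes>\<^sub>M K) (\<lambda>j (x, t). u j t r * e j x) (Y r)"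
      and ler: "\<And>j. AE t in K. \<bar>u j t r - u j t s - (r - s) * u' j t\<bar> \<le> C * (r - s)\<^sup>2 * \<bar>H j t\<bar>" by auto
    have eq: "(\<lambda>j z. (case z of (x, t) \<Rightarrow> u j t r * e j x) - (case z of (x, t) \<Rightarrow> u j t s * e j x)
        - (r - s) * (case z of (x, t) \<Rightarrow> u' j t * e j x))
      = (\<lambda>j (x, t). (u j t r - u j t s - (r - s) * u' j t) * e j x)"
      by (auto simp: fun_eq_iff algebra_simps)
    have "L2_sums (N \<Otimes>\<^sub>M K) (\<lambda>j (x, t). (u j t r - u j t s - (r - s) * u' j t) * e j x)
        (\<lambda>x. Y r x - Y s x - (r - s) * Y' x)"
      using L2_sums_diff[OF L2_sums_diff[OF ur(2) us(2)] L2_sums_scale[OF u'(2), of "r - s"]]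
      unfolding eq .
    from tensor_sums_norm_le[OF this L2_diff[OF L2_diff[OF ur(1) us(1)] L2_scale[OF u'(1)]] H ler]
    have "L2_norm (N \<Otimes>\<^sub>M K) (\<lambda>x. Y r x - Y s x - (r - s) * Y' x)
        \<le> C * (r - s)\<^sup>2 * sqrt (\<Sum>j. L2_inner K (H j) (H j))" using C by simp
    moreover have "Y r \<in> L2 (N \<Otimes>\<^sub>M K)" using ur(2) by (simp add: L2_sums_def L2_tendsto_def)
    ultimately show ?case by (simp add: mult.assoc mult.commute mult.left_commute)
  qed
qed

section \<open>First and second order conditions in one real variable\<close>

lemma open_params: "open (params L)"
proof -
  have "params L = {0<..} \<inter> ereal -` {..<L}" by (auto simp: params_def)
  moreover have "open (ereal -` {..<L})"
    by (intro open_vimage) (auto intro: continuous_intros)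
  ultimately show ?thesis by (simp add: open_Int)
qed

text \<open>Since \<open>params L\<close> is open, a minimum relative to it is a minimum on a full
  interval around \<open>s\<close>, where Fermat's criterion applies.\<close>

lemma optimal_imp_derivative_zero:
  assumes "optimal L J s" "(J has_real_derivative d) (at s)"
  shows "d = 0"
proof -
  from assms(1) obtain \<delta> where s: "s \<in> params L" and \<delta>: "\<delta> > 0"
    and min: "\<And>r. r \<in> params L \<Longrightarrow> \<bar>r - s\<bar> < \<delta> \<Longrightarrow> J s \<le> J r"
    unfolding optimal_def by blast
  from open_params[of L] s obtain \<epsilon> where \<epsilon>: "\<epsilon> > 0" "\<And>r. dist r s < \<epsilon> \<Longrightarrow> r \<in> params L"
    unfolding open_dist by blast
  have "\<forall>r. \<bar>s - r\<bar> < min \<delta> \<epsilon> \<longrightarrow> J s \<le> J r"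
    using min \<epsilon>(2) by (auto simp: dist_real_def abs_minus_commute)
  with assms(2) \<delta> \<epsilon>(1) show ?thesis by (intro DERIV_local_min[of J d s "min \<delta> \<epsilon>"]) auto
qed

text \<open>The first derivative vanishes at \<open>s\<close> with positive slope, so near
  \<open>s\<close> it is negative on the left and positive on the right; the function decreases
  towards \<open>s\<close> and increases away from it.\<close>

lemma second_derivative_test:
  assumes s: "s \<in> params L"
    and J: "\<And>r. r \<in> params L \<Longrightarrow> (J has_real_derivative J' r) (at r)"
    and J': "(J' has_real_derivative d) (at s)" and "J' s = 0" "d > 0"
  shows "optimal L J s"
proof -
  from open_params[of L] s obtain \<epsilon> where \<epsilon>: "\<epsilon> > 0" "\<And>r. dist r s < \<epsilon> \<Longrightarrow> r \<in> params L"
    unfolding open_dist by blast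
  from DERIV_pos_inc_right[OF J' \<open>d > 0\<close>] obtain d1 where
    d1: "d1 > 0" "\<And>h. 0 < h \<Longrightarrow> h < d1 \<Longrightarrow> 0 < J' (s + h)" using \<open>J' s = 0\<close> by auto
  from DERIV_pos_inc_left[OF J' \<open>d > 0\<close>] obtain d2 where
    d2: "d2 > 0" "\<And>h. 0 < h \<Longrightarrow> h < d2 \<Longrightarrow> J' (s - h) < 0" using \<open>J' s = 0\<close> by auto
  define \<delta> where "\<delta> = min \<epsilon> (min d1 d2)"
  have "J s \<le> J r" if "\<bar>r - s\<bar> < \<delta>" for r
  proof (cases r s rule: linorder_cases)
    case less
    have "\<exists>y. (J has_real_derivative y) (at x) \<and> y \<le> 0" if "r \<le> x" "x \<le> s" for x
    proof -
      have "dist x s < \<epsilon>" using that \<open>\<bar>r - s\<bar> < \<delta>\<close> by (simp add: dist_real_def \<delta>_def)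
      moreover have "J' x \<le> 0"
        using d2(2)[of "s - x"] that \<open>\<bar>r - s\<bar> < \<delta>\<close> \<open>J' s = 0\<close> by (cases "x = s") (auto simp: \<delta>_def)
      ultimately show ?thesis using J \<epsilon>(2) by blast
    qed
    with less show ?thesis by (intro DERIV_nonpos_imp_nonincreasing[of r s J]) auto
  next
    case greater
    have "\<exists>y. (J has_real_derivative y) (at x) \<and> y \<ge> 0" if "s \<le> x" "x \<le> r" for x
    proof -
      have "dist x s < \<epsilon>" using that \<open>\<bar>r - s\<bar> < \<delta>\<close> by (simp add: dist_real_def \<delta>_def)
      moreover have "J' x \<ge> 0"
        using d1(2)[of "x - s"] that \<open>\<bar>r - s\<bar> < \<delta>\<close> \<open>J' s = 0\<close> by (cases "x = s") (auto simp: \<delta>_def)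
      ultimately show ?thesis using J \<epsilon>(2) by blast
    qed
    with greater show ?thesis by (intro DERIV_nonneg_imp_nondecreasing[of s r J]) auto
  qed simp
  then show ?thesis using s \<epsilon>(1) d1(1) d2(1) unfolding optimal_def
    by (intro conjI exI[of _ \<delta>]) (auto simp: \<delta>_def)
qed

section \<open>The cost as a squared norm on the space-time cylinder\<close>

lemma finite_measure_restrict_bounded:
  fixes D :: "real set"
  assumes "bounded D" "D \<in> sets borel"
  shows "finite_measure (restrict_space lborel D)"
proof
  show "emeasure (restrict_space lborel D) (space (restrict_space lborel D)) \<noteq> \<infinity>"
    using emeasure_bounded_finite[OF assms(1)] assms(2)
    by (simp add: emeasure_restrict_space space_restrict_space)
qed

text \<open>Fubini in the order used by the cost, with space inside and time outside.\<close>

lemma cylinder_integral_eq_iterated: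
  fixes f :: "real \<times> real \<Rightarrow> real"
  assumes D: "open D" and f: "integrable (cylinder_measure D T) f"
  shows "(LINT t:{0<..<T}|lborel. LINT x:D|lborel. f (x, t)) = integral\<^sup>L (cylinder_measure D T) f"
proof -
  have sf: "sigma_finite_measure (restrict_space lborel X)" if "X \<in> sets borel" for X :: "real set"
    using that by (intro sigma_finite_measure_restrict_space lborel.sigma_finite_measure_axioms) auto
  interpret pair_sigma_finite "restrict_space lborel D" "restrict_space lborel {0<..<T}"
    using D by (intro pair_sigma_finite.intro sf) auto
  have "integral\<^sup>L (cylinder_measure D T) f
      = (LINT t|restrict_space lborel {0<..<T}. LINT x|restrict_space lborel D. f (x, t))"
    using integral_snd[of "\<lambda>x t. f (x, t)"] f by (simp add: cylinder_measure_def)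
  then show ?thesis
    using D by (simp add: integral_restrict_space set_lebesgue_integral_def)
qed

text \<open>The cost is half the squared norm of \<open>Y r - y\<^sub>D\<close> plus the penalty.
  Two applications of the product rule give its first two derivatives, which are the left-hand sides
  of the two conditions.\<close>

lemma cost_conditions:
  assumes D: "open D" and \<Phi>: "C2_on (params L) \<Phi>" and y: "y\<^sub>D \<in> L2 (cylinder_measure D T)"
    and Y: "\<And>s. s \<in> params L \<Longrightarrow> L2_taylor (cylinder_measure D T) Y (Y1 s) s"
    and Y1: "\<And>s. s \<in> params L \<Longrightarrow> L2_taylor (cylinder_measure D T) Y1 (Y2 s) s"
  shows "(\<forall>s. optimal L (\<lambda>r. cost D T y\<^sub>D \<Phi> (Y r) r) s \<longrightarrow>
        (LINT t:{0<..<T}|lborel. LINT x:D|lborel. (Y s (x, t) - y\<^sub>D (x, t)) * Y1 s (x, t))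
        + deriv \<Phi> s = 0) \<and>
     (\<forall>s\<in>params L.
        (LINT t:{0<..<T}|lborel. LINT x:D|lborel. (Y s (x, t) - y\<^sub>D (x, t)) * Y1 s (x, t))
        + deriv \<Phi> s = 0 \<longrightarrow>
        (LINT t:{0<..<T}|lborel. LINT x:D|lborel.
           (Y1 s (x, t))\<^sup>2 + (Y s (x, t) - y\<^sub>D (x, t)) * Y2 s (x, t))
        + deriv (deriv \<Phi>) s > 0 \<longrightarrow>
        optimal L (\<lambda>r. cost D T y\<^sub>D \<Phi> (Y r) r) s)"
proof -
  let ?M = "cylinder_measure D T"
  let ?J = "\<lambda>r. cost D T y\<^sub>D \<Phi> (Y r) r"
  have YL2: "Y s \<in> L2 ?M" and Y1L2: "Y1 s \<in> L2 ?M" and Y2L2: "Y2 s \<in> L2 ?M" if "s \<in> params L" for s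
    using Y[OF that] Y1[OF that] by (auto simp: L2_taylor_def dest: eventually_nhds_x_imp_x)
  define R where "R r = (\<lambda>z. Y r z - y\<^sub>D z)" for r
  have R: "R s \<in> L2 ?M" if "s \<in> params L" for s
    unfolding R_def using YL2[OF that] y by (rule L2_diff)
  have Rt: "L2_taylor ?M R (Y1 s) s" if "s \<in> params L" for s
    using L2_taylor_diff_const[OF Y[OF that] y] by (simp add: R_def[abs_def])
  have J_eq: "?J s = 1 / 2 * L2_inner ?M (R s) (R s) + \<Phi> s" if "s \<in> params L" for s
    using cylinder_integral_eq_iterated[OF D L2_integrable_mult[OF R[OF that] R[OF that]]]
    by (simp add: cost_def L2_inner_def R_def power2_eq_square)
  define J' where "J' s = L2_inner ?M (R s) (Y1 s) + deriv \<Phi> s" for s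
  define J'' where "J'' s = L2_inner ?M (Y1 s) (Y1 s) + L2_inner ?M (R s) (Y2 s) + deriv (deriv \<Phi>) s" for s
  have \<Phi>': "(\<Phi> has_real_derivative deriv \<Phi> s) (at s)"
    and \<Phi>'': "(deriv \<Phi> has_real_derivative deriv (deriv \<Phi>) s) (at s)" if "s \<in> params L" for s
    using \<Phi> that by (auto simp: C2_on_def field_differentiable_derivI)
  have dJ: "(?J has_real_derivative J' s) (at s)" if s: "s \<in> params L" for s
  proof (rule has_field_derivative_transform_within_open[OF _ open_params s])
    have "((\<lambda>r. 1 / 2 * L2_inner ?M (R r) (R r) + \<Phi> r) has_real_derivative
        1 / 2 * (L2_inner ?M (Y1 s) (R s) + L2_inner ?M (R s) (Y1 s)) + deriv \<Phi> s) (at s)"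
      by (intro DERIV_add DERIV_cmult L2_taylor_inner Rt \<Phi>' s)
    \<comment> \<open>The two terms of the product rule coincide by symmetry, which cancels the
      factor \<open>1 / 2\<close>.\<close>
    then show "((\<lambda>r. 1 / 2 * L2_inner ?M (R r) (R r) + \<Phi> r) has_real_derivative J' s) (at s)"
      by (simp add: J'_def L2_inner_commute[of ?M "Y1 s"])
  qed (simp add: J_eq)
  have dJ': "(J' has_real_derivative J'' s) (at s)" if s: "s \<in> params L" for s
    unfolding J'_def[abs_def] J''_def by (intro DERIV_add L2_taylor_inner Rt Y1 \<Phi>'' s)
  have I1: "(LINT t:{0<..<T}|lborel. LINT x:D|lborel. (Y s (x, t) - y\<^sub>D (x, t)) * Y1 s (x, t)) + deriv \<Phi> s = J' s"
    if "s \<in> params L" for s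
    using cylinder_integral_eq_iterated[OF D L2_integrable_mult[OF R[OF that] Y1L2[OF that]]]
    by (simp add: J'_def L2_inner_def R_def)
  have I2: "(LINT t:{0<..<T}|lborel. LINT x:D|lborel.
           (Y1 s (x, t))\<^sup>2 + (Y s (x, t) - y\<^sub>D (x, t)) * Y2 s (x, t)) + deriv (deriv \<Phi>) s = J'' s"
    if "s \<in> params L" for s
  proof -
    have 1: "integrable ?M (\<lambda>z. Y1 s z * Y1 s z)" by (intro L2_integrable_mult Y1L2 that)
    have 2: "integrable ?M (\<lambda>z. R s z * Y2 s z)" by (intro L2_integrable_mult R Y2L2 that)
    show ?thesis
      using cylinder_integral_eq_iterated[OF D Bochner_Integration.integrable_add[OF 1 2]] 1 2
      by (simp add: J''_def L2_inner_def R_def power2_eq_square)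
  qed
  show ?thesis
  proof (intro conjI allI ballI impI)
    fix s assume o: "optimal L ?J s"
    then have s: "s \<in> params L" by (simp add: optimal_def)
    show "(LINT t:{0<..<T}|lborel. LINT x:D|lborel. (Y s (x, t) - y\<^sub>D (x, t)) * Y1 s (x, t)) + deriv \<Phi> s = 0"
      unfolding I1[OF s] by (rule optimal_imp_derivative_zero[OF o dJ[OF s]])
  next
    fix s assume s: "s \<in> params L"
      and "(LINT t:{0<..<T}|lborel. LINT x:D|lborel. (Y s (x, t) - y\<^sub>D (x, t)) * Y1 s (x, t)) + deriv \<Phi> s = 0"
      and "(LINT t:{0<..<T}|lborel. LINT x:D|lborel.
           (Y1 s (x, t))\<^sup>2 + (Y s (x, t) - y\<^sub>D (x, t)) * Y2 s (x, t)) + deriv (deriv \<Phi>) s > 0"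
    then show "optimal L ?J s"
      unfolding I1[OF s] I2[OF s] by (intro second_derivative_test[OF s dJ dJ'[OF s]])
  qed
qed

text \<open>The passage from scalar coefficients to the field at a fixed realisation: one
  square-summable family \<open>H j\<close> controls values, derivatives and Taylor remainders
  locally uniformly in the parameter.\<close>

lemma state_taylor:
  fixes z :: "nat \<Rightarrow> real \<Rightarrow> real \<Rightarrow> 'w \<Rightarrow> real" and \<omega> :: 'w and T :: real
  defines "v \<equiv> \<lambda>j t r. z j t r \<omega>" and "K \<equiv> restrict_space lborel {0<..<T}"
  assumes D: "open D" "bounded D" and e: "orthonormal_basis (space_measure D) e"
    and I: "open I"
    and meas: "\<And>j s. s \<in> I \<Longrightarrow> (\<lambda>t. v j t s) \<in> borel_measurable K"
      "\<And>j s. s \<in> I \<Longrightarrow> (\<lambda>t. deriv (v j t) s) \<in> borel_measurable K"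
      "\<And>j s. s \<in> I \<Longrightarrow> (\<lambda>t. deriv (deriv (v j t)) s) \<in> borel_measurable K"
    and H: "\<And>j. H j \<in> L2 K" "summable (\<lambda>j. L2_inner K (H j) (H j))"
    and bound: "\<And>s. s \<in> I \<Longrightarrow> \<exists>C\<ge>0. \<forall>\<^sub>F r in nhds s. \<forall>j. AE t in K.
        \<bar>v j t r\<bar> \<le> C * \<bar>H j t\<bar> \<and> \<bar>deriv (v j t) r\<bar> \<le> C * \<bar>H j t\<bar> \<and> \<bar>deriv (deriv (v j t)) r\<bar> \<le> C * \<bar>H j t\<bar> \<and>
        \<bar>v j t r - v j t s - (r - s) * deriv (v j t) s\<bar> \<le> C * (r - s)\<^sup>2 * \<bar>H j t\<bar> \<and>
        \<bar>deriv (v j t) r - deriv (v j t) s - (r - s) * deriv (deriv (v j t)) s\<bar> \<le> C * (r - s)\<^sup>2 * \<bar>H j t\<bar>"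
    and s: "s \<in> I"
  shows "L2_taylor (cylinder_measure D T) (\<lambda>s. state D T e z s \<omega>) (state_ds D T e z s \<omega>) s"
    and "L2_taylor (cylinder_measure D T) (\<lambda>s. state_ds D T e z s \<omega>) (state_dss D T e z s \<omega>) s"
proof -
  let ?N = "space_measure D"
  have cyl: "cylinder_measure D T = ?N \<Otimes>\<^sub>M K"
    by (simp add: cylinder_measure_def space_measure_def K_def)
  interpret orthonormal_tensor ?N K e
  proof (intro orthonormal_tensor.intro orthonormal_tensor_axioms.intro)
    show "finite_measure ?N" "finite_measure K"
      unfolding space_measure_def K_def using D by (auto intro!: finite_measure_restrict_bounded)
  qed (use e in \<open>auto simp: orthonormal_basis_def\<close>)
  \<comment> \<open>\<open>L2_suminf\<close> is a choice among possible sums, so the chosen function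
    is known to be a sum only once convergence is established; the majorant \<open>C * H j\<close>
    provides it.\<close>
  have ex: "(\<forall>j. w j \<in> L2 K) \<and> L2_sums (?N \<Otimes>\<^sub>M K) (\<lambda>j (x, t). w j t * e j x) (L2_suminf (?N \<Otimes>\<^sub>M K) (\<lambda>j (x, t). w j t * e j x))"
    if w: "\<And>j. w j \<in> borel_measurable K" "\<And>j. AE t in K. \<bar>w j t\<bar> \<le> C * \<bar>H j t\<bar>" "C \<ge> 0" for w :: "nat \<Rightarrow> real \<Rightarrow> real" and C
  proof -
    have CH: "(\<lambda>t. C * H j t) \<in> L2 K" for j by (intro L2_scale H)
    have le: "AE t in K. \<bar>w j t\<bar> \<le> \<bar>C * H j t\<bar>" for j
      using w(2)[of j] w(3) by (auto simp: abs_mult)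
    have wL2: "w j \<in> L2 K" for j by (rule L2_bounded[OF w(1) CH le])
    have "summable (\<lambda>j. L2_inner K (w j) (w j))"
    proof (rule summable_comparison_test_ev[OF always_eventually])
      show "summable (\<lambda>j. C\<^sup>2 * L2_inner K (H j) (H j))" by (intro summable_mult H)
      show "\<forall>j. norm (L2_inner K (w j) (w j)) \<le> C\<^sup>2 * L2_inner K (H j) (H j)"
      proof
        fix j
        have "L2_inner K (w j) (w j) \<le> L2_inner K (\<lambda>t. C * H j t) (\<lambda>t. C * H j t)"
          unfolding L2_inner_self
          by (rule integral_mono_AE)
            (use wL2[of j] CH[of j] le[of j] in \<open>auto simp: L2_def abs_le_square_iff\<close>)
        then show "norm (L2_inner K (w j) (w j)) \<le> C\<^sup>2 * L2_inner K (H j) (H j)"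
          by (simp add: L2_inner_self_nonneg L2_inner_scale_left L2_inner_scale_right power2_eq_square mult.assoc)
      qed
    qed
    from someI_ex[OF tensor_sums_exists[OF wL2 this]] wL2 show ?thesis
      unfolding L2_suminf_def by blast
  qed
  from bound[OF s] obtain C where C: "C \<ge> 0" and ev: "\<forall>\<^sub>F r in nhds s. \<forall>j. AE t in K.
        \<bar>v j t r\<bar> \<le> C * \<bar>H j t\<bar> \<and> \<bar>deriv (v j t) r\<bar> \<le> C * \<bar>H j t\<bar> \<and> \<bar>deriv (deriv (v j t)) r\<bar> \<le> C * \<bar>H j t\<bar> \<and>
        \<bar>v j t r - v j t s - (r - s) * deriv (v j t) s\<bar> \<le> C * (r - s)\<^sup>2 * \<bar>H j t\<bar> \<and>
        \<bar>deriv (v j t) r - deriv (v j t) s - (r - s) * deriv (deriv (v j t)) s\<bar> \<le> C * (r - s)\<^sup>2 * \<bar>H j t\<bar>"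
    by blast
  have evI: "\<forall>\<^sub>F r in nhds s. r \<in> I" using I s by (rule eventually_nhds_in_open)
  have s0: "\<forall>\<^sub>F r in nhds s. (\<forall>j. (\<lambda>t. v j t r) \<in> L2 K) \<and>
      L2_sums (?N \<Otimes>\<^sub>M K) (\<lambda>j (x, t). v j t r * e j x) (state D T e z r \<omega>)"
    using ev evI
  proof eventually_elim
    case (elim r)
    then have "AE t in K. \<bar>v j t r\<bar> \<le> C * \<bar>H j t\<bar>" for j by (auto elim!: allE[of _ j] AE_mp)
    from ex[OF meas(1)[OF elim(2)] this C] show ?case unfolding state_def cyl v_def .
  qed
  have s1: "\<forall>\<^sub>F r in nhds s. (\<forall>j. (\<lambda>t. deriv (v j t) r) \<in> L2 K) \<and>
      L2_sums (?N \<Otimes>\<^sub>M K) (\<lambda>j (x, t). deriv (v j t) r * e j x) (state_ds D T e z r \<omega>)"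
    using ev evI
  proof eventually_elim
    case (elim r)
    then have "AE t in K. \<bar>deriv (v j t) r\<bar> \<le> C * \<bar>H j t\<bar>" for j by (auto elim!: allE[of _ j] AE_mp)
    from ex[OF meas(2)[OF elim(2)] this C] show ?case unfolding state_ds_def cyl v_def .
  qed
  have s2: "(\<forall>j. (\<lambda>t. deriv (deriv (v j t)) s) \<in> L2 K) \<and>
      L2_sums (?N \<Otimes>\<^sub>M K) (\<lambda>j (x, t). deriv (deriv (v j t)) s * e j x) (state_dss D T e z s \<omega>)"
  proof -
    have "AE t in K. \<bar>deriv (deriv (v j t)) s\<bar> \<le> C * \<bar>H j t\<bar>" for j
      using eventually_nhds_x_imp_x[OF ev] by (auto elim!: allE[of _ j] AE_mp)
    from ex[OF meas(3)[OF s] this C] show ?thesis unfolding state_dss_def cyl v_def .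
  qed
  have t0: "\<forall>\<^sub>F r in nhds s. \<forall>j. AE t in K.
      \<bar>v j t r - v j t s - (r - s) * deriv (v j t) s\<bar> \<le> C * (r - s)\<^sup>2 * \<bar>H j t\<bar>"
    using ev by eventually_elim (auto elim!: allE AE_mp)
  have t1: "\<forall>\<^sub>F r in nhds s. \<forall>j. AE t in K.
      \<bar>deriv (v j t) r - deriv (v j t) s - (r - s) * deriv (deriv (v j t)) s\<bar> \<le> C * (r - s)\<^sup>2 * \<bar>H j t\<bar>"
    using ev by eventually_elim (auto elim!: allE AE_mp)
  show "L2_taylor (cylinder_measure D T) (\<lambda>s. state D T e z s \<omega>) (state_ds D T e z s \<omega>) s"
    unfolding cyl using eventually_nhds_x_imp_x[OF s1]
    by (intro tensor_sum_taylor[OF s0 _ _ H C t0]) auto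
  show "L2_taylor (cylinder_measure D T) (\<lambda>s. state_ds D T e z s \<omega>) (state_dss D T e z s \<omega>) s"
    unfolding cyl using s2
    by (intro tensor_sum_taylor[where u="\<lambda>j t r. deriv (v j t) r", OF s1 _ _ H C t1]) auto
qed

section \<open>Parameter derivatives of the mild solution\<close>

text \<open>One term of the exponential series, all of whose terms are nonnegative.\<close>

lemma power_le_fact_exp:
  fixes x :: real assumes "x \<ge> 0"
  shows "x ^ n \<le> fact n * exp x"
proof -
  have "(\<Sum>k\<in>{n}. x ^ k /\<^sub>R fact k) \<le> (\<Sum>k. x ^ k /\<^sub>R fact k)"
    using exp_converges[of x] assms by (intro sum_le_suminf) (auto simp: sums_iff)
  also have "\<dots> = exp x" using exp_converges[of x] by (simp add: sums_iff)
  finally show ?thesis by (simp add: field_simps)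
qed

lemma poly_le_exp:
  fixes p :: "real poly"
  shows "\<exists>C\<ge>0. \<forall>x\<ge>0. \<bar>poly p x\<bar> \<le> C * exp x"
proof (intro exI[of _ "\<Sum>i\<le>degree p. \<bar>coeff p i\<bar> * fact i"] conjI allI impI)
  fix x :: real assume x: "x \<ge> 0"
  have "\<bar>poly p x\<bar> \<le> (\<Sum>i\<le>degree p. \<bar>coeff p i * x ^ i\<bar>)"
    unfolding poly_altdef by (rule sum_abs)
  also have "\<dots> \<le> (\<Sum>i\<le>degree p. \<bar>coeff p i\<bar> * (fact i * exp x))"
    using x by (intro sum_mono) (auto simp: abs_mult power_le_fact_exp mult_left_mono)
  finally show "\<bar>poly p x\<bar> \<le> (\<Sum>i\<le>degree p. \<bar>coeff p i\<bar> * fact i) * exp x"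
    by (simp add: sum_distrib_right mult.assoc)
qed (auto intro!: sum_nonneg)

text \<open>For exponents between 0 and 2, \<open>x powr \<beta> \<le> 1 + x\<^sup>2\<close>. The
  decay thus follows from the exponential bound on \<open>p\<close> times
  \<open>[:1, 0, 1:]\<close>, the polynomial \<open>1 + x\<^sup>2\<close>.\<close>

lemma poly_exp_decay:
  fixes p :: "real poly"
  assumes "0 \<le> \<beta>" "\<beta> \<le> 2"
  shows "\<exists>C\<ge>0. \<forall>x>0. \<bar>poly p x * exp (- x)\<bar> \<le> C * x powr (-\<beta>)"
proof -
  obtain C where C: "C \<ge> 0" "\<And>x. x \<ge> 0 \<Longrightarrow> \<bar>poly (p * [:1, 0, 1:]) x\<bar> \<le> C * exp x"
    using poly_le_exp[of "p * [:1, 0, 1:]"] by blast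
  have "\<bar>poly p x * exp (- x)\<bar> \<le> C * x powr (-\<beta>)" if x: "x > 0" for x
  proof -
    have "x powr \<beta> \<le> 1 + x\<^sup>2"
    proof (cases "x \<le> 1")
      case True
      then have "x powr \<beta> \<le> 1" using x assms by (simp add: powr_le1)
      then show ?thesis by (simp add: add_increasing2)
    next
      case False
      then have "x powr \<beta> \<le> x powr 2" using assms by (intro powr_mono) auto
      then show ?thesis using x by (simp add: powr_numeral)
    qed
    then have "\<bar>poly p x\<bar> * x powr \<beta> \<le> \<bar>poly p x\<bar> * (1 + x\<^sup>2)" by (rule mult_left_mono) simp
    also have "\<dots> = \<bar>poly (p * [:1, 0, 1:]) x\<bar>"
      by (simp only: poly_mult abs_mult) (simp add: power2_eq_square)
    also have "\<dots> \<le> C * exp x" using C(2) x by simp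
    finally show ?thesis using x by (simp add: abs_mult powr_minus exp_minus field_simps)
  qed
  then show ?thesis using C(1) by blast
qed

text \<open>For a polynomial \<open>p\<close> and \<open>x = l\<^sup>s u\<close>, these describe \<open>1 / ln l\<close> times the derivative in \<open>s\<close>
  of \<open>p(x) e\<^bsup>-x\<^esup>\<close> and of \<open>l\<^sup>s p(x) e\<^bsup>-x\<^esup>\<close>, respectively.\<close>

definition boundary_step :: "real poly \<Rightarrow> real poly" where
  "boundary_step p = [:0, 1:] * (pderiv p - p)"

definition kernel_step :: "real poly \<Rightarrow> real poly" where
  "kernel_step p = p + boundary_step p"

text \<open>The \<open>k\<close>-th derivative in \<open>s\<close> of the mild solution
  \<open>a e\<^bsup>-l\<^sup>s t\<^esup> + c (b(t) - l\<^sup>s \<integral>\<^sub>0\<^sup>t e\<^bsup>-l\<^sup>s u\<^esup> b(t - u) du)\<close> driven by the path \<open>b\<close>. The value \<open>b(t)\<close> is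
  absorbed into the integral, so that only increments of \<open>b\<close> meet the singular kernel.\<close>

definition mild_deriv :: "nat \<Rightarrow> real \<Rightarrow> real \<Rightarrow> real \<Rightarrow> (real \<Rightarrow> real) \<Rightarrow> real \<Rightarrow> real \<Rightarrow> real" where
  "mild_deriv k l a c b t s = (ln l) ^ k *
     (poly ((boundary_step ^^ k) 1) (l powr s * t) * exp (- (l powr s * t)) * (a + c * b t)
      + c * integral {0..t} (\<lambda>u. l powr s * (poly ((kernel_step ^^ k) 1) (l powr s * u) * exp (- (l powr s * u)))
          * (b t - b (t - u))))"

lemma has_real_derivative_const_powr:
  fixes l :: real
  assumes "l > 0"
  shows "((\<lambda>s. l powr s) has_real_derivative l powr s * ln l) (at s within X)"
proof -
  have "((\<lambda>s. l powr s) has_real_derivative l powr s * (1 * ln l + 0 * s / l)) (at s)"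
    by (rule DERIV_powr[OF DERIV_const assms DERIV_ident])
  then show ?thesis by (simp add: has_field_derivative_at_within)
qed

lemma has_real_derivative_poly_exp:
  fixes l :: real and p :: "real poly"
  assumes "l > 0"
  shows "((\<lambda>s. poly p (l powr s * u) * exp (- (l powr s * u))) has_real_derivative
     ln l * (poly (boundary_step p) (l powr s * u) * exp (- (l powr s * u)))) (at s within X)"
proof -
  note D = DERIV_cmult_right[OF has_real_derivative_const_powr[OF assms], of u]
  note E = DERIV_mult[OF DERIV_chain2[OF poly_DERIV D] DERIV_chain2[OF DERIV_exp DERIV_minus[OF D]], of p]
  show ?thesis
    by (rule DERIV_cong[OF E]) (simp add: boundary_step_def algebra_simps)
qed

lemma has_real_derivative_kernel:
  fixes l :: real and p :: "real poly"
  assumes "l > 0"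
  shows "((\<lambda>s. l powr s * (poly p (l powr s * u) * exp (- (l powr s * u))) * d) has_real_derivative
     ln l * (l powr s * (poly (kernel_step p) (l powr s * u) * exp (- (l powr s * u))) * d)) (at s within X)"
proof -
  note D = DERIV_cmult_right[OF DERIV_mult[OF has_real_derivative_const_powr[OF assms] has_real_derivative_poly_exp[OF assms, of p u s X]], of d]
  show ?thesis
    by (rule DERIV_cong[OF D]) (simp add: kernel_step_def algebra_simps)
qed

lemma continuous_on_kernel:
  fixes l :: real and p :: "real poly"
  assumes "l > 0" "continuous_on UNIV b"
  shows "continuous_on X (\<lambda>u. l powr s * (poly p (l powr s * u) * exp (- (l powr s * u))) * (b t - b (t - u)))"
  by (intro continuous_intros continuous_on_compose2[OF assms(2)]) auto

text \<open>Differentiation under the integral sign. Each derivative brings out one factor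
  \<open>ln l\<close> and applies one further step to each of the two polynomials, so all orders
  have the same shape.\<close>

lemma mild_deriv_has_derivative:
  assumes l: "l > 0" and b: "continuous_on UNIV b"
  shows "((\<lambda>s. mild_deriv k l a c b t s) has_real_derivative mild_deriv (Suc k) l a c b t s) (at s)"
proof -
  define p q where "p = (boundary_step ^^ k) 1" and "q = (kernel_step ^^ k) 1"
  let ?f = "\<lambda>p s u. l powr s * (poly p (l powr s * u) * exp (- (l powr s * u))) * (b t - b (t - u))"
  have lp: "continuous_on UNIV (\<lambda>s. l powr s)" using l by (intro continuous_intros) auto
  have "((\<lambda>s. integral (cbox 0 t) (?f q s)) has_real_derivative
       integral (cbox 0 t) (\<lambda>u. ln l * ?f (kernel_step q) s u)) (at s within UNIV)"
  proof (rule leibniz_rule_field_derivative)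
    show "((\<lambda>s. ?f q s u) has_real_derivative ln l * ?f (kernel_step q) s u) (at s within UNIV)" for s u
      by (rule has_real_derivative_kernel[OF l])
    show "?f q s integrable_on cbox 0 t" for s
      using continuous_on_kernel[OF l b] by (intro integrable_continuous) auto
    show "continuous_on (UNIV \<times> cbox 0 t) (\<lambda>(s, u). ln l * ?f (kernel_step q) s u)"
      unfolding case_prod_unfold
      by (intro continuous_intros continuous_on_compose2[OF b] continuous_on_compose2[OF lp]) auto
  qed auto
  then have I: "((\<lambda>s. integral {0..t} (?f q s)) has_real_derivative
       ln l * integral {0..t} (?f (kernel_step q) s)) (at s)" by simp
  have B: "((\<lambda>s. poly p (l powr s * t) * exp (- (l powr s * t)) * (a + c * b t)) has_real_derivative
       ln l * (poly (boundary_step p) (l powr s * t) * exp (- (l powr s * t))) * (a + c * b t)) (at s)"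
    by (rule DERIV_cmult_right[OF has_real_derivative_poly_exp[OF l]])
  show ?thesis
    unfolding mild_deriv_def p_def[symmetric] q_def[symmetric] funpow.simps o_apply
    by (rule DERIV_cong[OF DERIV_cmult[OF DERIV_add[OF B DERIV_cmult[OF I]]]])
      (simp add: algebra_simps)
qed

section \<open>Estimates for the singular kernel, uniform in the eigenvalue\<close>

lemma integral_powr_le:
  fixes T \<beta> :: real
  assumes "T \<ge> 0" "\<beta> > -1"
  shows "integrable (restrict_space lborel {0<..<T}) (\<lambda>u. u powr \<beta>)"
    and "(LINT u|restrict_space lborel {0<..<T}. u powr \<beta>) \<le> T powr (\<beta> + 1) / (\<beta> + 1)"
proof -
  let ?f = "\<lambda>u. indicator {0..T} u *\<^sub>R u powr \<beta> :: real"
  have hi: "((\<lambda>u. u powr \<beta>) has_integral (T powr (\<beta> + 1) / (\<beta> + 1))) {0..T}"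
    using assms by (intro has_integral_powr_from_0) auto
  have ai: "(\<lambda>u. u powr \<beta>) absolutely_integrable_on {0..T}"
    using hi by (intro nonnegative_absolutely_integrable_1) (auto simp: integrable_on_def)
  \<comment> \<open>Absolute integrability refers to the completed Lebesgue measure;
    \<open>?f\<close> is Borel measurable, so it is integrable for \<open>lborel\<close> as
    well.\<close>
  have int: "integrable lborel ?f"
    using ai integrable_completion[of ?f lborel] unfolding set_integrable_def by simp
  have int2: "integrable lborel (\<lambda>u. indicator {0<..<T} u *\<^sub>R u powr \<beta> :: real)"
    by (rule Bochner_Integration.integrable_bound[OF int]) (auto simp: indicator_def)
  then show "integrable (restrict_space lborel {0<..<T}) (\<lambda>u. u powr \<beta>)"
    by (simp add: integrable_restrict_space)
  have "(LINT u|restrict_space lborel {0<..<T}. u powr \<beta>) = (LINT u|lborel. indicator {0<..<T} u *\<^sub>R u powr \<beta>)"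
    by (simp add: integral_restrict_space)
  also have "\<dots> \<le> (LINT u|lborel. ?f u)"
    using int2 int by (rule integral_mono) (auto simp: indicator_def)
  also have "\<dots> = integral {0..T} (\<lambda>u. u powr \<beta>)"
    using set_lebesgue_integral_eq_integral(2)[OF ai] integral_completion[of ?f lborel]
    by (simp add: set_lebesgue_integral_def)
  also have "\<dots> = T powr (\<beta> + 1) / (\<beta> + 1)" using integral_unique[OF hi] by simp
  finally show "(LINT u|restrict_space lborel {0<..<T}. u powr \<beta>) \<le> T powr (\<beta> + 1) / (\<beta> + 1)" .
qed

text \<open>Before Cauchy--Schwarz the weight \<open>u powr (-5/4)\<close> is split as
  \<open>u powr (-3/8) * u powr (-7/8)\<close>. The first factor has the integrable square
  \<open>u powr (-3/4)\<close>; the second, together with \<open>d\<close>, gives the weighted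
  square integral of the conclusion.\<close>

lemma singular_integral_bound:
  fixes d :: "real \<Rightarrow> real"
  defines "\<And>T. R T \<equiv> restrict_space lborel {0<..<T}"
  assumes T: "0 < t" "t < T" and d: "continuous_on UNIV d"
    and V: "integrable (R T) (\<lambda>u. u powr (-7/4) * (d u)\<^sup>2)"
    and g: "continuous_on {0..t} g" and C: "C \<ge> 0"
    and le: "\<And>u. 0 < u \<Longrightarrow> u \<le> t \<Longrightarrow> \<bar>g u\<bar> \<le> C * u powr (-5/4) * \<bar>d u\<bar>"
  shows "\<bar>integral {0..t} g\<bar> \<le> C * (2 * T powr (1/8)) * sqrt (LINT u|R T. u powr (-7/4) * (d u)\<^sup>2)"
proof -
  have [measurable]: "d \<in> borel_measurable borel" using d by (rule borel_measurable_continuous_onI)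
  let ?v = "\<lambda>u. u powr (-3/8)" and ?w = "\<lambda>u. u powr (-7/8) * \<bar>d u\<bar>"
  have sq: "(?v u)\<^sup>2 = u powr (-3/4)" "(?w u)\<^sup>2 = u powr (-7/4) * (d u)\<^sup>2" for u
  proof -
    have "(u powr (-7/8))\<^sup>2 = u powr (-7/4)" by (simp add: power2_eq_square flip: powr_add)
    then show "(?w u)\<^sup>2 = u powr (-7/4) * (d u)\<^sup>2" by (simp only: power_mult_distrib power2_abs)
  qed (simp add: power2_eq_square flip: powr_add)
  have vw: "?v \<in> L2 (R T)" "?w \<in> L2 (R T)"
    unfolding L2_def mem_Collect_eq sq R_def using V integral_powr_le(1)[of T "-3/4"] T
    by (auto simp: R_def measurable_restrict_space1)
  have G: "integrable (R T) (\<lambda>u. ?v u * ?w u)" by (rule L2_integrable_mult[OF vw])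
  have vwu: "?v u * ?w u = u powr (-5/4) * \<bar>d u\<bar>" for u
    by (simp add: mult.assoc[symmetric] flip: powr_add)
  have gi: "set_integrable lborel {0..t} g" by (rule borel_integrable_atLeastAtMost'[OF g])
  have "\<bar>integral {0..t} g\<bar> = \<bar>LINT u|lborel. indicator {0..t} u *\<^sub>R g u\<bar>"
    using set_borel_integral_eq_integral(2)[OF gi] by (simp add: set_lebesgue_integral_def)
  also have "\<dots> \<le> (LINT u|lborel. indicator {0<..<T} u *\<^sub>R (C * (?v u * ?w u)))"
  proof (rule order_trans[OF integral_abs_bound], rule integral_mono_AE)
    show "integrable lborel (\<lambda>u. \<bar>indicator {0..t} u *\<^sub>R g u\<bar>)"
      using gi unfolding set_integrable_def by (rule integrable_abs)
    show "integrable lborel (\<lambda>u. indicator {0<..<T} u *\<^sub>R (C * (?v u * ?w u)))"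
      using integrable_mult_right[OF G, of C] unfolding R_def
      by (subst (asm) integrable_restrict_space) simp_all
    show "AE u in lborel. \<bar>indicator {0..t} u *\<^sub>R g u\<bar> \<le> indicator {0<..<T} u *\<^sub>R (C * (?v u * ?w u))"
      using AE_lborel_singleton[of 0]
    proof eventually_elim
      case (elim u)
      show ?case unfolding vwu using le[of u] elim T C by (auto simp: indicator_def mult.assoc)
    qed
  qed
  also have "\<dots> = C * L2_inner (R T) ?v ?w"
    by (simp add: L2_inner_def R_def integral_restrict_space mult.left_commute)
  also have "\<dots> \<le> C * (L2_norm (R T) ?v * L2_norm (R T) ?w)"
    using L2_inner_abs_le[OF vw] C by (intro mult_left_mono) auto
  also have "\<dots> \<le> C * (2 * T powr (1/8) * L2_norm (R T) ?w)"
  proof (intro mult_left_mono mult_right_mono C)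
    \<comment> \<open>\<open>4 * T powr (1/4)\<close> is the integral of
      \<open>u powr (-3/4)\<close> over \<open>(0, T)\<close>; its root is the constant
      \<open>2 * T powr (1/8)\<close>.\<close>
    have "L2_norm (R T) ?v \<le> sqrt (4 * T powr (1/4))"
      unfolding L2_norm_def L2_inner_self sq R_def
      using integral_powr_le(2)[of T "-3/4"] T by simp
    also have "\<dots> = 2 * T powr (1/8)"
      using powr_half_sqrt_powr[of T "1/4"] T by (simp add: real_sqrt_mult)
    finally show "L2_norm (R T) ?v \<le> 2 * T powr (1/8)" .
  qed (simp add: L2_norm_nonneg)
  also have "\<dots> = C * (2 * T powr (1/8)) * sqrt (LINT u|R T. u powr (-7/4) * (d u)\<^sup>2)"
    unfolding L2_norm_def L2_inner_self sq by simp
  finally show ?thesis .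
qed

text \<open>For \<open>l \<ge> 1\<close> the power of the logarithm is at most a constant times
  \<open>exp (s0 * ln l / 4)\<close>, which \<open>l powr (- s / 4)\<close> compensates since
  \<open>s \<ge> s0\<close>. For \<open>\<alpha> \<le> l < 1\<close> both factors are bounded, by
  \<open>\<bar>ln l\<bar> \<le> \<bar>ln \<alpha>\<bar>\<close>.\<close>

lemma ln_power_powr_bound:
  fixes \<alpha> s0 s1 :: real
  assumes \<alpha>: "\<alpha> > 0" and s0: "s0 > 0"
  shows "\<exists>C\<ge>0. \<forall>l\<ge>\<alpha>. \<forall>s\<in>{s0..s1}. \<bar>ln l\<bar> ^ k * (l powr s) powr (-1/4) \<le> C"
proof -
  define C where "C = fact k * (4 / s0) ^ k + \<bar>ln \<alpha>\<bar> ^ k * exp (\<bar>ln \<alpha>\<bar> * \<bar>s1\<bar> / 4)"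
  have "\<bar>ln l\<bar> ^ k * (l powr s) powr (-1/4) \<le> C" if l: "l \<ge> \<alpha>" and s: "s \<in> {s0..s1}" for l s
  proof -
    have l0: "l > 0" using l \<alpha> by simp
    have eq: "(l powr s) powr (-1/4) = exp (- (s * ln l / 4))"
      using l0 by (simp add: powr_def)
    show ?thesis
    proof (cases "l \<ge> 1")
      case True
      then have ln0: "ln l \<ge> 0" by simp
      let ?x = "s0 * ln l / 4"
      have x0: "?x \<ge> 0" using ln0 s0 by simp
      have "\<bar>ln l\<bar> ^ k = (4 / s0) ^ k * ?x ^ k"
        using ln0 s0 by (simp add: power_mult_distrib[symmetric])
      also have "\<dots> \<le> (4 / s0) ^ k * (fact k * exp ?x)"
        using s0 by (intro mult_left_mono power_le_fact_exp x0) simp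
      finally have 1: "\<bar>ln l\<bar> ^ k \<le> fact k * (4 / s0) ^ k * exp ?x" by (simp add: mult_ac)
      have "s0 * ln l \<le> s * ln l" using s ln0 by (intro mult_right_mono) auto
      then have 2: "exp (- (s * ln l / 4)) \<le> exp (- ?x)" by simp
      have "\<bar>ln l\<bar> ^ k * exp (- (s * ln l / 4)) \<le> (fact k * (4 / s0) ^ k * exp ?x) * exp (- ?x)"
        by (rule mult_mono[OF 1 2]) (use s0 in auto)
      also have "\<dots> = fact k * (4 / s0) ^ k" by (simp add: exp_minus)
      also have "\<dots> \<le> C" by (simp add: C_def)
      finally show ?thesis by (simp only: eq)
    next
      case False
      then have ln: "ln l \<le> 0" "ln \<alpha> \<le> ln l" using l0 \<alpha> l by auto
      have 1: "\<bar>ln l\<bar> ^ k \<le> \<bar>ln \<alpha>\<bar> ^ k" using ln by (intro power_mono) auto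
      have "- (s * ln l) = s * \<bar>ln l\<bar>" using ln by simp
      also have "\<dots> \<le> \<bar>s1\<bar> * \<bar>ln \<alpha>\<bar>" using s s0 ln by (intro mult_mono) auto
      finally have 2: "exp (- (s * ln l / 4)) \<le> exp (\<bar>ln \<alpha>\<bar> * \<bar>s1\<bar> / 4)" by (simp add: mult.commute)
      have "\<bar>ln l\<bar> ^ k * exp (- (s * ln l / 4)) \<le> \<bar>ln \<alpha>\<bar> ^ k * exp (\<bar>ln \<alpha>\<bar> * \<bar>s1\<bar> / 4)"
        by (rule mult_mono[OF 1 2]) auto
      also have "\<dots> \<le> C" using s0 by (simp add: C_def)
      finally show ?thesis by (simp only: eq)
    qed
  qed
  moreover have "C \<ge> 0" using s0 by (simp add: C_def)
  ultimately show ?thesis by blast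
qed

text \<open>The constant is chosen before \<open>l\<close>, \<open>a\<close>, \<open>c\<close>,
  \<open>b\<close> and \<open>t\<close>, so it serves all modes, realisations and times at once. For
  \<open>c = 0\<close> the singular integral drops out of the mild solution and may diverge.\<close>

lemma mild_deriv_bound:
  fixes \<alpha> s0 s1 T :: real
  defines "R \<equiv> restrict_space lborel {0<..<T}"
  assumes \<alpha>: "\<alpha> > 0" and s0: "s0 > 0"
  shows "\<exists>C\<ge>0. \<forall>l\<ge>\<alpha>. \<forall>s\<in>{s0..s1}. \<forall>a c b t. continuous_on UNIV b \<longrightarrow> 0 < t \<longrightarrow> t < T \<longrightarrow>
     c = 0 \<or> integrable R (\<lambda>u. u powr (-7/4) * (b t - b (t - u))\<^sup>2) \<longrightarrow>
     \<bar>mild_deriv k l a c b t s\<bar> \<le> C * sqrt (t powr (-1/2) * (a\<^sup>2 + c\<^sup>2 * (b t)\<^sup>2)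
        + c\<^sup>2 * (LINT u|R. u powr (-7/4) * (b t - b (t - u))\<^sup>2))"
proof -
  define p q where "p = (boundary_step ^^ k) 1" and "q = (kernel_step ^^ k) 1"
  \<comment> \<open>Decay of order 1/4 for the boundary term and 5/4 for the kernel leaves the same
    factor \<open>\<kappa> powr (-1/4)\<close> in both, because the kernel carries an additional
    \<open>\<kappa>\<close>. This factor then absorbs the logarithms through
    \<open>C0\<close>.\<close>
  obtain C1 where C1: "C1 \<ge> 0" "\<And>x. x > 0 \<Longrightarrow> \<bar>poly p x * exp (- x)\<bar> \<le> C1 * x powr (-1/4)"
    using poly_exp_decay[of "1/4" p] by auto
  obtain C2 where C2: "C2 \<ge> 0" "\<And>x. x > 0 \<Longrightarrow> \<bar>poly q x * exp (- x)\<bar> \<le> C2 * x powr (-5/4)"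
    using poly_exp_decay[of "5/4" q] by auto
  obtain C0 where C0: "C0 \<ge> 0" "\<And>l s. l \<ge> \<alpha> \<Longrightarrow> s \<in> {s0..s1} \<Longrightarrow> \<bar>ln l\<bar> ^ k * (l powr s) powr (-1/4) \<le> C0"
    using ln_power_powr_bound[OF \<alpha> s0, of s1 k] by blast
  define c2 where "c2 = C2 * (2 * T powr (1/8))"
  have c2: "c2 \<ge> 0" using C2(1) by (simp add: c2_def)
  show ?thesis
  proof (intro exI[of _ "C0 * (2 * C1 + c2)"] conjI allI ballI impI)
    show "0 \<le> C0 * (2 * C1 + c2)" using C0(1) C1(1) c2 by simp
    fix l s a c t :: real and b :: "real \<Rightarrow> real"
    assume l: "\<alpha> \<le> l" and s: "s \<in> {s0..s1}" and b: "continuous_on UNIV b" and t: "0 < t" "t < T"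
      and V: "c = 0 \<or> integrable R (\<lambda>u. u powr (-7/4) * (b t - b (t - u))\<^sup>2)"
    define \<kappa> where "\<kappa> = l powr s"
    define v where "v = (LINT u|R. u powr (-7/4) * (b t - b (t - u))\<^sup>2)"
    define h where "h = sqrt (t powr (-1/2) * (a\<^sup>2 + c\<^sup>2 * (b t)\<^sup>2) + c\<^sup>2 * v)"
    have l0: "l > 0" using l \<alpha> by simp
    have \<kappa>: "\<kappa> > 0" using l0 by (simp add: \<kappa>_def)
    have v0: "v \<ge> 0" unfolding v_def by (intro Bochner_Integration.integral_nonneg) simp
    \<comment> \<open>\<open>h\<close> is the root of a sum of nonnegative terms, so it dominates
      the root of each of them; this gives \<open>h1\<close>, \<open>h2\<close> and
      \<open>h3\<close>.\<close>
    have root: "\<bar>x\<bar> \<le> h" if "x\<^sup>2 \<le> t powr (-1/2) * (a\<^sup>2 + c\<^sup>2 * (b t)\<^sup>2) + c\<^sup>2 * v" for x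
      using real_sqrt_le_mono[OF that] by (simp add: h_def)
    have tp: "(t powr (-1/4))\<^sup>2 = t powr (-1/2)" by (simp add: power2_eq_square flip: powr_add)
    have h1: "t powr (-1/4) * \<bar>a\<bar> \<le> h"
    proof -
      have "(t powr (-1/4) * a)\<^sup>2 \<le> t powr (-1/2) * (a\<^sup>2 + c\<^sup>2 * (b t)\<^sup>2) + c\<^sup>2 * v"
        using v0 by (simp only: power_mult_distrib tp distrib_left) simp
      from root[OF this] show ?thesis by (simp add: abs_mult)
    qed
    have h2: "t powr (-1/4) * \<bar>c * b t\<bar> \<le> h"
    proof -
      have "(t powr (-1/4) * (c * b t))\<^sup>2 \<le> t powr (-1/2) * (a\<^sup>2 + c\<^sup>2 * (b t)\<^sup>2) + c\<^sup>2 * v"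
        using v0 by (simp only: power_mult_distrib tp distrib_left) simp
      from root[OF this] show ?thesis by (simp add: abs_mult)
    qed
    have h3: "\<bar>c\<bar> * sqrt v \<le> h"
      using root[of "c * sqrt v"] v0 by (simp add: abs_mult power_mult_distrib)
    let ?g = "\<lambda>u. \<kappa> * (poly q (\<kappa> * u) * exp (- (\<kappa> * u))) * (b t - b (t - u))"
    have I: "\<bar>integral {0..t} ?g\<bar> \<le> (\<kappa> powr (-1/4) * C2) * (2 * T powr (1/8)) * sqrt v" if "c \<noteq> 0"
      unfolding v_def R_def
    proof (rule singular_integral_bound[OF t])
      show "continuous_on UNIV (\<lambda>u. b t - b (t - u))"
        by (intro continuous_intros continuous_on_compose2[OF b]) auto
      show "continuous_on {0..t} ?g" unfolding \<kappa>_def by (rule continuous_on_kernel[OF l0 b])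
      show "0 \<le> \<kappa> powr (-1/4) * C2" using C2(1) by simp
      fix u :: real assume u: "0 < u" "u \<le> t"
      have "\<kappa> * \<bar>poly q (\<kappa> * u) * exp (- (\<kappa> * u))\<bar> \<le> \<kappa> * (C2 * (\<kappa> * u) powr (-5/4))"
        using C2(2)[of "\<kappa> * u"] \<kappa> u by (intro mult_left_mono) auto
      also have "\<dots> = \<kappa> powr 1 * \<kappa> powr (-5/4) * C2 * u powr (-5/4)"
        using \<kappa> by (simp add: powr_mult mult_ac)
      also have "\<kappa> powr 1 * \<kappa> powr (-5/4) = \<kappa> powr (-1/4)" by (simp only: powr_add[symmetric]) simp
      finally show "\<bar>?g u\<bar> \<le> \<kappa> powr (-1/4) * C2 * u powr (-5/4) * \<bar>b t - b (t - u)\<bar>"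
        using \<kappa> by (simp add: abs_mult mult_right_mono)
    qed (use V that in \<open>simp add: R_def\<close>)
    have P: "\<bar>poly p (\<kappa> * t) * exp (- (\<kappa> * t)) * (a + c * b t)\<bar> \<le> \<kappa> powr (-1/4) * (C1 * (2 * h))"
    proof -
      have "\<bar>poly p (\<kappa> * t) * exp (- (\<kappa> * t)) * (a + c * b t)\<bar>
          \<le> (C1 * (\<kappa> * t) powr (-1/4)) * (\<bar>a\<bar> + \<bar>c * b t\<bar>)"
        unfolding abs_mult[of "_ * _" "a + _"] using C1(2)[of "\<kappa> * t"] C1(1) \<kappa> t
        by (intro mult_mono) auto
      also have "\<dots> = \<kappa> powr (-1/4) * (C1 * (t powr (-1/4) * \<bar>a\<bar> + t powr (-1/4) * \<bar>c * b t\<bar>))"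
        by (simp add: powr_mult algebra_simps)
      also have "\<dots> \<le> \<kappa> powr (-1/4) * (C1 * (2 * h))"
        using h1 h2 C1(1) by (intro mult_left_mono) auto
      finally show ?thesis .
    qed
    have h0: "h \<ge> 0" unfolding h_def using v0 by simp
    have Q: "\<bar>c * integral {0..t} ?g\<bar> \<le> \<kappa> powr (-1/4) * (c2 * h)"
    proof (cases "c = 0")
      case False
      have "\<bar>c * integral {0..t} ?g\<bar> \<le> \<bar>c\<bar> * ((\<kappa> powr (-1/4) * C2) * (2 * T powr (1/8)) * sqrt v)"
        unfolding abs_mult by (rule mult_left_mono[OF I[OF False]]) simp
      also have "\<dots> = \<kappa> powr (-1/4) * (c2 * (\<bar>c\<bar> * sqrt v))" by (simp add: c2_def mult_ac)
      also have "\<dots> \<le> \<kappa> powr (-1/4) * (c2 * h)" using h3 c2 by (intro mult_left_mono) auto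
      finally show ?thesis .
    qed (use c2 h0 in simp)
    have "\<bar>mild_deriv k l a c b t s\<bar> = \<bar>ln l\<bar> ^ k *
        \<bar>poly p (\<kappa> * t) * exp (- (\<kappa> * t)) * (a + c * b t) + c * integral {0..t} ?g\<bar>"
      by (simp add: mild_deriv_def p_def q_def \<kappa>_def abs_mult power_abs)
    also have "\<dots> \<le> \<bar>ln l\<bar> ^ k * (\<kappa> powr (-1/4) * (C1 * (2 * h)) + \<kappa> powr (-1/4) * (c2 * h))"
      by (rule mult_left_mono[OF order_trans[OF abs_triangle_ineq add_mono[OF P Q]]]) simp
    also have "\<dots> = (\<bar>ln l\<bar> ^ k * \<kappa> powr (-1/4)) * ((2 * C1 + c2) * h)" by (simp add: algebra_simps)
    also have "\<dots> \<le> C0 * ((2 * C1 + c2) * h)"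
      using C0(2)[OF l s] C1(1) c2 h0 by (intro mult_right_mono) (auto simp: \<kappa>_def)
    finally show "\<bar>mild_deriv k l a c b t s\<bar> \<le> C0 * (2 * C1 + c2) * sqrt (t powr (-1/2) * (a\<^sup>2 + c\<^sup>2 * (b t)\<^sup>2)
        + c\<^sup>2 * (LINT u|R. u powr (-7/4) * (b t - b (t - u))\<^sup>2))"
      by (simp add: h_def v_def mult.assoc)
  qed
qed

text \<open>The mean value inequality used twice: \<open>f x - x * f' s\<close> has derivative
  \<open>f' x - f' s\<close>, which is itself at most \<open>c * \<bar>x - s\<bar>\<close>.\<close>

lemma taylor_quadratic_bound:
  fixes f :: "real \<Rightarrow> real"
  assumes I: "convex I" "s \<in> I" "r \<in> I"
    and f: "\<And>x. x \<in> I \<Longrightarrow> (f has_real_derivative f' x) (at x)"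
    and f': "\<And>x. x \<in> I \<Longrightarrow> (f' has_real_derivative f'' x) (at x)"
    and le: "\<And>x. x \<in> I \<Longrightarrow> \<bar>f'' x\<bar> \<le> c"
  shows "\<bar>f r - f s - (r - s) * f' s\<bar> \<le> c * (r - s)\<^sup>2"
proof -
  have c: "c \<ge> 0" using le[OF I(2)] by linarith
  let ?X = "closed_segment s r"
  have sub: "?X \<subseteq> I" using I by (simp add: closed_segment_subset)
  have "norm ((\<lambda>x. f x - x * f' s) r - (\<lambda>x. f x - x * f' s) s) \<le> (c * \<bar>r - s\<bar>) * norm (r - s)"
  proof (rule field_differentiable_bound[of ?X])
    fix x assume x: "x \<in> ?X"
    then have xI: "x \<in> I" using sub by auto
    show "((\<lambda>x. f x - x * f' s) has_real_derivative (f' x - f' s)) (at x within ?X)"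
      using DERIV_subset[OF f[OF xI], of ?X] by (auto intro!: derivative_eq_intros)
    have "norm (f' x - f' s) \<le> c * norm (x - s)"
      by (rule field_differentiable_bound[OF I(1) DERIV_subset[OF f']])
        (use le xI I in auto)
    also have "\<dots> \<le> c * \<bar>r - s\<bar>"
      using segment_bound(1)[OF x] c by (intro mult_left_mono) auto
    finally show "norm (f' x - f' s) \<le> c * \<bar>r - s\<bar>" .
  qed auto
  also have "(c * \<bar>r - s\<bar>) * norm (r - s) = c * (r - s)\<^sup>2"
    by (simp add: power2_eq_square mult.assoc flip: abs_mult)
  also have "(\<lambda>x. f x - x * f' s) r - (\<lambda>x. f x - x * f' s) s = f r - f s - (r - s) * f' s"
    by (simp add: algebra_simps)
  finally show ?thesis by simp
qed

section \<open>Brownian motion and the stochastic integral\<close>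

text \<open>Covariances and path continuity are all that is used of Brownian motion below; paths are
  extended to negative times by their value at \<open>0\<close>.\<close>

locale continuous_brownian = prob_space M for M :: "'w measure" +
  fixes B :: "real \<Rightarrow> 'w \<Rightarrow> real"
  assumes cont: "continuous_on UNIV (\<lambda>t. B t \<omega>)"
    and B_L2: "B t \<in> L2 M"
    and cov: "L2_inner M (B s) (B t) = max 0 (min s t)"

section \<open>Gaussian moments, covariance and a continuous version\<close>

lemma (in prob_space) centered_gaussian_moments:
  assumes "centered_gaussian M X v"
  shows "X \<in> L2 M" "expectation X = 0" "L2_inner M X X = v"
proof -
  have [measurable]: "X \<in> borel_measurable M" and v: "v \<ge> 0"
    using assms by (auto simp: centered_gaussian_def)
  have "X \<in> L2 M \<and> expectation X = 0 \<and> L2_inner M X X = v"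
  proof (cases "v = 0")
    case True
    then have X: "AE \<omega> in M. X \<omega> = 0" using assms by (simp add: centered_gaussian_def)
    have X2: "AE \<omega> in M. (X \<omega>)\<^sup>2 = 0" using X by eventually_elim simp
    have "integrable M (\<lambda>\<omega>. (X \<omega>)\<^sup>2)" using X2 integrable_cong_AE[of "\<lambda>\<omega>. (X \<omega>)\<^sup>2" M "\<lambda>_. 0"] by simp
    moreover have "expectation X = 0" using X integral_cong_AE[of X M "\<lambda>_. 0"] by simp
    moreover have "expectation (\<lambda>\<omega>. (X \<omega>)\<^sup>2) = 0" using X2 integral_cong_AE[of "\<lambda>\<omega>. (X \<omega>)\<^sup>2" M "\<lambda>_. 0"] by simp
    ultimately show ?thesis by (simp add: L2_def L2_inner_self True)
  next
    case False
    then have s: "0 < sqrt v" using v by simp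
    have d: "distributed M lborel X (normal_density 0 (sqrt v))"
      using assms False by (simp add: centered_gaussian_def)
    have "integrable lborel (\<lambda>x. normal_density 0 (sqrt v) x * x ^ 2)"
      using integrable_normal_moment[OF s, of 0 2] by simp
    then have "integrable M (\<lambda>\<omega>. (X \<omega>)\<^sup>2)"
      using distributed_integrable[OF d, of "\<lambda>x. x\<^sup>2"] s by simp
    moreover have "expectation X = 0" using normal_distributed_expectation[OF s d] .
    moreover have "expectation (\<lambda>\<omega>. (X \<omega>)\<^sup>2) = v"
      using normal_distributed_variance[OF s d] \<open>expectation X = 0\<close> v by simp
    ultimately show ?thesis by (simp add: L2_def L2_inner_self)
  qed
  then show "X \<in> L2 M" "expectation X = 0" "L2_inner M X X = v" by auto
qed

lemma L2_cong_AE: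
  assumes "f \<in> L2 M" "g \<in> borel_measurable M" "AE x in M. f x = g x"
  shows "g \<in> L2 M"
  using assms(3) by (intro L2_bounded[OF assms(2,1)]) auto

lemma L2_inner_cong_AE:
  assumes "f \<in> borel_measurable M" "f' \<in> borel_measurable M" "g \<in> borel_measurable M" "g' \<in> borel_measurable M"
    and "AE x in M. f x = f' x" "AE x in M. g x = g' x"
  shows "L2_inner M f g = L2_inner M f' g'"
  unfolding L2_inner_def
  by (rule integral_cong_AE) (use assms in \<open>auto elim: AE_mp\<close>)

text \<open>\<open>B t\<close> is the sum of \<open>B s\<close> and a centered increment independent
  of it, so the mixed moment vanishes and the variance of \<open>B s\<close> remains.\<close>

lemma (in prob_space) brownian_covariance:
  assumes B: "brownian_motion M B" and st: "0 \<le> s" "s \<le> t"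
  shows "B s \<in> L2 M" "L2_inner M (B s) (B t) = s"
proof -
  have [measurable]: "B r \<in> borel_measurable M" if "r \<ge> 0" for r
    using B that by (simp add: brownian_motion_def)
  have [measurable]: "B s \<in> borel_measurable M" "B t \<in> borel_measurable M" "B 0 \<in> borel_measurable M"
    using st by auto
  have B0: "AE \<omega> in M. B 0 \<omega> = 0" using B by (simp add: brownian_motion_def)
  have gauss: "centered_gaussian M (\<lambda>\<omega>. B r \<omega> - B q \<omega>) (r - q)" if "0 \<le> q" "q < r" for q r
    using B that by (simp add: brownian_motion_def)
  have init: "AE \<omega> in M. B r \<omega> - B 0 \<omega> = B r \<omega>" for r using B0 by eventually_elim simp
  have L2: "B r \<in> L2 M \<and> L2_inner M (B r) (B r) = r" if "r \<ge> 0" for r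
  proof (cases "r = 0")
    case True
    have "(\<lambda>_. 0) \<in> L2 M" by (simp add: L2_def)
    then have "B 0 \<in> L2 M" by (rule L2_cong_AE) (use B0 in \<open>auto elim: AE_mp\<close>)
    moreover have "L2_inner M (B 0) (B 0) = L2_inner M (\<lambda>_. 0) (\<lambda>_. 0)"
      by (rule L2_inner_cong_AE) (use B0 in auto)
    ultimately show ?thesis using True by (simp add: L2_inner_def)
  next
    case False
    then have r: "r > 0" using that by simp
    have [measurable]: "B r \<in> borel_measurable M" using B that by (simp add: brownian_motion_def)
    note m = centered_gaussian_moments[OF gauss[OF order_refl r]]
    have "B r \<in> L2 M" by (rule L2_cong_AE[OF m(1) _ init]) simp
    moreover have "L2_inner M (B r) (B r) = r"
      using m(3) L2_inner_cong_AE[OF _ _ _ _ init init, of r r] by simp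
    ultimately show ?thesis by simp
  qed
  show s2: "B s \<in> L2 M" using L2[OF st(1)] by simp
  have t2: "B t \<in> L2 M" using L2 st by simp
  show "L2_inner M (B s) (B t) = s"
  proof (cases "s = 0 \<or> s = t")
    case True
    then show ?thesis
    proof
      assume "s = 0"
      moreover have "L2_inner M (B 0) (B t) = L2_inner M (\<lambda>_. 0) (B t)"
        by (rule L2_inner_cong_AE) (use B0 in auto)
      ultimately show ?thesis by (simp add: L2_inner_def)
    qed (use L2[OF st(1)] in simp)
  next
    case False
    then have s: "0 < s" "s < t" using st by auto
    \<comment> \<open>The partition \<open>0, s, t\<close> yields the two increments whose
      independence is used. The cases \<open>s = 0\<close> and \<open>s = t\<close> are treated
      apart because the Gaussian law of increments is given for intervals of positive
      length.\<close>
    define p :: "nat \<Rightarrow> real" where "p i = (if i = 0 then 0 else if i = 1 then s else t)" for i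
    have "0 \<le> p 0" by (simp add: p_def)
    moreover have "mono_on {..2} p" using s by (auto simp: mono_on_def p_def)
    moreover have "\<forall>n. \<forall>p :: nat \<Rightarrow> real. 0 \<le> p 0 \<and> mono_on {..n} p \<longrightarrow>
        indep_vars (\<lambda>_. borel) (\<lambda>i \<omega>. B (p (Suc i)) \<omega> - B (p i) \<omega>) {..<n}"
      using B by (simp add: brownian_motion_def)
    ultimately have ind: "indep_vars (\<lambda>_. borel) (\<lambda>i \<omega>. B (p (Suc i)) \<omega> - B (p i) \<omega>) {..<2}"
      by blast
    note m1 = centered_gaussian_moments[OF gauss[OF order_refl s(1)]]
    note m2 = centered_gaussian_moments[OF gauss[OF st(1) s(2)]]
    have int: "integrable M (\<lambda>\<omega>. B (p (Suc i)) \<omega> - B (p i) \<omega>)" if "i \<in> {..<2}" for i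
    proof -
      have "i = 0 \<or> i = 1" using that by auto
      then show ?thesis using L2_integrable[OF m1(1)] L2_integrable[OF m2(1)] by (auto simp: p_def)
    qed
    have "L2_inner M (\<lambda>\<omega>. B s \<omega> - B 0 \<omega>) (\<lambda>\<omega>. B t \<omega> - B s \<omega>) = 0"
      using indep_vars_lebesgue_integral[OF _ ind int] m1(2) m2(2)
      by (simp add: p_def L2_inner_def numeral_2_eq_2)
    moreover have "L2_inner M (\<lambda>\<omega>. B s \<omega> - B 0 \<omega>) (\<lambda>\<omega>. B t \<omega> - B s \<omega>) = L2_inner M (B s) (\<lambda>\<omega>. B t \<omega> - B s \<omega>)"
      by (rule L2_inner_cong_AE) (use init in auto)
    ultimately show ?thesis using L2[OF st(1)] s2 t2 by (simp add: L2_inner_diff_right)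
  qed
qed

text \<open>Setting the paths to 0 on a null set that contains all discontinuous ones gives
  continuity for every realisation. Evaluation at \<open>max 0 t\<close> freezes the paths before
  time 0, which gives \<open>B' (t - u)\<close> a meaning for all \<open>u\<close> in
  \<open>(0, T)\<close>.\<close>

lemma (in prob_space) brownian_motion_continuous_version:
  assumes B: "brownian_motion M B"
  shows "\<exists>B'. continuous_brownian M B' \<and> (AE \<omega> in M. \<forall>t\<ge>0. B' t \<omega> = B t \<omega>)"
proof -
  have "AE \<omega> in M. continuous_on {0..} (\<lambda>t. B t \<omega>)" using B by (simp add: brownian_motion_def)
  then obtain N where N: "N \<in> null_sets M" "{\<omega> \<in> space M. \<not> continuous_on {0..} (\<lambda>t. B t \<omega>)} \<subseteq> N"
    by (auto elim: AE_E simp: null_sets_def)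
  have [measurable]: "N \<in> sets M" using N by auto
  have [measurable]: "B (max 0 t) \<in> borel_measurable M" for t
    using B by (simp add: brownian_motion_def)
  define B' where "B' t \<omega> = indicator (space M - N) \<omega> * B (max 0 t) \<omega>" for t \<omega>
  have [measurable]: "B' t \<in> borel_measurable M" for t unfolding B'_def[abs_def] by measurable
  have notN: "AE \<omega> in M. \<omega> \<in> space M - N" using AE_not_in[OF N(1)] AE_space by eventually_elim auto
  have eq: "AE \<omega> in M. \<forall>t\<ge>0. B' t \<omega> = B t \<omega>"
    using notN by eventually_elim (simp add: B'_def)
  have eq': "AE \<omega> in M. B (max 0 t) \<omega> = B' t \<omega>" for t
    using notN by eventually_elim (simp add: B'_def)
  have "continuous_brownian M B'"
  proof (intro continuous_brownian.intro continuous_brownian_axioms.intro)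
    show "prob_space M" by unfold_locales
    show "continuous_on UNIV (\<lambda>t. B' t \<omega>)" for \<omega>
    proof (cases "\<omega> \<in> space M - N")
      case True
      then have "continuous_on {0..} (\<lambda>t. B t \<omega>)" using N(2) by auto
      then have "continuous_on UNIV (\<lambda>t. B (max 0 t) \<omega>)"
        by (rule continuous_on_compose2) (auto intro!: continuous_intros)
      with True show ?thesis by (simp add: B'_def)
    qed (simp add: B'_def)
    show "B' t \<in> L2 M" for t
      by (rule L2_cong_AE[OF brownian_covariance(1)[OF B _ order_refl] _ eq']) auto
    have le: "L2_inner M (B' s) (B' t) = max 0 (min s t)" if "s \<le> t" for s t
    proof -
      have "L2_inner M (B' s) (B' t) = L2_inner M (B (max 0 s)) (B (max 0 t))"
        by (rule L2_inner_cong_AE[symmetric, OF _ _ _ _ eq' eq']) auto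
      also have "\<dots> = max 0 s" using that by (intro brownian_covariance(2)[OF B]) auto
      finally show ?thesis using that by simp
    qed
    show "L2_inner M (B' s) (B' t) = max 0 (min s t)" for s t
    proof (cases "s \<le> t")
      case False
      then have "L2_inner M (B' t) (B' s) = max 0 (min t s)" by (intro le) simp
      then show ?thesis by (simp only: L2_inner_commute[of M "B' s"] min.commute[of s])
    qed (rule le)
  qed
  with eq show ?thesis by blast
qed

section \<open>Joint measurability and increments\<close>

context continuous_brownian begin

text \<open>Joint measurability in time and realisation: rounding the time down to a grid of mesh
  \<open>1 / real (Suc n)\<close> leaves countably many times, and path continuity recovers the
  value in the limit.\<close>

lemma borel_measurable_path_evaluation [measurable (raw)]:
  assumes [measurable]: "h \<in> measurable N M" "g \<in> borel_measurable N"
  shows "(\<lambda>x. B (g x) (h x)) \<in> borel_measurable N"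
proof (rule borel_measurable_LIMSEQ_real)
  have [measurable]: "B t \<in> borel_measurable M" for t using B_L2 by (rule L2_measurable)
  let ?f = "\<lambda>n x. B (real_of_int \<lfloor>g x * real (Suc n)\<rfloor> / real (Suc n)) (h x)"
  show "?f n \<in> borel_measurable N" for n
  proof (rule measurable_compose_countable[where f="\<lambda>i x. B (real_of_int i / real (Suc n)) (h x)"])
    show "(\<lambda>x. B (real_of_int i / real (Suc n)) (h x)) \<in> borel_measurable N" for i by measurable
    show "(\<lambda>x. \<lfloor>g x * real (Suc n)\<rfloor>) \<in> measurable N (count_space UNIV)" by measurable
  qed
  fix x assume "x \<in> space N"
  have "(\<lambda>n. real_of_int \<lfloor>g x * real (Suc n)\<rfloor> / real (Suc n)) \<longlonglongrightarrow> g x"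
  proof (rule tendsto_sandwich)
    show "(\<lambda>n. g x - 1 / real (Suc n)) \<longlonglongrightarrow> g x"
      using tendsto_diff[OF tendsto_const LIMSEQ_Suc[OF lim_1_over_n], of "g x"] by simp
    show "\<forall>\<^sub>F n in sequentially. g x - 1 / real (Suc n) \<le> real_of_int \<lfloor>g x * real (Suc n)\<rfloor> / real (Suc n)"
    proof (intro always_eventually allI)
      fix n
      have "g x * real (Suc n) - 1 \<le> real_of_int \<lfloor>g x * real (Suc n)\<rfloor>" by linarith
      then have "(g x * real (Suc n) - 1) / real (Suc n) \<le> real_of_int \<lfloor>g x * real (Suc n)\<rfloor> / real (Suc n)"
        by (rule divide_right_mono) simp
      then show "g x - 1 / real (Suc n) \<le> real_of_int \<lfloor>g x * real (Suc n)\<rfloor> / real (Suc n)"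
        by (simp add: diff_divide_distrib)
    qed
    show "\<forall>\<^sub>F n in sequentially. real_of_int \<lfloor>g x * real (Suc n)\<rfloor> / real (Suc n) \<le> g x"
    proof (intro always_eventually allI)
      fix n
      have "real_of_int \<lfloor>g x * real (Suc n)\<rfloor> / real (Suc n) \<le> (g x * real (Suc n)) / real (Suc n)"
        by (rule divide_right_mono) (auto simp: of_int_floor_le)
      then show "real_of_int \<lfloor>g x * real (Suc n)\<rfloor> / real (Suc n) \<le> g x" by simp
    qed
  qed simp
  moreover have "isCont (\<lambda>t. B t (h x)) (g x)"
    using cont by (simp add: continuous_on_eq_continuous_at)
  ultimately show "(\<lambda>n. ?f n x) \<longlonglongrightarrow> B (g x) (h x)"
    by (rule isCont_tendsto_compose[rotated])
qed

lemma increment_inner: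
  "L2_inner M (\<lambda>\<omega>. B t \<omega> - B s \<omega>) (B r) = max 0 (min t r) - max 0 (min s r)"
  by (simp add: L2_inner_diff_left B_L2 cov)

text \<open>An inequality, since the paths are constant before time 0 and gain no variance
  there.\<close>

lemma increment_variance_le:
  assumes "s \<le> t"
  shows "L2_inner M (\<lambda>\<omega>. B t \<omega> - B s \<omega>) (\<lambda>\<omega>. B t \<omega> - B s \<omega>) \<le> t - s"
  using assms by (simp add: L2_inner_diff_right L2_diff B_L2 increment_inner)

lemma nn_increment_variance_le:
  assumes "s \<le> t"
  shows "(\<integral>\<^sup>+\<omega>. ennreal ((B t \<omega> - B s \<omega>)\<^sup>2) \<partial>M) \<le> ennreal (t - s)"
proof -
  have "(\<integral>\<^sup>+\<omega>. ennreal ((B t \<omega> - B s \<omega>)\<^sup>2) \<partial>M) = ennreal (L2_inner M (\<lambda>\<omega>. B t \<omega> - B s \<omega>) (\<lambda>\<omega>. B t \<omega> - B s \<omega>))"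
    unfolding L2_inner_self using L2_diff[OF B_L2 B_L2, of t s]
    by (intro nn_integral_eq_integral) (auto simp: L2_def)
  then show ?thesis using increment_variance_le[OF assms] by (simp add: ennreal_leI)
qed

end

section \<open>The Ito integral of an exponential integrand\<close>

lemma integral_weighted_process:
  assumes "prob_space M" "finite_measure R"
    and k [measurable]: "k \<in> borel_measurable R" and kc: "\<And>u. u \<in> space R \<Longrightarrow> \<bar>k u\<bar> \<le> c"
    and V [measurable]: "(\<lambda>(\<omega>, u). V u \<omega>) \<in> borel_measurable (M \<Otimes>\<^sub>M R)"
    and V2: "integrable (M \<Otimes>\<^sub>M R) (\<lambda>(\<omega>, u). (V u \<omega>)\<^sup>2)"
  shows "(\<lambda>\<omega>. LINT u|R. k u * V u \<omega>) \<in> L2 M"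
    and "U \<in> L2 M \<Longrightarrow> L2_inner M (\<lambda>\<omega>. LINT u|R. k u * V u \<omega>) U = (LINT u|R. k u * L2_inner M (V u) U)"
proof -
  interpret M: prob_space M by fact
  interpret R: finite_measure R by fact
  interpret P: pair_sigma_finite M R ..
  interpret MR: finite_measure "M \<Otimes>\<^sub>M R" by (rule finite_measure_pair_measure) unfold_locales
  have kL2: "k \<in> L2 R"
  proof -
    have "(\<lambda>_. c) \<in> L2 R" by (simp add: L2_def)
    moreover have "AE u in R. \<bar>k u\<bar> \<le> \<bar>c\<bar>" using kc by (intro AE_I2) fastforce
    ultimately show ?thesis by (rule L2_bounded[OF k])
  qed
  have Vsec: "AE \<omega> in M. (\<lambda>u. V u \<omega>) \<in> L2 R"
    using P.AE_integrable_fst[OF V2] AE_space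
  proof eventually_elim
    case (elim \<omega>)
    have "(\<lambda>u. V u \<omega>) \<in> borel_measurable R"
      using measurable_compose[OF measurable_Pair1'[OF elim(2)] V] by simp
    with elim show ?case by (simp add: L2_def)
  qed
  have meas_I [measurable]: "(\<lambda>\<omega>. LINT u|R. k u * V u \<omega>) \<in> borel_measurable M"
    by (rule R.borel_measurable_lebesgue_integral) measurable
  have V2int: "integrable M (\<lambda>\<omega>. LINT u|R. (V u \<omega>)\<^sup>2)"
    using P.integrable_fst'[OF V2] by simp
  have "integrable M (\<lambda>\<omega>. (LINT u|R. k u * V u \<omega>)\<^sup>2)"
  proof (rule Bochner_Integration.integrable_bound)
    show "integrable M (\<lambda>\<omega>. L2_inner R k k * (LINT u|R. (V u \<omega>)\<^sup>2))" using V2int by simp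
    show "AE \<omega> in M. norm ((LINT u|R. k u * V u \<omega>)\<^sup>2) \<le> norm (L2_inner R k k * (LINT u|R. (V u \<omega>)\<^sup>2))"
      using Vsec
    proof eventually_elim
      case (elim \<omega>)
      have "(LINT u|R. k u * V u \<omega>)\<^sup>2 \<le> L2_inner R k k * (LINT u|R. (V u \<omega>)\<^sup>2)"
        using L2_inner_Cauchy_Schwarz[OF kL2 elim]
        by (simp only: L2_inner_self) (simp add: L2_inner_def)
      then show ?case by simp
    qed
  qed measurable
  then show "(\<lambda>\<omega>. LINT u|R. k u * V u \<omega>) \<in> L2 M" by (simp add: L2_def)
  assume U: "U \<in> L2 M"
  have [measurable]: "U \<in> borel_measurable M" using U by (rule L2_measurable)
  have U2: "integrable (M \<Otimes>\<^sub>M R) (\<lambda>(\<omega>, u). (U \<omega>)\<^sup>2)"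
  proof (rule P.Fubini_integrable)
    show "integrable M (\<lambda>\<omega>. LINT u|R. norm (case (\<omega>, u) of (\<omega>, u) \<Rightarrow> (U \<omega>)\<^sup>2))"
      using U by (simp add: L2_def)
  qed auto
  \<comment> \<open>Fubini requires joint integrability: boundedness of \<open>k\<close> and the
    inequality between a product and a sum of squares reduce it to \<open>V2\<close> and
    \<open>U2\<close>.\<close>
  have int: "integrable (M \<Otimes>\<^sub>M R) (\<lambda>(\<omega>, u). k u * V u \<omega> * U \<omega>)"
  proof (rule Bochner_Integration.integrable_bound)
    show "integrable (M \<Otimes>\<^sub>M R) (\<lambda>z. \<bar>c\<bar> * ((case z of (\<omega>, u) \<Rightarrow> (V u \<omega>)\<^sup>2) + (case z of (\<omega>, u) \<Rightarrow> (U \<omega>)\<^sup>2)))"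
      using V2 U2 by simp
    show "(\<lambda>(\<omega>, u). k u * V u \<omega> * U \<omega>) \<in> borel_measurable (M \<Otimes>\<^sub>M R)" by measurable
    show "AE z in M \<Otimes>\<^sub>M R. norm (case z of (\<omega>, u) \<Rightarrow> k u * V u \<omega> * U \<omega>)
        \<le> norm (\<bar>c\<bar> * ((case z of (\<omega>, u) \<Rightarrow> (V u \<omega>)\<^sup>2) + (case z of (\<omega>, u) \<Rightarrow> (U \<omega>)\<^sup>2)))"
    proof (rule AE_I2)
      fix z assume "z \<in> space (M \<Otimes>\<^sub>M R)"
      then obtain \<omega> u where z: "z = (\<omega>, u)" "u \<in> space R" by (auto simp: space_pair_measure)
      have "2 * (\<bar>V u \<omega>\<bar> * \<bar>U \<omega>\<bar>) \<le> (V u \<omega>)\<^sup>2 + (U \<omega>)\<^sup>2"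
        using sum_squares_bound[of "\<bar>V u \<omega>\<bar>" "\<bar>U \<omega>\<bar>"] by simp
      moreover have "0 \<le> \<bar>V u \<omega>\<bar> * \<bar>U \<omega>\<bar>" by simp
      ultimately have "\<bar>V u \<omega>\<bar> * \<bar>U \<omega>\<bar> \<le> (V u \<omega>)\<^sup>2 + (U \<omega>)\<^sup>2" by linarith
      then have "\<bar>k u\<bar> * (\<bar>V u \<omega>\<bar> * \<bar>U \<omega>\<bar>) \<le> \<bar>c\<bar> * ((V u \<omega>)\<^sup>2 + (U \<omega>)\<^sup>2)"
        using kc[OF z(2)] by (intro mult_mono) auto
      then show "norm (case z of (\<omega>, u) \<Rightarrow> k u * V u \<omega> * U \<omega>)
        \<le> norm (\<bar>c\<bar> * ((case z of (\<omega>, u) \<Rightarrow> (V u \<omega>)\<^sup>2) + (case z of (\<omega>, u) \<Rightarrow> (U \<omega>)\<^sup>2)))"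
        by (simp add: z abs_mult mult.assoc)
    qed
  qed
  have "L2_inner M (\<lambda>\<omega>. LINT u|R. k u * V u \<omega>) U = (LINT \<omega>|M. LINT u|R. k u * V u \<omega> * U \<omega>)"
    by (simp add: L2_inner_def)
  also have "\<dots> = (LINT u|R. LINT \<omega>|M. k u * V u \<omega> * U \<omega>)"
    by (rule P.Fubini_integral[symmetric]) (use int in simp)
  also have "\<dots> = (LINT u|R. k u * L2_inner M (V u) U)"
    by (simp add: L2_inner_def mult.assoc)
  finally show "L2_inner M (\<lambda>\<omega>. LINT u|R. k u * V u \<omega>) U = (LINT u|R. k u * L2_inner M (V u) U)" .
qed

text \<open>The increments of \<open>min (p i) r\<close> on the right are the covariances of
  Brownian increments with the value at time \<open>r\<close>. This is how the isometry between
  integrands and integrals enters.\<close>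

lemma step_function_inner_indicator:
  fixes p :: "nat \<Rightarrow> real"
  assumes p: "p 0 = 0" "p n = t" "mono_on {..n} p" and r: "0 \<le> r" "r \<le> t"
  shows "L2_inner (restrict_space lborel {0..t}) (step_function n p c) (indicator {..r})
    = (\<Sum>i<n. c i * (min (p (Suc i)) r - min (p i) r))"
proof -
  let ?K = "restrict_space lborel {0..t}"
  have pm: "p i \<le> p j" if "i \<le> j" "j \<le> n" for i j using p(3) that by (auto simp: mono_on_def)
  have ind: "integrable ?K (\<lambda>\<tau>. indicator {a<..b} \<tau> * indicator {..r} \<tau> :: real)"
    and val: "(LINT \<tau>|?K. indicator {a<..b} \<tau> * indicator {..r} \<tau>) = min b r - min a r"
    if ab: "0 \<le> a" "a \<le> b" "b \<le> t" for a b
  proof -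
    have eq: "indicator {0..t} \<tau> *\<^sub>R (indicator {a<..b} \<tau> * indicator {..r} \<tau> :: real) = indicator {min a r<..min b r} \<tau>" for \<tau>
      using ab r by (auto simp: indicator_def)
    show "integrable ?K (\<lambda>\<tau>. indicator {a<..b} \<tau> * indicator {..r} \<tau> :: real)"
      using ab by (subst integrable_restrict_space)
        (simp_all only: eq, auto intro!: integrable_real_indicator simp: min.mono)
    show "(LINT \<tau>|?K. indicator {a<..b} \<tau> * indicator {..r} \<tau>) = min b r - min a r"
      using ab by (subst integral_restrict_space) (simp_all only: eq, simp_all)
  qed
  have in_range: "0 \<le> p i \<and> p i \<le> p (Suc i) \<and> p (Suc i) \<le> t" if "i < n" for i
    using pm[of 0 i] pm[of i "Suc i"] pm[of "Suc i" n] p that by auto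
  have "L2_inner ?K (step_function n p c) (indicator {..r})
      = (LINT \<tau>|?K. (\<Sum>i<n. c i * (indicator {p i<..p (Suc i)} \<tau> * indicator {..r} \<tau>)))"
    unfolding L2_inner_def step_function_def sum_distrib_right mult.assoc ..
  also have "\<dots> = (\<Sum>i<n. c i * (LINT \<tau>|?K. indicator {p i<..p (Suc i)} \<tau> * indicator {..r} \<tau>))"
    using ind in_range by (subst Bochner_Integration.integral_sum) auto
  also have "\<dots> = (\<Sum>i<n. c i * (min (p (Suc i)) r - min (p i) r))"
    using val in_range by (intro sum.cong) auto
  finally show ?thesis .
qed

lemma exp_inner_indicator:
  fixes \<kappa> :: real
  assumes "\<kappa> > 0" "0 \<le> r" "r \<le> t"
  shows "L2_inner (restrict_space lborel {0..t}) (\<lambda>\<tau>. exp (- \<kappa> * (t - \<tau>))) (indicator {..r})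
    = (exp (- \<kappa> * (t - r)) - exp (- \<kappa> * t)) / \<kappa>"
proof -
  have "L2_inner (restrict_space lborel {0..t}) (\<lambda>\<tau>. exp (- \<kappa> * (t - \<tau>))) (indicator {..r})
      = (LINT \<tau>|lborel. exp (- \<kappa> * (t - \<tau>)) * indicator {0..r} \<tau>)"
    unfolding L2_inner_def
    by (subst integral_restrict_space) (use assms in \<open>auto intro!: Bochner_Integration.integral_cong simp: indicator_def\<close>)
  also have "\<dots> = exp (- \<kappa> * (t - r)) / \<kappa> - exp (- \<kappa> * (t - 0)) / \<kappa>"
    by (rule integral_FTC_Icc_real) (use assms in \<open>auto intro!: derivative_eq_intros\<close>)
  finally show ?thesis by (simp add: diff_divide_distrib)
qed

text \<open>The integrand vanishes for \<open>u \<le> t - r\<close> and equals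
  \<open>\<kappa> * exp (- \<kappa> * u) * (u - (t - r))\<close> beyond, where \<open>?G\<close> is
  an antiderivative.\<close>

lemma exp_kernel_min_integral:
  fixes \<kappa> :: real
  assumes "\<kappa> > 0" "0 \<le> r" "r \<le> t"
  shows "(LINT u|restrict_space lborel {0<..<t}. \<kappa> * exp (- \<kappa> * u) * (r - min (t - u) r))
    = (exp (- \<kappa> * (t - r)) - exp (- \<kappa> * t)) / \<kappa> - exp (- \<kappa> * t) * r"
proof -
  let ?G = "\<lambda>u. - exp (- \<kappa> * u) * (u - (t - r)) - exp (- \<kappa> * u) / \<kappa>"
  have "(LINT u|restrict_space lborel {0<..<t}. \<kappa> * exp (- \<kappa> * u) * (r - min (t - u) r))
      = (LINT u|lborel. indicator {0<..<t} u *\<^sub>R (\<kappa> * exp (- \<kappa> * u) * (r - min (t - u) r)))"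
    by (subst integral_restrict_space) auto
  also have "\<dots> = (LINT u|lborel. (\<kappa> * exp (- \<kappa> * u) * (u - (t - r))) * indicator {t - r..t} u)"
  proof (rule integral_cong_AE)
    show "AE u in lborel. indicator {0<..<t} u *\<^sub>R (\<kappa> * exp (- \<kappa> * u) * (r - min (t - u) r))
        = (\<kappa> * exp (- \<kappa> * u) * (u - (t - r))) * indicator {t - r..t} u"
      using AE_lborel_singleton[of 0] AE_lborel_singleton[of t]
      by eventually_elim (use assms in \<open>auto simp: indicator_def min_def\<close>)
  qed auto
  also have "\<dots> = ?G t - ?G (t - r)"
  proof (rule integral_FTC_Icc_real)
    fix u :: real
    show "(?G has_real_derivative \<kappa> * exp (- \<kappa> * u) * (u - (t - r))) (at u)"
      using assms by (auto intro!: derivative_eq_intros simp: field_simps)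
    show "isCont (\<lambda>u. \<kappa> * exp (- \<kappa> * u) * (u - (t - r))) u" by (intro continuous_intros)
  qed (use assms in simp)
  also have "\<dots> = (exp (- \<kappa> * (t - r)) - exp (- \<kappa> * t)) / \<kappa> - exp (- \<kappa> * t) * r"
    by (simp add: diff_divide_distrib)
  finally show ?thesis .
qed

context continuous_brownian begin

lemma increment_process_square_integrable:
  assumes "0 \<le> t"
  shows "integrable (M \<Otimes>\<^sub>M restrict_space lborel {0<..<t}) (\<lambda>(\<omega>, u). (B t \<omega> - B (t - u) \<omega>)\<^sup>2)"
proof -
  let ?R = "restrict_space lborel {0<..<t}"
  interpret R: finite_measure ?R by (rule finite_measure_restrict_bounded) auto
  interpret P: pair_sigma_finite M ?R ..
  have [measurable]: "(\<lambda>u. u) \<in> borel_measurable ?R" by (simp add: measurable_restrict_space1)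
  have meas [measurable]: "(\<lambda>(\<omega>, u). (B t \<omega> - B (t - u) \<omega>)\<^sup>2) \<in> borel_measurable (M \<Otimes>\<^sub>M ?R)"
    by measurable
  have "(\<integral>\<^sup>+z. ennreal (norm (case z of (\<omega>, u) \<Rightarrow> (B t \<omega> - B (t - u) \<omega>)\<^sup>2)) \<partial>(M \<Otimes>\<^sub>M ?R))
      = (\<integral>\<^sup>+u. (\<integral>\<^sup>+\<omega>. ennreal ((B t \<omega> - B (t - u) \<omega>)\<^sup>2) \<partial>M) \<partial>?R)"
    by (subst P.nn_integral_snd[symmetric]) simp_all
  also have "\<dots> \<le> (\<integral>\<^sup>+u. ennreal t \<partial>?R)"
  proof (rule nn_integral_mono)
    fix u assume "u \<in> space ?R"
    then have "0 < u" "u < t" by (auto simp: space_restrict_space)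
    then show "(\<integral>\<^sup>+\<omega>. ennreal ((B t \<omega> - B (t - u) \<omega>)\<^sup>2) \<partial>M) \<le> ennreal t"
      using nn_increment_variance_le[of "t - u" t] by (auto intro: order_trans ennreal_leI)
  qed
  also have "\<dots> < \<infinity>" by (simp add: R.emeasure_eq_measure ennreal_mult_less_top)
  finally show ?thesis by (intro integrableI_bounded meas)
qed

text \<open>Both sides have covariance \<open>\<integral>\<^sub>0\<^sup>r e\<^bsup>-\<kappa>(t - \<tau>)\<^esup> d\<tau>\<close> with \<open>B(r)\<close>, so their difference is orthogonal to
  all \<open>B(r)\<close>. Each side being a limit or an average of values of \<open>B\<close>, the difference is also
  orthogonal to itself.\<close>

lemma exponential_ito_integral:
  assumes t: "t > 0" and \<kappa>: "\<kappa> > 0"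
    and X: "has_ito_integral M B (\<lambda>\<tau>. exp (- \<kappa> * (t - \<tau>))) X t"
  shows "AE \<omega> in M. X \<omega> = exp (- \<kappa> * t) * B t \<omega>
     + (LINT u|restrict_space lborel {0<..<t}. \<kappa> * exp (- \<kappa> * u) * (B t \<omega> - B (t - u) \<omega>))"
proof -
  let ?R = "restrict_space lborel {0<..<t}" and ?K = "restrict_space lborel {0..t}"
  define f where "f \<tau> = exp (- \<kappa> * (t - \<tau>))" for \<tau>
  define V where "V u \<omega> = B t \<omega> - B (t - u) \<omega>" for u \<omega>
  define k where "k u = \<kappa> * exp (- \<kappa> * u)" for u
  define I where "I \<omega> = (LINT u|?R. k u * V u \<omega>)" for \<omega>
  define Y where "Y \<omega> = exp (- \<kappa> * t) * B t \<omega> + I \<omega>" for \<omega>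
  have R: "finite_measure ?R" by (rule finite_measure_restrict_bounded) auto
  have [measurable]: "(\<lambda>u. u) \<in> borel_measurable ?R" by (simp add: measurable_restrict_space1)
  have k [measurable]: "k \<in> borel_measurable ?R" unfolding k_def[abs_def] by measurable
  have kc: "\<bar>k u\<bar> \<le> \<kappa>" if "u \<in> space ?R" for u
    using that \<kappa> by (auto simp: k_def space_restrict_space abs_mult)
  have V [measurable]: "(\<lambda>(\<omega>, u). V u \<omega>) \<in> borel_measurable (M \<Otimes>\<^sub>M ?R)" unfolding V_def by measurable
  have V2: "integrable (M \<Otimes>\<^sub>M ?R) (\<lambda>(\<omega>, u). (V u \<omega>)\<^sup>2)"
    unfolding V_def by (rule increment_process_square_integrable) (use t in simp)
  have I: "I \<in> L2 M"
    unfolding I_def[abs_def] by (rule integral_weighted_process(1)[OF prob_space_axioms R k _ V V2]) (rule kc)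
  have IU: "L2_inner M I U = (LINT u|?R. k u * L2_inner M (V u) U)" if U: "U \<in> L2 M" for U
    unfolding I_def[abs_def]
    by (rule integral_weighted_process(2)[OF prob_space_axioms R k _ V V2 U]) (rule kc)
  have Y: "Y \<in> L2 M" unfolding Y_def[abs_def] by (intro L2_add L2_scale B_L2 I)
  from X obtain n p c where
    p: "\<And>i::nat. p i 0 = 0" "\<And>i. p i (n i) = t" "\<And>i. mono_on {..n i} (p i)" and
    lim_f: "L2_tendsto ?K (\<lambda>i. step_function (n i) (p i) (c i)) f" and
    lim_X: "L2_tendsto M (\<lambda>i. step_integral (n i) (p i) (c i) B) X"
    unfolding has_ito_integral_def f_def[symmetric] by blast
  have XL2: "X \<in> L2 M" and SL2: "step_integral (n i) (p i) (c i) B \<in> L2 M" for i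
    using lim_X by (auto simp: L2_tendsto_def)
  have step_inner: "L2_inner M (step_integral (n i) (p i) (c i) B) U
      = (\<Sum>j<n i. c i j * (L2_inner M (B (p i (Suc j))) U - L2_inner M (B (p i j)) U))" if U: "U \<in> L2 M" for i U
  proof -
    have "L2_inner M (\<lambda>\<omega>. \<Sum>j<n i. c i j * (B (p i (Suc j)) \<omega> - B (p i j) \<omega>)) U
        = (\<Sum>j<n i. L2_inner M (\<lambda>\<omega>. c i j * (B (p i (Suc j)) \<omega> - B (p i j) \<omega>)) U)"
      by (intro L2_inner_sum_left L2_scale L2_diff B_L2 U)
    then show ?thesis
      by (simp add: step_integral_def[abs_def] L2_inner_scale_left L2_inner_diff_left B_L2 U)
  qed
  have p_range: "0 \<le> p i j \<and> p i j \<le> t" if "j \<le> n i" for i j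
  proof -
    have "p i 0 \<le> p i j" "p i j \<le> p i (n i)" using p(3)[of i] that by (auto simp: mono_on_def)
    then show ?thesis by (simp add: p)
  qed
  \<comment> \<open>For step functions, the inner product of the integral with \<open>B r\<close>
    equals that of the integrand with \<open>indicator {..r}\<close> on the time axis; the two
    convergences in \<open>has_ito_integral\<close> carry this over to \<open>X\<close> and
    \<open>f\<close>.\<close>
  have XB: "L2_inner M X (B r) = (exp (- \<kappa> * (t - r)) - exp (- \<kappa> * t)) / \<kappa>" if r: "0 \<le> r" "r \<le> t" for r
  proof -
    have indL2: "indicator {..r} \<in> L2 ?K"
    proof -
      have "finite_measure ?K" by (rule finite_measure_restrict_bounded) auto
      then have "(\<lambda>_. 1 :: real) \<in> L2 ?K" by (simp add: L2_def finite_measure.integrable_const)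
      moreover have "indicator {..r} \<in> borel_measurable ?K" by (simp add: measurable_restrict_space1)
      ultimately show ?thesis by (elim L2_bounded[rotated]) (auto simp: indicator_def)
    qed
    have "(\<lambda>i. L2_inner M (step_integral (n i) (p i) (c i) B) (B r)) \<longlonglongrightarrow> L2_inner M X (B r)"
      by (rule L2_tendsto_inner[OF lim_X B_L2])
    moreover have "L2_inner M (step_integral (n i) (p i) (c i) B) (B r)
        = L2_inner ?K (step_function (n i) (p i) (c i)) (indicator {..r})" for i
    proof -
      have "L2_inner M (B (p i j)) (B r) = min (p i j) r" if "j \<le> n i" for j
        using p_range[OF that] r by (simp add: cov)
      then show ?thesis
        unfolding step_inner[OF B_L2] step_function_inner_indicator[OF p r] by (intro sum.cong) auto
    qed
    ultimately have "(\<lambda>i. L2_inner ?K (step_function (n i) (p i) (c i)) (indicator {..r})) \<longlonglongrightarrow> L2_inner M X (B r)"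
      by simp
    from LIMSEQ_unique[OF this L2_tendsto_inner[OF lim_f indL2]]
    show ?thesis using exp_inner_indicator[OF \<kappa> r] by (simp add: f_def[abs_def])
  qed
  have YB: "L2_inner M Y (B r) = (exp (- \<kappa> * (t - r)) - exp (- \<kappa> * t)) / \<kappa>" if r: "0 \<le> r" "r \<le> t" for r
  proof -
    have "L2_inner M I (B r) = (LINT u|?R. \<kappa> * exp (- \<kappa> * u) * (r - min (t - u) r))"
      unfolding IU[OF B_L2]
    proof (rule Bochner_Integration.integral_cong)
      fix u assume "u \<in> space ?R"
      then show "k u * L2_inner M (V u) (B r) = \<kappa> * exp (- \<kappa> * u) * (r - min (t - u) r)"
        using r increment_inner[of t "t - u" r] by (auto simp: V_def[abs_def] k_def space_restrict_space)
    qed simp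
    also have "\<dots> = (exp (- \<kappa> * (t - r)) - exp (- \<kappa> * t)) / \<kappa> - exp (- \<kappa> * t) * r"
      by (rule exp_kernel_min_integral[OF \<kappa> r])
    finally show ?thesis
      using r by (simp add: Y_def[abs_def] L2_inner_add_left L2_scale I B_L2 L2_inner_scale_left cov)
  qed
  define Z where "Z \<omega> = X \<omega> - Y \<omega>" for \<omega>
  have Z: "Z \<in> L2 M" unfolding Z_def[abs_def] by (rule L2_diff[OF XL2 Y])
  have BZ: "L2_inner M (B r) Z = 0" if "0 \<le> r" "r \<le> t" for r
    unfolding L2_inner_commute[of M "B r"] Z_def[abs_def] using XB[OF that] YB[OF that]
    by (simp add: L2_inner_diff_left XL2 Y B_L2)
  \<comment> \<open>A step integral combines values of \<open>B\<close> at times in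
    \<open>{0..t}\<close>, all orthogonal to \<open>Z\<close>; the orthogonality survives the
    limit.\<close>
  have "L2_inner M (step_integral (n i) (p i) (c i) B) Z = 0" for i
    unfolding step_inner[OF Z] using p_range by (intro sum.neutral) (auto simp: BZ)
  then have XZ: "L2_inner M X Z = 0"
    using L2_tendsto_inner[OF lim_X Z] by (simp add: LIMSEQ_const_iff)
  have "L2_inner M I Z = (LINT u|?R. 0)"
    unfolding IU[OF Z]
  proof (rule Bochner_Integration.integral_cong)
    fix u assume "u \<in> space ?R"
    then show "k u * L2_inner M (V u) Z = 0"
      using t by (auto simp: V_def[abs_def] L2_inner_diff_left B_L2 Z BZ space_restrict_space)
  qed simp
  then have YZ: "L2_inner M Y Z = 0"
    using t by (simp add: Y_def[abs_def] L2_inner_add_left L2_scale I B_L2 Z L2_inner_scale_left BZ)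
  have "L2_inner M Z Z = L2_inner M X Z - L2_inner M Y Z"
    using L2_inner_diff_left[OF XL2 Y Z] by (simp add: Z_def[abs_def])
  then have "(LINT \<omega>|M. (Z \<omega>)\<^sup>2) = 0" using XZ YZ by (simp add: L2_inner_self)
  then have "AE \<omega> in M. (Z \<omega>)\<^sup>2 = 0"
    using Z by (subst (asm) integral_nonneg_eq_0_iff_AE) (auto simp: L2_def)
  then show ?thesis
    by eventually_elim (simp add: Z_def Y_def I_def k_def V_def)
qed

end

section \<open>Energy estimates\<close>

text \<open>If \<open>f\<close> is not integrable, its integral is 0 by convention and the bound is
  trivial.\<close>

lemma ennreal_integral_le_nn_integral:
  assumes "\<And>x. 0 \<le> f x"
  shows "ennreal (integral\<^sup>L M f) \<le> (\<integral>\<^sup>+x. ennreal (f x) \<partial>M)"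
proof (cases "integrable M f")
  case True
  then show ?thesis using nn_integral_eq_integral[OF True] assms by simp
qed (simp add: not_integrable_integral_eq)

text \<open>Extended nonnegative values keep a divergent singular integral visible: finiteness of
  the energy then carries information, and Tonelli's theorem applies directly.\<close>

definition energy_density :: "real \<Rightarrow> real \<Rightarrow> real \<Rightarrow> (real \<Rightarrow> real) \<Rightarrow> real \<Rightarrow> ennreal" where
  "energy_density T a c b t = ennreal (t powr (-1/2) * (a\<^sup>2 + c\<^sup>2 * (b t)\<^sup>2))
     + ennreal (c\<^sup>2) * (\<integral>\<^sup>+u. ennreal (u powr (-7/4) * (b t - b (t - u))\<^sup>2) \<partial>restrict_space lborel {0<..<T})"

text \<open>The real counterpart, which is the right-hand side of the derivative bound up to the
  constant. Its integral takes the default value 0 where it diverges; finite energy excludes this at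
  almost every time unless \<open>c = 0\<close>.\<close>

definition path_majorant :: "real \<Rightarrow> real \<Rightarrow> real \<Rightarrow> (real \<Rightarrow> real) \<Rightarrow> real \<Rightarrow> real" where
  "path_majorant T a c b t = sqrt (t powr (-1/2) * (a\<^sup>2 + c\<^sup>2 * (b t)\<^sup>2)
     + c\<^sup>2 * (LINT u|restrict_space lborel {0<..<T}. u powr (-7/4) * (b t - b (t - u))\<^sup>2))"

lemma path_majorant_L2:
  fixes T :: real
  defines "R \<equiv> restrict_space lborel {0<..<T}"
  assumes b: "continuous_on UNIV b" and fin: "(\<integral>\<^sup>+t. energy_density T a c b t \<partial>R) < \<infinity>"
  shows "path_majorant T a c b \<in> L2 R"
    and "ennreal (L2_inner R (path_majorant T a c b) (path_majorant T a c b)) \<le> (\<integral>\<^sup>+t. energy_density T a c b t \<partial>R)"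
    and "AE t in R. c = 0 \<or> integrable R (\<lambda>u. u powr (-7/4) * (b t - b (t - u))\<^sup>2)"
proof -
  interpret R: finite_measure R unfolding R_def by (rule finite_measure_restrict_bounded) auto
  have [measurable]: "b \<in> borel_measurable borel" using b by (rule borel_measurable_continuous_onI)
  have [measurable]: "(\<lambda>u. u) \<in> borel_measurable R" unfolding R_def by (simp add: measurable_restrict_space1)
  let ?V = "\<lambda>t. LINT u|R. u powr (-7/4) * (b t - b (t - u))\<^sup>2"
  have V0: "0 \<le> ?V t" for t by (intro Bochner_Integration.integral_nonneg) simp
  have [measurable]: "?V \<in> borel_measurable R"
    by (rule R.borel_measurable_lebesgue_integral) measurable
  have [measurable]: "path_majorant T a c b \<in> borel_measurable R"
    unfolding path_majorant_def[abs_def] R_def[symmetric] by measurable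
  have [measurable]: "energy_density T a c b \<in> borel_measurable R"
    unfolding energy_density_def[abs_def] R_def[symmetric] by measurable
  have sq: "(path_majorant T a c b t)\<^sup>2 = t powr (-1/2) * (a\<^sup>2 + c\<^sup>2 * (b t)\<^sup>2) + c\<^sup>2 * ?V t" for t
    unfolding path_majorant_def R_def[symmetric] using V0[of t] by simp
  have le: "ennreal ((path_majorant T a c b t)\<^sup>2) \<le> energy_density T a c b t" for t
  proof -
    have "ennreal (c\<^sup>2 * ?V t) = ennreal (c\<^sup>2) * ennreal (?V t)" using V0[of t] by (simp add: ennreal_mult)
    moreover have "ennreal (?V t) \<le> (\<integral>\<^sup>+u. ennreal (u powr (-7/4) * (b t - b (t - u))\<^sup>2) \<partial>R)"
      by (rule ennreal_integral_le_nn_integral) simp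
    ultimately show ?thesis
      unfolding sq energy_density_def R_def[symmetric] using V0[of t]
      by (subst ennreal_plus) (auto intro!: add_left_mono mult_left_mono)
  qed
  have le_int: "(\<integral>\<^sup>+t. ennreal ((path_majorant T a c b t)\<^sup>2) \<partial>R) \<le> (\<integral>\<^sup>+t. energy_density T a c b t \<partial>R)"
    by (rule nn_integral_mono) (rule le)
  have int: "integrable R (\<lambda>t. (path_majorant T a c b t)\<^sup>2)"
    using le_int fin by (intro integrableI_bounded) auto
  then show "path_majorant T a c b \<in> L2 R" by (simp add: L2_def)
  show "ennreal (L2_inner R (path_majorant T a c b) (path_majorant T a c b)) \<le> (\<integral>\<^sup>+t. energy_density T a c b t \<partial>R)"
    using le_int nn_integral_eq_integral[OF int] by (simp add: L2_inner_self)
  have "AE t in R. energy_density T a c b t \<noteq> \<infinity>"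
    by (rule nn_integral_PInf_AE) (use fin in auto)
  then show "AE t in R. c = 0 \<or> integrable R (\<lambda>u. u powr (-7/4) * (b t - b (t - u))\<^sup>2)"
  proof eventually_elim
    case (elim t)
    show ?case
    \<comment> \<open>For \<open>c = 0\<close> the convention that 0 times infinity is 0 hides a
      divergent integral, so integrability is derived in the other case.\<close>
    proof (cases "c = 0")
      case False
      have "(\<integral>\<^sup>+u. ennreal (u powr (-7/4) * (b t - b (t - u))\<^sup>2) \<partial>R) \<noteq> \<infinity>"
      proof
        assume "(\<integral>\<^sup>+u. ennreal (u powr (-7/4) * (b t - b (t - u))\<^sup>2) \<partial>R) = \<infinity>"
        then have "energy_density T a c b t = \<infinity>"
          using False by (simp add: energy_density_def R_def[symmetric] ennreal_mult_top)
        with elim show False by simp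
      qed
      then have "integrable R (\<lambda>u. u powr (-7/4) * (b t - b (t - u))\<^sup>2)"
        by (intro integrableI_bounded) (auto simp: less_top)
      then show ?thesis ..
    qed simp
  qed
qed

text \<open>Tonelli moves the expectation inside. The increment over a lag \<open>u\<close> has
  variance at most \<open>u\<close>, so the weight \<open>u powr (-7/4)\<close> becomes
  \<open>u powr (-3/4)\<close>, which is integrable at 0. The bound is linear in
  \<open>a\<^sup>2 + c\<^sup>2\<close> and can therefore be summed over all modes.\<close>

lemma (in continuous_brownian) energy_bound:
  fixes T :: real
  assumes T: "T > 0"
  defines "R \<equiv> restrict_space lborel {0<..<T}"
  shows "(\<lambda>\<omega>. \<integral>\<^sup>+t. energy_density T a c (\<lambda>t. B t \<omega>) t \<partial>R) \<in> borel_measurable M"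
    and "(\<integral>\<^sup>+\<omega>. \<integral>\<^sup>+t. energy_density T a c (\<lambda>t. B t \<omega>) t \<partial>R \<partial>M)
      \<le> ennreal (((1 + T) * (2 * T powr (1/2)) + 4 * T * T powr (1/4)) * (a\<^sup>2 + c\<^sup>2))"
proof -
  interpret R: finite_measure R unfolding R_def by (rule finite_measure_restrict_bounded) auto
  interpret P: pair_sigma_finite M R ..
  have id [measurable]: "(\<lambda>u. u) \<in> borel_measurable R" unfolding R_def by (simp add: measurable_restrict_space1)
  have meas [measurable]: "(\<lambda>(\<omega>, t). energy_density T a c (\<lambda>t. B t \<omega>) t) \<in> borel_measurable (M \<Otimes>\<^sub>M R)"
    unfolding energy_density_def R_def[symmetric] by measurable
  show "(\<lambda>\<omega>. \<integral>\<^sup>+t. energy_density T a c (\<lambda>t. B t \<omega>) t \<partial>R) \<in> borel_measurable M"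
    by (rule R.borel_measurable_nn_integral) (rule meas)
  \<comment> \<open>\<open>A\<close> bounds the expectation \<open>a\<^sup>2 + c\<^sup>2 * t\<close>
    of the boundary square for all times below \<open>T\<close>.\<close>
  define A where "A = (1 + T) * (a\<^sup>2 + c\<^sup>2)"
  have A0: "A \<ge> 0" using T by (simp add: A_def)
  have inner: "(\<integral>\<^sup>+\<omega>. energy_density T a c (\<lambda>t. B t \<omega>) t \<partial>M)
      \<le> ennreal (t powr (-1/2) * A + c\<^sup>2 * (4 * T powr (1/4)))" if "t \<in> space R" for t
  proof -
    have t: "0 < t" "t < T" using that by (auto simp: R_def space_restrict_space)
    have [measurable]: "B r \<in> borel_measurable M" for r using B_L2 by (rule L2_measurable)
    have B2: "integrable M (\<lambda>\<omega>. (B t \<omega>)\<^sup>2)" "(LINT \<omega>|M. (B t \<omega>)\<^sup>2) = t"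
      using B_L2[of t] cov[of t t] t by (simp_all add: L2_def L2_inner_self)
    have "(\<integral>\<^sup>+\<omega>. ennreal (t powr (-1/2) * (a\<^sup>2 + c\<^sup>2 * (B t \<omega>)\<^sup>2)) \<partial>M)
        = ennreal (LINT \<omega>|M. t powr (-1/2) * (a\<^sup>2 + c\<^sup>2 * (B t \<omega>)\<^sup>2))"
      using B2(1) by (intro nn_integral_eq_integral) auto
    also have "(LINT \<omega>|M. t powr (-1/2) * (a\<^sup>2 + c\<^sup>2 * (B t \<omega>)\<^sup>2)) = t powr (-1/2) * (a\<^sup>2 + c\<^sup>2 * t)"
      using B2 by (simp add: prob_space)
    also have "\<dots> \<le> t powr (-1/2) * A"
    proof (rule mult_left_mono)
      have "c\<^sup>2 * t \<le> c\<^sup>2 * T" using t by (intro mult_left_mono) auto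
      moreover have "0 \<le> T * a\<^sup>2" using T by simp
      ultimately have "a\<^sup>2 + c\<^sup>2 * t \<le> a\<^sup>2 + c\<^sup>2 * T + (T * a\<^sup>2 + c\<^sup>2)" by (simp add: add_increasing2)
      also have "\<dots> = A" by (simp add: A_def algebra_simps)
      finally show "a\<^sup>2 + c\<^sup>2 * t \<le> A" .
    qed simp
    finally have 1: "(\<integral>\<^sup>+\<omega>. ennreal (t powr (-1/2) * (a\<^sup>2 + c\<^sup>2 * (B t \<omega>)\<^sup>2)) \<partial>M) \<le> ennreal (t powr (-1/2) * A)"
      by (simp add: ennreal_leI)
    have "(\<integral>\<^sup>+\<omega>. \<integral>\<^sup>+u. ennreal (u powr (-7/4) * (B t \<omega> - B (t - u) \<omega>)\<^sup>2) \<partial>R \<partial>M)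
        = (\<integral>\<^sup>+u. \<integral>\<^sup>+\<omega>. ennreal (u powr (-7/4) * (B t \<omega> - B (t - u) \<omega>)\<^sup>2) \<partial>M \<partial>R)"
      by (rule P.Fubini'[symmetric]) measurable
    also have "\<dots> \<le> (\<integral>\<^sup>+u. ennreal (u powr (-3/4)) \<partial>R)"
    proof (rule nn_integral_mono)
      fix u assume "u \<in> space R"
      then have u: "0 < u" by (simp add: R_def space_restrict_space)
      have "(\<integral>\<^sup>+\<omega>. ennreal (u powr (-7/4) * (B t \<omega> - B (t - u) \<omega>)\<^sup>2) \<partial>M)
          = ennreal (u powr (-7/4)) * (\<integral>\<^sup>+\<omega>. ennreal ((B t \<omega> - B (t - u) \<omega>)\<^sup>2) \<partial>M)"
        by (simp add: ennreal_mult nn_integral_cmult)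
      also have "\<dots> \<le> ennreal (u powr (-7/4)) * ennreal u"
        using nn_increment_variance_le[of "t - u" t] u by (intro mult_left_mono) auto
      also have "\<dots> = ennreal (u powr (-7/4) * u powr 1)" using u by (simp add: ennreal_mult)
      also have "u powr (-7/4) * u powr 1 = u powr (-3/4)" by (simp only: powr_add[symmetric]) simp
      finally show "(\<integral>\<^sup>+\<omega>. ennreal (u powr (-7/4) * (B t \<omega> - B (t - u) \<omega>)\<^sup>2) \<partial>M) \<le> ennreal (u powr (-3/4))" .
    qed
    also have "\<dots> = ennreal (LINT u|R. u powr (-3/4))"
      unfolding R_def using integral_powr_le(1)[of T "-3/4"] T by (intro nn_integral_eq_integral) auto
    also have "\<dots> \<le> ennreal (4 * T powr (1/4))"
      unfolding R_def using integral_powr_le(2)[of T "-3/4"] T by (intro ennreal_leI) simp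
    finally have 2: "(\<integral>\<^sup>+\<omega>. \<integral>\<^sup>+u. ennreal (u powr (-7/4) * (B t \<omega> - B (t - u) \<omega>)\<^sup>2) \<partial>R \<partial>M) \<le> ennreal (4 * T powr (1/4))" .
    have "(\<integral>\<^sup>+\<omega>. energy_density T a c (\<lambda>t. B t \<omega>) t \<partial>M)
        = (\<integral>\<^sup>+\<omega>. ennreal (t powr (-1/2) * (a\<^sup>2 + c\<^sup>2 * (B t \<omega>)\<^sup>2)) \<partial>M)
          + ennreal (c\<^sup>2) * (\<integral>\<^sup>+\<omega>. \<integral>\<^sup>+u. ennreal (u powr (-7/4) * (B t \<omega> - B (t - u) \<omega>)\<^sup>2) \<partial>R \<partial>M)"
      unfolding energy_density_def R_def[symmetric]
      by (subst nn_integral_add, measurable, subst nn_integral_cmult) simp_all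
    also have "\<dots> \<le> ennreal (t powr (-1/2) * A) + ennreal (c\<^sup>2) * ennreal (4 * T powr (1/4))"
      by (intro add_mono mult_left_mono 1 2) simp
    also have "\<dots> = ennreal (t powr (-1/2) * A + c\<^sup>2 * (4 * T powr (1/4)))"
      using A0 by (subst ennreal_plus) (simp_all add: ennreal_mult)
    finally show ?thesis .
  qed
  have intp: "integrable R (\<lambda>t. t powr (-1/2))"
    unfolding R_def using integral_powr_le(1)[of T "-1/2"] T by simp
  have "(\<integral>\<^sup>+\<omega>. \<integral>\<^sup>+t. energy_density T a c (\<lambda>t. B t \<omega>) t \<partial>R \<partial>M)
      = (\<integral>\<^sup>+t. \<integral>\<^sup>+\<omega>. energy_density T a c (\<lambda>t. B t \<omega>) t \<partial>M \<partial>R)"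
    by (rule P.Fubini'[symmetric]) (rule meas)
  also have "\<dots> \<le> (\<integral>\<^sup>+t. ennreal (t powr (-1/2) * A + c\<^sup>2 * (4 * T powr (1/4))) \<partial>R)"
    by (rule nn_integral_mono) (rule inner)
  also have "\<dots> = ennreal (LINT t|R. t powr (-1/2) * A + c\<^sup>2 * (4 * T powr (1/4)))"
    using A0 intp by (intro nn_integral_eq_integral) auto
  also have "(LINT t|R. t powr (-1/2) * A + c\<^sup>2 * (4 * T powr (1/4)))
      = (LINT t|R. t powr (-1/2)) * A + c\<^sup>2 * (4 * T powr (1/4)) * measure R (space R)"
    using intp by simp
  also have "measure R (space R) = T"
    using T by (simp add: R_def measure_restrict_space space_restrict_space)
  also have "ennreal ((LINT t|R. t powr (-1/2)) * A + c\<^sup>2 * (4 * T powr (1/4)) * T)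
      \<le> ennreal (((1 + T) * (2 * T powr (1/2)) + 4 * T * T powr (1/4)) * (a\<^sup>2 + c\<^sup>2))"
  proof (rule ennreal_leI)
    have "(LINT t|R. t powr (-1/2)) * A \<le> (2 * T powr (1/2)) * A"
      unfolding R_def using integral_powr_le(2)[of T "-1/2"] T A0 by (intro mult_right_mono) auto
    moreover have "c\<^sup>2 * (4 * T powr (1/4)) * T \<le> (a\<^sup>2 + c\<^sup>2) * (4 * T powr (1/4)) * T"
      using T by (intro mult_right_mono) auto
    ultimately have "(LINT t|R. t powr (-1/2)) * A + c\<^sup>2 * (4 * T powr (1/4)) * T
        \<le> (2 * T powr (1/2)) * A + (a\<^sup>2 + c\<^sup>2) * (4 * T powr (1/4)) * T" by (rule add_mono)
    also have "\<dots> = ((1 + T) * (2 * T powr (1/2)) + 4 * T * T powr (1/4)) * (a\<^sup>2 + c\<^sup>2)"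
      by (simp add: A_def algebra_simps)
    finally show "(LINT t|R. t powr (-1/2)) * A + c\<^sup>2 * (4 * T powr (1/4)) * T
        \<le> ((1 + T) * (2 * T powr (1/2)) + 4 * T * T powr (1/4)) * (a\<^sup>2 + c\<^sup>2)" .
  qed
  finally show "(\<integral>\<^sup>+\<omega>. \<integral>\<^sup>+t. energy_density T a c (\<lambda>t. B t \<omega>) t \<partial>R \<partial>M)
      \<le> ennreal (((1 + T) * (2 * T powr (1/2)) + 4 * T * T powr (1/4)) * (a\<^sup>2 + c\<^sup>2))" .
qed

text \<open>The expectation of the sum is the sum of the expectations, here dominated by a
  convergent series, and a nonnegative variable with finite expectation is almost surely
  finite.\<close>

lemma energy_summable_AE:
  assumes M: "prob_space M" and B: "\<And>j. continuous_brownian M (B j)" and T: "T > 0"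
    and summ: "summable (\<lambda>j. (a j)\<^sup>2 + (c j)\<^sup>2)"
  shows "AE \<omega> in M. (\<Sum>j. \<integral>\<^sup>+t. energy_density T (a j) (c j) (\<lambda>t. B j t \<omega>) t \<partial>restrict_space lborel {0<..<T}) < \<infinity>"
proof -
  let ?G = "\<lambda>j \<omega>. \<integral>\<^sup>+t. energy_density T (a j) (c j) (\<lambda>t. B j t \<omega>) t \<partial>restrict_space lborel {0<..<T}"
  define C where "C = (1 + T) * (2 * T powr (1/2)) + 4 * T * T powr (1/4)"
  have C0: "C \<ge> 0" using T by (simp add: C_def)
  have [measurable]: "?G j \<in> borel_measurable M" for j
    by (rule continuous_brownian.energy_bound(1)[OF B T])
  have "(\<integral>\<^sup>+\<omega>. (\<Sum>j. ?G j \<omega>) \<partial>M) = (\<Sum>j. \<integral>\<^sup>+\<omega>. ?G j \<omega> \<partial>M)" by (rule nn_integral_suminf) simp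
  also have "\<dots> \<le> (\<Sum>j. ennreal (C * ((a j)\<^sup>2 + (c j)\<^sup>2)))"
    unfolding C_def by (intro suminf_le continuous_brownian.energy_bound(2)[OF B T]) auto
  also have "\<dots> = ennreal (\<Sum>j. C * ((a j)\<^sup>2 + (c j)\<^sup>2))"
    using C0 summ by (intro suminf_ennreal2) auto
  finally have "(\<integral>\<^sup>+\<omega>. (\<Sum>j. ?G j \<omega>) \<partial>M) < \<infinity>" by (rule le_less_trans) simp
  then have "AE \<omega> in M. (\<Sum>j. ?G j \<omega>) \<noteq> \<infinity>" by (intro nn_integral_PInf_AE) auto
  then show ?thesis by eventually_elim (simp add: less_top)
qed

section \<open>The identification problem\<close>

text \<open>The integral over \<open>(0, t)\<close> matches the representation of the Ito integral,
  while the cut-off integral over the fixed interval \<open>(0, T)\<close> gives access to joint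
  measurability in time and realisation.\<close>

lemma mild_deriv_0_integral:
  assumes l: "l > 0" and b: "continuous_on UNIV b" and t: "0 < t" "t < T"
  shows "mild_deriv 0 l a c b t s = exp (- (l powr s) * t) * (a + c * b t)
      + c * (LINT u|restrict_space lborel {0<..<t}. l powr s * exp (- (l powr s) * u) * (b t - b (t - u)))"
    and "mild_deriv 0 l a c b t s = exp (- (l powr s) * t) * (a + c * b t)
      + c * (LINT u|restrict_space lborel {0<..<T}.
          (if u < t then l powr s * exp (- (l powr s) * u) * (b t - b (t - u)) else 0))"
proof -
  let ?g = "\<lambda>u. l powr s * exp (- (l powr s) * u) * (b t - b (t - u))"
  have [measurable]: "b \<in> borel_measurable borel" using b by (rule borel_measurable_continuous_onI)
  have "continuous_on {0..t} ?g"
    by (intro continuous_intros continuous_on_compose2[OF b]) auto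
  then have si: "set_integrable lborel {0..t} ?g" by (rule borel_integrable_atLeastAtMost')
  have I: "integral {0..t} ?g = (LINT u|lborel. indicator {0..t} u *\<^sub>R ?g u)"
    using set_borel_integral_eq_integral(2)[OF si] by (simp add: set_lebesgue_integral_def)
  have m: "mild_deriv 0 l a c b t s = exp (- (l powr s) * t) * (a + c * b t) + c * integral {0..t} ?g"
    by (simp add: mild_deriv_def)
  have ae: "AE u in lborel. u \<noteq> 0 \<and> u \<noteq> t"
    using AE_lborel_singleton[of 0] AE_lborel_singleton[of t] by eventually_elim simp
  have "(LINT u|restrict_space lborel {0<..<t}. ?g u) = (LINT u|lborel. indicator {0<..<t} u *\<^sub>R ?g u)"
    by (subst integral_restrict_space) auto
  also have "\<dots> = integral {0..t} ?g"
    unfolding I by (rule integral_cong_AE) (use ae in \<open>auto elim!: AE_mp simp: indicator_def\<close>)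
  finally show "mild_deriv 0 l a c b t s = exp (- (l powr s) * t) * (a + c * b t)
      + c * (LINT u|restrict_space lborel {0<..<t}. ?g u)" by (simp only: m)
  have "(LINT u|restrict_space lborel {0<..<T}. (if u < t then ?g u else 0))
      = (LINT u|lborel. indicator {0<..<T} u *\<^sub>R (if u < t then ?g u else 0))"
    by (subst integral_restrict_space) auto
  also have "\<dots> = integral {0..t} ?g"
    unfolding I by (rule integral_cong_AE) (use ae t in \<open>auto elim!: AE_mp simp: indicator_def\<close>)
  finally show "mild_deriv 0 l a c b t s = exp (- (l powr s) * t) * (a + c * b t)
      + c * (LINT u|restrict_space lborel {0<..<T}. (if u < t then ?g u else 0))" by (simp only: m)
qed

lemma L2_tendsto_cong_AE:
  assumes f: "L2_tendsto M f g" and f': "\<And>n. f' n \<in> borel_measurable M"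
    and eq: "\<And>n. AE x in M. f n x = f' n x"
  shows "L2_tendsto M f' g"
proof -
  have mem: "f n \<in> L2 M" "g \<in> L2 M" for n using f by (auto simp: L2_tendsto_def)
  have [measurable]: "f n \<in> borel_measurable M" "g \<in> borel_measurable M" "f' n \<in> borel_measurable M" for n
    using mem f' by (auto simp: L2_def)
  have "L2_norm M (\<lambda>x. f n x - g x) = L2_norm M (\<lambda>x. f' n x - g x)" for n
  proof -
    have ae: "AE x in M. f n x - g x = f' n x - g x" using eq[of n] by eventually_elim simp
    show ?thesis unfolding L2_norm_def by (subst L2_inner_cong_AE[OF _ _ _ _ ae ae]) auto
  qed
  moreover have "f' n \<in> L2 M" for n by (rule L2_cong_AE[OF mem(1) f' eq])
  ultimately show ?thesis using f by (simp add: L2_tendsto_def)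
qed

text \<open>The points of \<open>I\<close> where \<open>f\<close> and \<open>g\<close> differ form
  an open set, which would contain a rational if it were nonempty.\<close>

lemma agree_on_open_rationals:
  fixes f g :: "real \<Rightarrow> real"
  assumes I: "open I" and f: "continuous_on I f" and g: "continuous_on I g"
    and eq: "\<And>q. q \<in> \<rat> \<inter> I \<Longrightarrow> f q = g q" and s: "s \<in> I"
  shows "f s = g s"
proof (rule ccontr)
  assume "f s \<noteq> g s"
  have "open (I \<inter> (\<lambda>x. f x - g x) -` (- {0}))"
    by (intro continuous_open_preimage continuous_on_diff f g I) auto
  moreover have "s \<in> I \<inter> (\<lambda>x. f x - g x) -` (- {0})" using \<open>f s \<noteq> g s\<close> s by simp
  ultimately obtain \<epsilon> where \<epsilon>: "\<epsilon> > 0" "\<And>x. dist x s < \<epsilon> \<Longrightarrow> x \<in> I \<inter> (\<lambda>x. f x - g x) -` (- {0})"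
    unfolding open_dist by blast
  obtain q where q: "q \<in> \<rat>" "s < q" "q < s + \<epsilon>"
    using Rats_dense_in_real[of s "s + \<epsilon>"] \<epsilon>(1) by auto
  then have "q \<in> I \<inter> (\<lambda>x. f x - g x) -` (- {0})" by (intro \<epsilon>(2)) (simp add: dist_real_def)
  with eq[of q] q(1) show False by simp
qed

lemma (in continuous_brownian) state_coefficient_eq_mild_deriv:
  fixes T :: real
  assumes T: "T > 0" and l: "l > 0" and z: "state_coefficient M T L a l m B\<^sub>0 z"
    and B0: "AE \<omega> in M. \<forall>t\<ge>0. B t \<omega> = B\<^sub>0 t \<omega>"
  shows "AE \<omega> in M. AE t in restrict_space lborel {0<..<T}. \<forall>s\<in>params L.
    z t s \<omega> = mild_deriv 0 l a (sqrt m) (\<lambda>t. B t \<omega>) t s"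
proof -
  let ?R = "restrict_space lborel {0<..<T}"
  interpret R: finite_measure ?R by (rule finite_measure_restrict_bounded) auto
  interpret P: pair_sigma_finite M ?R ..
  define f where "f t s \<omega> = mild_deriv 0 l a (sqrt m) (\<lambda>t. B t \<omega>) t s" for t s \<omega>
  have id [measurable]: "(\<lambda>u. u) \<in> borel_measurable ?R" by (simp add: measurable_restrict_space1)
  have [measurable]: "B r \<in> borel_measurable M" for r using B_L2 by (rule L2_measurable)
  \<comment> \<open>Step integrals see the paths only at times \<open>p k i \<ge> 0\<close>, where
    \<open>B\<close> and \<open>B\<^sub>0\<close> agree almost surely.\<close>
  have version: "has_ito_integral M B g X t" if "has_ito_integral M B\<^sub>0 g X t" for g X t
  proof -
    from that obtain n p c where
      p: "\<forall>k::nat. p k 0 = 0 \<and> p k (n k) = t \<and> mono_on {..n k} (p k)" and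
      lim: "L2_tendsto (restrict_space lborel {0..t}) (\<lambda>k. step_function (n k) (p k) (c k)) g"
        "L2_tendsto M (\<lambda>k. step_integral (n k) (p k) (c k) B\<^sub>0) X"
      unfolding has_ito_integral_def by blast
    have "L2_tendsto M (\<lambda>k. step_integral (n k) (p k) (c k) B) X"
    proof (rule L2_tendsto_cong_AE[OF lim(2)])
      show "step_integral (n k) (p k) (c k) B \<in> borel_measurable M" for k
        unfolding step_integral_def[abs_def] by measurable
      fix k
      have pos: "p k i \<ge> 0" if "i \<le> n k" for i
      proof -
        have "p k 0 \<le> p k i" using p that by (intro mono_onD[of "{..n k}" "p k"]) auto
        then show ?thesis using p by simp
      qed
      show "AE \<omega> in M. step_integral (n k) (p k) (c k) B\<^sub>0 \<omega> = step_integral (n k) (p k) (c k) B \<omega>"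
        using B0
      proof eventually_elim
        case (elim \<omega>)
        then show ?case unfolding step_integral_def by (intro sum.cong) (auto simp: pos)
      qed
    qed
    with p lim(1) show ?thesis unfolding has_ito_integral_def by blast
  qed
  have pointwise: "AE \<omega> in M. z t s \<omega> = f t s \<omega>" if s: "s \<in> params L" and t: "0 < t" "t < T" for s t
  proof -
    have "t \<in> {0..T}" using t by simp
    then obtain X where X: "has_ito_integral M B\<^sub>0 (\<lambda>\<tau>. exp (- (l powr s) * (t - \<tau>))) X t"
      and zX: "AE \<omega> in M. z t s \<omega> = a * exp (- (l powr s) * t) + sqrt m * X \<omega>"
      using z s unfolding state_coefficient_def by blast
    have "l powr s > 0" using l by simp
    from exponential_ito_integral[OF t(1) this version[OF X]] zX show ?thesis
      by eventually_elim (simp add: f_def mild_deriv_0_integral(1)[OF l cont t] algebra_simps)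
  qed
  \<comment> \<open>Exchanging the two almost-everywhere quantifiers requires the set of agreement
    to be measurable in the product; for \<open>f\<close> this comes from the cut-off form of the
    mild solution.\<close>
  have "AE \<omega> in M. AE t in ?R. z t s \<omega> = f t s \<omega>" if s: "s \<in> params L" for s
  proof (subst P.AE_commute)
    have "(\<lambda>p. (fst p, snd p)) \<in> measurable (M \<Otimes>\<^sub>M ?R) (M \<Otimes>\<^sub>M restrict_space borel {0..T})"
    proof (rule measurable_Pair[OF measurable_fst measurable_restrict_space2])
      show "snd \<in> borel_measurable (M \<Otimes>\<^sub>M ?R)" using measurable_compose[OF measurable_snd id] by simp
    qed (auto simp: space_pair_measure space_restrict_space)
    from measurable_compose[OF this, of "\<lambda>(\<omega>, t). z t s \<omega>" borel]
    have [measurable]: "(\<lambda>p. z (snd p) s (fst p)) \<in> borel_measurable (M \<Otimes>\<^sub>M ?R)"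
      using z s by (simp add: state_coefficient_def)
    have "(\<lambda>p. exp (- (l powr s) * snd p) * (a + sqrt m * B (snd p) (fst p))
      + sqrt m * (LINT u|?R. (if u < snd p then l powr s * exp (- (l powr s) * u) * (B (snd p) (fst p) - B (snd p - u) (fst p)) else 0)))
       \<in> borel_measurable (M \<Otimes>\<^sub>M ?R)" by measurable
    then have [measurable]: "(\<lambda>p. f (snd p) s (fst p)) \<in> borel_measurable (M \<Otimes>\<^sub>M ?R)"
      by (rule measurable_cong[THEN iffD1, rotated])
        (auto simp: f_def space_pair_measure space_restrict_space mild_deriv_0_integral(2)[OF l cont] cong: if_cong)
    show "{p \<in> space (M \<Otimes>\<^sub>M ?R). z (snd p) s (fst p) = f (snd p) s (fst p)} \<in> sets (M \<Otimes>\<^sub>M ?R)"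
      by measurable
    show "AE t in ?R. AE \<omega> in M. z t s \<omega> = f t s \<omega>"
      by (rule AE_I2, rule pointwise[OF s]) (auto simp: space_restrict_space)
  qed
  then have "AE \<omega> in M. \<forall>s\<in>\<rat> \<inter> params L. AE t in ?R. z t s \<omega> = f t s \<omega>"
    by (intro AE_ball_countable') (auto intro: countable_Int1 countable_rat)
  moreover have "AE \<omega> in M. \<forall>t\<in>{0..T}. C2_on (params L) (\<lambda>s. z t s \<omega>)"
    using z by (simp add: state_coefficient_def)
  ultimately show ?thesis
  proof eventually_elim
    case (elim \<omega>)
    \<comment> \<open>The countable quantifier over rational parameters is moved inside, so at
      almost every \<open>t\<close> the equality holds at all of them simultaneously.\<close>
    have "AE t in ?R. \<forall>s\<in>\<rat> \<inter> params L. z t s \<omega> = f t s \<omega>"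
      using elim(1) by (intro AE_ball_countable') (auto intro: countable_Int1 countable_rat)
    then show ?case
    proof (rule AE_mp, intro AE_I2 impI ballI)
      fix t s assume t: "t \<in> space ?R" and eq: "\<forall>s\<in>\<rat> \<inter> params L. z t s \<omega> = f t s \<omega>" and s: "s \<in> params L"
      have "continuous_on (params L) (\<lambda>s. z t s \<omega>)"
        using elim(2) t by (intro continuous_at_imp_continuous_on ballI field_differentiable_imp_continuous_at)
          (auto simp: C2_on_def space_restrict_space)
      moreover have "continuous_on (params L) (\<lambda>s. f t s \<omega>)"
        unfolding f_def by (intro continuous_at_imp_continuous_on ballI DERIV_isCont[OF mild_deriv_has_derivative[OF l cont]])
      ultimately show "z t s \<omega> = mild_deriv 0 l a (sqrt m) (\<lambda>t. B t \<omega>) t s"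
        using agree_on_open_rationals[OF open_params _ _ _ s, of "\<lambda>s. z t s \<omega>" "\<lambda>s. f t s \<omega>"] eq
        by (simp add: f_def)
    qed
  qed
qed

text \<open>The derivative is a pointwise limit of difference quotients along one fixed sequence of
  increments, small enough to keep \<open>s + h n\<close> in \<open>I\<close>.\<close>

lemma borel_measurable_deriv:
  fixes v :: "'a \<Rightarrow> real \<Rightarrow> real"
  assumes I: "open I" "s \<in> I" and v: "\<And>r. r \<in> I \<Longrightarrow> (\<lambda>t. v t r) \<in> borel_measurable K"
    and d: "\<And>t. t \<in> space K \<Longrightarrow> v t field_differentiable (at s)"
  shows "(\<lambda>t. deriv (v t) s) \<in> borel_measurable K"
proof -
  from I obtain \<epsilon> where \<epsilon>: "\<epsilon> > 0" "\<And>r. dist r s < \<epsilon> \<Longrightarrow> r \<in> I" unfolding open_dist by blast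
  define h where "h n = \<epsilon> / 2 / real (Suc n)" for n
  have h0: "h n > 0" "h n < \<epsilon>" for n
  proof -
    show "h n > 0" using \<epsilon>(1) by (simp add: h_def)
    have "h n \<le> \<epsilon> / 2 / 1" unfolding h_def using \<epsilon>(1) by (intro divide_left_mono) auto
    then show "h n < \<epsilon>" using \<epsilon>(1) by simp
  qed
  have "h \<longlonglongrightarrow> 0"
    using tendsto_mult_right_zero[OF LIMSEQ_Suc[OF lim_1_over_n], of "\<epsilon> / 2"] by (simp add: h_def[abs_def])
  then have lim: "filterlim h (at 0) sequentially"
    using h0(1) by (intro filterlim_atI always_eventually) (auto simp: less_imp_neq[symmetric])
  show ?thesis
  proof (rule borel_measurable_LIMSEQ_real)
    fix t assume "t \<in> space K"
    then have "(v t has_field_derivative deriv (v t) s) (at s)" using d by (simp add: field_differentiable_derivI)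
    then have "(\<lambda>h. (v t (s + h) - v t s) / h) \<midarrow>0\<rightarrow> deriv (v t) s" by (simp add: DERIV_def)
    from filterlim_compose[OF this lim] show "(\<lambda>n. (v t (s + h n) - v t s) / h n) \<longlonglongrightarrow> deriv (v t) s" .
  next
    fix n
    have "s + h n \<in> I" using h0[of n] by (intro \<epsilon>(2)) (simp add: dist_real_def)
    then show "(\<lambda>t. (v t (s + h n) - v t s) / h n) \<in> borel_measurable K"
      using v[of "s + h n"] v[OF I(2)] by simp
  qed
qed

text \<open>Agreement with a closed formula on an open set passes to the derivatives;
  \<open>F k\<close> is the derivative of order \<open>k\<close> of that formula.\<close>

lemma deriv_chain_on_open:
  fixes v :: "real \<Rightarrow> real"
  assumes I: "open I" "s \<in> I" and v: "\<And>r. r \<in> I \<Longrightarrow> v r = F 0 r"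
    and F: "\<And>k r. (F k has_real_derivative F (Suc k) r) (at r)"
  shows "deriv v s = F 1 s" "deriv (deriv v) s = F 2 s"
proof -
  have 1: "deriv v r = F 1 r" if "r \<in> I" for r
    using has_field_derivative_transform_within_open[OF F[of 0 r] I(1) that] v by (intro DERIV_imp_deriv) simp
  show "deriv v s = F 1 s" by (rule 1[OF I(2)])
  show "deriv (deriv v) s = F 2 s"
    using has_field_derivative_transform_within_open[OF F[of 1 s] I] 1
    by (intro DERIV_imp_deriv) (simp add: numeral_2_eq_2)
qed

theorem theorem4p4:
  fixes D :: "real set" and T \<alpha> :: real and L :: ereal
    and S :: "(real \<Rightarrow> real) set" and A Q :: "(real \<Rightarrow> real) \<Rightarrow> real \<Rightarrow> real"
    and e :: "nat \<Rightarrow> real \<Rightarrow> real" and l \<mu> :: "nat \<Rightarrow> real"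
    and M :: "'w measure" and F :: "real \<Rightarrow> 'w measure"
    and B :: "nat \<Rightarrow> real \<Rightarrow> 'w \<Rightarrow> real" and W :: "real \<Rightarrow> 'w \<Rightarrow> real \<Rightarrow> real"
    and y\<^sub>0 :: "real \<Rightarrow> real" and y\<^sub>D :: "real \<times> real \<Rightarrow> real" and \<Phi> :: "real \<Rightarrow> real"
    and z :: "nat \<Rightarrow> real \<Rightarrow> real \<Rightarrow> 'w \<Rightarrow> real"
  assumes D: "open D" "connected D" "bounded D" "D \<noteq> {}"
    and T: "T > 0"
    and A: "linear_operator (space_measure D) S A" "L2_dense (space_measure D) S"
      "self_adjoint (space_measure D) S A" "positive_operator (space_measure D) S A"
      "has_compact_inverse (space_measure D) S A"
    and e: "orthonormal_basis (space_measure D) e"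
      "\<And>j. e j \<in> S" "\<And>j. L2_eq (space_measure D) (A (e j)) (\<lambda>x. l j * e j x)"
    and l: "\<alpha> > 0" "\<alpha> < l 0" "mono l" "filterlim l at_top sequentially"
    and M: "prob_space M" "normal_filtration M F"
    and Q: "linear_operator (space_measure D) (L2 (space_measure D)) Q"
      "bounded_operator (space_measure D) (L2 (space_measure D)) Q"
      "self_adjoint (space_measure D) (L2 (space_measure D)) Q"
      "positive_semidefinite (space_measure D) (L2 (space_measure D)) Q"
      "\<And>j. L2_eq (space_measure D) (Q (e j)) (\<lambda>x. \<mu> j * e j x)" "summable \<mu>"
    and W: "Q_wiener_process M F (space_measure D) Q W"
    and B: "independent_brownian_motions M B"
      "\<And>t. t \<ge> 0 \<Longrightarrow> AE \<omega> in M.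
         L2_sums (space_measure D) (\<lambda>j x. sqrt (\<mu> j) * B j t \<omega> * e j x) (W t \<omega>)"
    and L: "L > 0"
    and \<Phi>: "penalty L \<Phi>"
    and y\<^sub>D: "y\<^sub>D \<in> L2 (cylinder_measure D T)"
    and y\<^sub>0: "y\<^sub>0 \<in> L2 (space_measure D)"
    and z: "\<And>j. state_coefficient M T L (L2_inner (space_measure D) y\<^sub>0 (e j)) (l j) (\<mu> j) (B j) (z j)"
  shows "AE \<omega> in M.
     (\<forall>s. optimal L (\<lambda>r. cost D T y\<^sub>D \<Phi> (state D T e z r \<omega>) r) s \<longrightarrow>
        (LINT t:{0<..<T}|lborel. LINT x:D|lborel.
           (state D T e z s \<omega> (x, t) - y\<^sub>D (x, t)) * state_ds D T e z s \<omega> (x, t))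
        + deriv \<Phi> s = 0) \<and>
     (\<forall>s\<in>params L.
        (LINT t:{0<..<T}|lborel. LINT x:D|lborel.
           (state D T e z s \<omega> (x, t) - y\<^sub>D (x, t)) * state_ds D T e z s \<omega> (x, t))
        + deriv \<Phi> s = 0 \<longrightarrow>
        (LINT t:{0<..<T}|lborel. LINT x:D|lborel.
           (state_ds D T e z s \<omega> (x, t))\<^sup>2
           + (state D T e z s \<omega> (x, t) - y\<^sub>D (x, t)) * state_dss D T e z s \<omega> (x, t))
        + deriv (deriv \<Phi>) s > 0 \<longrightarrow>
        optimal L (\<lambda>r. cost D T y\<^sub>D \<Phi> (state D T e z r \<omega>) r) s)"
proof -
  interpret prob_space M by (rule M)
  let ?N = "space_measure D" and ?R = "restrict_space lborel {0<..<T}"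
  define a c where "a j = L2_inner ?N y\<^sub>0 (e j)" and "c j = sqrt (\<mu> j)" for j
  have eL2: "e j \<in> L2 ?N" and eON: "L2_inner ?N (e i) (e j) = (if i = j then 1 else 0)" for i j
    using e(1) by (auto simp: orthonormal_basis_def)
  have lj: "\<alpha> \<le> l j" and lpos: "l j > 0" for j
    using l(1,2) monoD[OF l(3), of 0 j] by auto
  \<comment> \<open>Testing the semidefiniteness of \<open>Q\<close> on the normalised eigenfunction
    \<open>e j\<close> returns its eigenvalue. Nonnegativity makes \<open>(c j)\<^sup>2\<close>
    equal to \<open>\<mu> j\<close>.\<close>
  have \<mu>: "\<mu> j \<ge> 0" for j
  proof -
    have Qe: "Q (e j) \<in> L2 ?N" using Q(1) eL2[of j] by (auto simp: linear_operator_def)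
    have "0 \<le> L2_inner ?N (Q (e j)) (e j)" using Q(4) eL2[of j] by (simp add: positive_semidefinite_def)
    also have "\<dots> = L2_inner ?N (\<lambda>x. \<mu> j * e j x) (e j)"
      using Q(5)[of j] Qe eL2[of j] L2_scale[OF eL2[of j], of "\<mu> j"]
      by (intro L2_inner_cong_AE) (auto simp: L2_def L2_eq_def)
    also have "\<dots> = \<mu> j" using eON[of j j] by (simp add: L2_inner_scale_left)
    finally show ?thesis .
  qed
  have summ: "summable (\<lambda>j. (a j)\<^sup>2 + (c j)\<^sup>2)"
    using summable_orthonormal_coefficients[OF eL2 eON y\<^sub>0] Q(6) \<mu>
    by (intro summable_add) (simp_all add: a_def c_def)
  have "\<forall>j. \<exists>B'. continuous_brownian M B' \<and> (AE \<omega> in M. \<forall>t\<ge>0. B' t \<omega> = B j t \<omega>)"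
    using B(1) brownian_motion_continuous_version by (auto simp: independent_brownian_motions_def)
  from choice[OF this] obtain B' where
    B'_spec: "\<forall>j. continuous_brownian M (B' j) \<and> (AE \<omega> in M. \<forall>t\<ge>0. B' j t \<omega> = B j t \<omega>)" ..
  have B': "continuous_brownian M (B' j)" and eqB: "AE \<omega> in M. \<forall>t\<ge>0. B' j t \<omega> = B j t \<omega>" for j
    using spec[OF B'_spec, of j] by simp_all
  let ?b = "\<lambda>j \<omega> t. B' j t \<omega>"
  have contB: "continuous_on UNIV (?b j \<omega>)" for j \<omega>
    using B'[of j] by (rule continuous_brownian.cont)
  \<comment> \<open>There are countably many modes, so one null set serves all of them.\<close>
  have "AE \<omega> in M. \<forall>j. AE t in ?R. \<forall>s\<in>params L. z j t s \<omega> = mild_deriv 0 (l j) (a j) (c j) (?b j \<omega>) t s"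
    unfolding AE_all_countable a_def c_def
    by (intro allI continuous_brownian.state_coefficient_eq_mild_deriv[OF B' T lpos z eqB])
  moreover have "AE \<omega> in M. \<forall>j. \<forall>t\<in>{0..T}. C2_on (params L) (\<lambda>s. z j t s \<omega>)"
    unfolding AE_all_countable using z by (simp add: state_coefficient_def)
  moreover have "AE \<omega> in M. (\<Sum>j. \<integral>\<^sup>+t. energy_density T (a j) (c j) (?b j \<omega>) t \<partial>?R) < \<infinity>"
    by (rule energy_summable_AE[OF M(1) B' T summ])
  ultimately show ?thesis using AE_space
  proof eventually_elim
    case (elim \<omega>)
    define H where "H j = path_majorant T (a j) (c j) (?b j \<omega>)" for j
    define f where "f j k t s = mild_deriv k (l j) (a j) (c j) (?b j \<omega>) t s" for j k t s
    let ?v = "\<lambda>j t r. z j t r \<omega>"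
    let ?G = "\<lambda>j. \<integral>\<^sup>+t. energy_density T (a j) (c j) (?b j \<omega>) t \<partial>?R"
    have fin: "?G j < \<infinity>" for j
    proof -
      have "?G j \<le> (\<Sum>j. ?G j)" using sum_le_suminf[of ?G "{j}"] by simp
      then show ?thesis using elim(3) by (rule le_less_trans)
    qed
    have HL2: "H j \<in> L2 ?R" for j unfolding H_def by (rule path_majorant_L2(1)[OF contB fin])
    have Hsum: "summable (\<lambda>j. L2_inner ?R (H j) (H j))"
    proof (rule summable_suminf_not_top)
      have "(\<Sum>j. ennreal (L2_inner ?R (H j) (H j))) \<le> (\<Sum>j. ?G j)"
        unfolding H_def by (intro suminf_le path_majorant_L2(2)[OF contB fin]) auto
      then show "(\<Sum>j. ennreal (L2_inner ?R (H j) (H j))) \<noteq> top" using elim(3) by auto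
    qed (simp add: L2_inner_self_nonneg)
    have H0: "0 \<le> H j t" for j t
      unfolding H_def path_majorant_def by (auto intro!: add_nonneg_nonneg mult_nonneg_nonneg Bochner_Integration.integral_nonneg)
    have fderiv: "(f j k t has_real_derivative f j (Suc k) t s) (at s)" for j k t s
      unfolding f_def[abs_def] by (rule mild_deriv_has_derivative[OF lpos contB])
    have good: "AE t in ?R. 0 < t \<and> t < T \<and> (\<forall>s\<in>params L. ?v j t s = f j 0 t s) \<and>
        (c j = 0 \<or> integrable ?R (\<lambda>u. u powr (-7/4) * (?b j \<omega> t - ?b j \<omega> (t - u))\<^sup>2))" for j
      using elim(1)[rule_format, of j] path_majorant_L2(3)[OF contB fin, of j] AE_space
      by eventually_elim (auto simp: f_def space_restrict_space)
    have meas0: "(\<lambda>t. ?v j t s) \<in> borel_measurable ?R" if "s \<in> params L" for j s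
    proof -
      have "(\<lambda>(\<omega>, t). z j t s \<omega>) \<in> borel_measurable (M \<Otimes>\<^sub>M restrict_space borel {0..T})"
        using z[of j] that by (simp add: state_coefficient_def)
      from measurable_compose[OF measurable_Pair1'[OF elim(4)] this]
      have *: "(\<lambda>t. ?v j t s) \<in> borel_measurable (restrict_space borel {0..T})" by simp
      have "(\<lambda>t. t) \<in> measurable ?R (restrict_space borel {0..T})"
        by (rule measurable_restrict_space2) (auto simp: space_restrict_space measurable_restrict_space1)
      from measurable_compose[OF this *] show ?thesis .
    qed
    \<comment> \<open>Measurability of the derivatives rests on differentiability at every
      \<open>t\<close>, supplied by \<open>C2_on\<close>; the closed formula is known at almost
      every \<open>t\<close>.\<close>
    have C2: "C2_on (params L) (?v j t)" if "t \<in> space ?R" for j t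
      using elim(2) that by (auto simp: space_restrict_space)
    have meas1: "(\<lambda>t. deriv (?v j t) s) \<in> borel_measurable ?R" if "s \<in> params L" for j s
      using C2 that by (intro borel_measurable_deriv[OF open_params that meas0]) (auto simp: C2_on_def)
    have meas2: "(\<lambda>t. deriv (deriv (?v j t)) s) \<in> borel_measurable ?R" if "s \<in> params L" for j s
      using C2 that by (intro borel_measurable_deriv[OF open_params that meas1]) (auto simp: C2_on_def)
    have bound: "\<exists>C\<ge>0. \<forall>\<^sub>F r in nhds s. \<forall>j. AE t in ?R.
        \<bar>?v j t r\<bar> \<le> C * \<bar>H j t\<bar> \<and> \<bar>deriv (?v j t) r\<bar> \<le> C * \<bar>H j t\<bar> \<and> \<bar>deriv (deriv (?v j t)) r\<bar> \<le> C * \<bar>H j t\<bar> \<and>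
        \<bar>?v j t r - ?v j t s - (r - s) * deriv (?v j t) s\<bar> \<le> C * (r - s)\<^sup>2 * \<bar>H j t\<bar> \<and>
        \<bar>deriv (?v j t) r - deriv (?v j t) s - (r - s) * deriv (deriv (?v j t)) s\<bar> \<le> C * (r - s)\<^sup>2 * \<bar>H j t\<bar>"
      if s: "s \<in> params L" for s
    proof -
      from open_params[of L] s obtain \<epsilon> where \<epsilon>: "\<epsilon> > 0" "\<And>r. dist r s < \<epsilon> \<Longrightarrow> r \<in> params L"
        unfolding open_dist by blast
      \<comment> \<open>The closed interval stays inside \<open>params L\<close>, so its left end is
        positive, as the uniform bound \<open>mild_deriv_bound\<close> requires.\<close>
      let ?J = "{s - \<epsilon> / 2..s + \<epsilon> / 2}"
      have J: "r \<in> params L" if "r \<in> ?J" for r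
        using that \<epsilon>(1) by (intro \<epsilon>(2)) (auto simp: dist_real_def)
      have "s - \<epsilon> / 2 > 0" using J[of "s - \<epsilon> / 2"] \<epsilon>(1) by (simp add: params_def)
      then have "\<forall>k. \<exists>C. C \<ge> 0 \<and> (\<forall>l\<ge>\<alpha>. \<forall>s\<in>?J. \<forall>a c b t. continuous_on UNIV b \<longrightarrow> 0 < t \<longrightarrow> t < T \<longrightarrow>
          c = 0 \<or> integrable ?R (\<lambda>u. u powr (-7/4) * (b t - b (t - u))\<^sup>2) \<longrightarrow>
          \<bar>mild_deriv k l a c b t s\<bar> \<le> C * path_majorant T a c b t)"
        unfolding path_majorant_def by (intro allI mild_deriv_bound l(1))
      from choice[OF this] obtain C where C_spec: "\<forall>k. C k \<ge> 0 \<and> (\<forall>l\<ge>\<alpha>. \<forall>s\<in>?J. \<forall>a c b t.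
          continuous_on UNIV b \<longrightarrow> 0 < t \<longrightarrow> t < T \<longrightarrow>
          c = 0 \<or> integrable ?R (\<lambda>u. u powr (-7/4) * (b t - b (t - u))\<^sup>2) \<longrightarrow>
          \<bar>mild_deriv k l a c b t s\<bar> \<le> C k * path_majorant T a c b t)" ..
      have C: "C k \<ge> 0" for k using spec[OF C_spec, of k] by simp
      note CH = conjunct2[OF spec[OF C_spec], rule_format]
      \<comment> \<open>One constant for the orders 0 to 3; order 3 enters through the Taylor
        remainder of the first derivative.\<close>
      define C' where "C' = C 0 + C 1 + C 2 + C 3"
      show ?thesis
      proof (intro exI[of _ C'] conjI)
        show "C' \<ge> 0" unfolding C'_def by (intro add_nonneg_nonneg C)
        have "\<forall>\<^sub>F r in nhds s. r \<in> {s - \<epsilon> / 2<..<s + \<epsilon> / 2}"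
          by (rule eventually_nhds_in_open) (use \<epsilon>(1) in auto)
        then show "\<forall>\<^sub>F r in nhds s. \<forall>j. AE t in ?R.
          \<bar>?v j t r\<bar> \<le> C' * \<bar>H j t\<bar> \<and> \<bar>deriv (?v j t) r\<bar> \<le> C' * \<bar>H j t\<bar> \<and> \<bar>deriv (deriv (?v j t)) r\<bar> \<le> C' * \<bar>H j t\<bar> \<and>
          \<bar>?v j t r - ?v j t s - (r - s) * deriv (?v j t) s\<bar> \<le> C' * (r - s)\<^sup>2 * \<bar>H j t\<bar> \<and>
          \<bar>deriv (?v j t) r - deriv (?v j t) s - (r - s) * deriv (deriv (?v j t)) s\<bar> \<le> C' * (r - s)\<^sup>2 * \<bar>H j t\<bar>"
        proof eventually_elim
          case (elim r)
          then have r: "r \<in> ?J" "r \<in> params L" and sJ: "s \<in> ?J" using J[of r] \<epsilon>(1) by auto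
          show ?case
          proof
            fix j
            show "AE t in ?R.
              \<bar>?v j t r\<bar> \<le> C' * \<bar>H j t\<bar> \<and> \<bar>deriv (?v j t) r\<bar> \<le> C' * \<bar>H j t\<bar> \<and> \<bar>deriv (deriv (?v j t)) r\<bar> \<le> C' * \<bar>H j t\<bar> \<and>
              \<bar>?v j t r - ?v j t s - (r - s) * deriv (?v j t) s\<bar> \<le> C' * (r - s)\<^sup>2 * \<bar>H j t\<bar> \<and>
              \<bar>deriv (?v j t) r - deriv (?v j t) s - (r - s) * deriv (deriv (?v j t)) s\<bar> \<le> C' * (r - s)\<^sup>2 * \<bar>H j t\<bar>"
              using good[of j]
            proof eventually_elim
              case (elim t)
              have fk: "\<bar>f j k t x\<bar> \<le> C' * \<bar>H j t\<bar>" if "x \<in> ?J" "k \<in> {0, 1, 2, 3}" for k x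
              proof -
                have "\<bar>f j k t x\<bar> \<le> C k * H j t"
                  unfolding f_def H_def using elim that(1) by (intro CH lj contB) auto
                also have "\<dots> \<le> C' * H j t"
                  using that(2) C[of 0] C[of 1] C[of 2] C[of 3] H0[of j t]
                  by (intro mult_right_mono) (auto simp: C'_def)
                finally show ?thesis using H0[of j t] by simp
              qed
              \<comment> \<open>At such a time the formula holds for all parameters in an open set,
                so the derivatives of \<open>z\<close> are those of the mild solution.\<close>
              have v: "?v j t x = f j 0 t x" "deriv (?v j t) x = f j 1 t x" "deriv (deriv (?v j t)) x = f j 2 t x"
                if "x \<in> params L" for x
                using elim that deriv_chain_on_open[OF open_params that, of "?v j t" "\<lambda>k. f j k t"] fderiv by auto
              have taylor: "\<bar>f j k t r - f j k t s - (r - s) * f j (Suc k) t s\<bar> \<le> C' * (r - s)\<^sup>2 * \<bar>H j t\<bar>"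
                if "k \<in> {0, 1}" for k
              proof -
                have "\<bar>f j k t r - f j k t s - (r - s) * f j (Suc k) t s\<bar> \<le> (C' * \<bar>H j t\<bar>) * (r - s)\<^sup>2"
                  using that by (intro taylor_quadratic_bound[OF _ sJ r(1) fderiv fderiv] fk) auto
                then show ?thesis by (simp add: mult_ac)
              qed
              show ?case
                unfolding v[OF r(2)] v[OF s] using fk[OF r(1)] taylor[of 0] taylor[of 1]
                by (simp add: numeral_2_eq_2)
            qed
          qed
        qed
      qed
    qed
    have "L2_taylor (cylinder_measure D T) (\<lambda>s. state D T e z s \<omega>) (state_ds D T e z s \<omega>) s"
      and "L2_taylor (cylinder_measure D T) (\<lambda>s. state_ds D T e z s \<omega>) (state_dss D T e z s \<omega>) s"
      if s: "s \<in> params L" for s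
      by (rule state_taylor[OF D(1,3) e(1) open_params _ _ _ HL2 Hsum _ s]; (erule meas0 meas1 meas2 bound))+
    \<comment> \<open>With the realisation fixed, only the deterministic conditions on the cost
      remain.\<close>
    then show ?case
      using \<Phi> by (intro cost_conditions[OF D(1) _ y\<^sub>D]) (simp_all add: penalty_def)
  qed
qed

end
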